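(* Let $f_1$ be a Casimir function on $M_1$ and let $(M=M_1\times_{f_1}M_2,\Pi^{\nu_1},\tilde g^{f_1})$ be a Riemannian Poisson warped product space. If $M$ has positive sectional curvature, then $M_1$ and $M_2$ are Poisson manifolds of positive sectional curvature.
   Context: Everything is smooth. For a bivector field $\Pi$ on a manifold $N$, the sharp map $\sharp_\Pi:T^*N\to TN$ is defined by $\eta(\sharp_\Pi(\omega))=\Pi(\omega,\eta)$, and the bracket on one-forms is $[\omega,\eta]_\Pi=\mathcal L_{\sharp_\Pi(\omega)}\eta-\mathcal L_{\sharp_\Pi(\eta)}\omega-d(\Pi(\omega,\eta))$. $(N,\Pi)$ is a Poisson manifold (and $\Pi$ a Poisson tensor) if the Schouten bracket $[\Pi,\Pi]_S$ vanishes; then $\{f,g\}=\Pi(df,dg)$. A function $f$ is Casimir if $\{f,g\}=0$ for all smooth $g$. For a metric $\bar g$ on $N$, its cometric $\tilde g$ is the induced metric on $T^*N$. A contravariant connection $\mathcal D$ is an $\mathbb R$-bilinear map on one-forms with $\mathcal D_{f\omega}\eta=f\mathcal D_\omega\eta$ and $\mathcal D_\omega(f\eta)=f\mathcal D_\omega\eta+\sharp_\Pi(\omega)(f)\eta$. The contravariant Levi-Civita connection of $(\tilde g,\Pi)$ is the unique one satisfying $\mathcal D_\omega\eta-\mathcal D_\eta\omega=[\omega,\eta]_\Pi$ and $\sharp_\Pi(\omega)\tilde g(\eta,\gamma)=\tilde g(\mathcal D_\omega\eta,\gamma)+\tilde g(\eta,\mathcal D_\omega\gamma)$. Its curvature is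 $\mathcal R(\omega,\eta)\gamma=\mathcal D_\omega\mathcal D_\eta\gamma-\mathcal D_\eta\mathcal D_\omega\gamma-\mathcal D_{[\omega,\eta]_\Pi}\gamma$, and the sectional curvature is $$\mathcal K(\omega,\eta)=\frac{\tilde g(\mathcal R(\omega,\eta)\eta,\omega)}{\tilde g(\omega,\omega)\tilde g(\eta,\eta)-\tilde g(\omega,\eta)^2}$$ for linearly independent covectors $\omega,\eta$ at a point. "Sectional curvature of $M$, $M_1$, $M_2$" always means this contravariant sectional curvature of $(\tilde g^{f_1},\Pi^{\nu_1})$, $(\tilde g_1,\Pi_1)$, $(\tilde g_2,\Pi_2)$ respectively; it is positive if it is positive for all such pairs at all points. Warped product: for $i=1,2$ let $(M_i,\Pi_i)$ be a Poisson manifold with metric $\bar g_i$ and cometric $\tilde g_i$. Let $f_1$ be a positive smooth function and $\nu_1$ a smooth function on $M_1$. Put $M=M_1\times M_2$ with projections $\pi_1,\pi_2$. The superscript $h$ denotes pull-back by $\pi_1$ of functions and forms from $M_1$, and $v$ denotes pull-back by $\pi_2$ from $M_2$. $M$ carries the warped metric $\bar g^{f_1}=\pi_1^*\bar g_1+(f_1^h)^2\pi_2^*\bar g_2$, whose cometric is $\tilde g^{f_1}=\tilde g_1^h+\frac1{(f_1^h)^2}\tilde g_2^v$, and the bivector field $\Pi^{\nu_1}=\Pi_1+\nu_1\Pi_2$, i.e. $\Pi^{\nu_1}(\omega_1^h+\omega_2^v,\gamma_1^h+\gamma_2^v)=\Pi_1(\omega_1,\gamma_1)^h+\nu_1^h\Pi_2(\omega_2,\gamma_2)^v$.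 It is called a Riemannian Poisson warped product space when the metrics $\bar g_1,\bar g_2$ (hence $\bar g^{f_1}$) are Riemannian, i.e. positive definite, and $\Pi^{\nu_1}$ is a Poisson tensor. *)

theory Defs
  imports "HOL-Analysis.Analysis"
begin

section \<open>Smooth manifolds\<close>

text \<open>
  The C^n condition for a map on an open subset of a finite-dimensional normed space: all iterated
  directional derivatives up to order n exist, are Frechet differentiable below order n, and are
  continuous.
\<close>

primrec ck_on :: "nat \<Rightarrow> 'e::real_normed_vector set \<Rightarrow> ('e \<Rightarrow> 'f::real_normed_vector) \<Rightarrow> bool" where
  "ck_on 0 S f \<longleftrightarrow> continuous_on S f"
| "ck_on (Suc n) S f \<longleftrightarrow>
     (\<forall>x\<in>S. f differentiable (at x)) \<and> (\<forall>v. ck_on n S (\<lambda>x. frechet_derivative f (at x) v))"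

definition smooth_on :: "'e::real_normed_vector set \<Rightarrow> ('e \<Rightarrow> 'f::real_normed_vector) \<Rightarrow> bool" where
  "smooth_on S f \<longleftrightarrow> (\<forall>n. ck_on n S f)"

text \<open>
  A manifold is a topological space (the type 'a) with an atlas in which every point p has a
  preferred chart, with domain \<open>chart_dom M p\<close> and coordinate map \<open>chart M p\<close>, into a model space 'e.
  Any atlas can be presented in this way. The model space is a normed space that
  \<open>smooth_manifold\<close> requires to be finite-dimensional, i.e. a copy of R^n with n = 0 allowed.
\<close>

datatype ('a, 'e) manifold =
  Manifold (chart_dom: "'a \<Rightarrow> 'a set") (chart: "'a \<Rightarrow> 'a \<Rightarrow> 'e")

definition chart_inv :: "('a, 'e) manifold \<Rightarrow> 'a \<Rightarrow> 'e \<Rightarrow> 'a" where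
  "chart_inv M c = inv_into (chart_dom M c) (chart M c)"

definition smooth_manifold ::
    "('a::{t2_space,second_countable_topology}, 'e::real_normed_vector) manifold \<Rightarrow> bool" where
  "smooth_manifold M \<longleftrightarrow>
     (\<exists>B::'e set. finite B \<and> span B = UNIV) \<and>
     (\<forall>c. c \<in> chart_dom M c \<and> open (chart_dom M c) \<and> open (chart M c ` chart_dom M c) \<and>
          homeomorphism (chart_dom M c) (chart M c ` chart_dom M c) (chart M c) (chart_inv M c)) \<and>
     (\<forall>c d. smooth_on (chart M c ` (chart_dom M c \<inter> chart_dom M d)) (chart M d \<circ> chart_inv M c))"

definition smooth_function :: "('a, 'e::real_normed_vector) manifold \<Rightarrow> ('a \<Rightarrow> real) \<Rightarrow> bool" where
  "smooth_function M f \<longleftrightarrow> (\<forall>c. smooth_on (chart M c ` chart_dom M c) (f \<circ> chart_inv M c))"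


section \<open>Tensor fields\<close>

text \<open>
  The tangent space at p is identified with the model space 'e by means of the preferred chart at p,
  and the cotangent space with the dual of 'e. A vector field is thus a function \<open>'a \<Rightarrow> 'e\<close>, and a
  one-form a function \<open>'a \<Rightarrow> 'e covec\<close>. As the preferred chart varies with the point, smoothness
  and derivatives of a tensor field only make sense for its coordinate representation in one fixed
  chart. The map \<open>coord_change M p c d\<close> takes components of tangent vectors at p with respect to
  the chart at c to components with respect to the chart at d.
\<close>

type_synonym 'e covec = "'e \<Rightarrow>\<^sub>L real"

definition coord_change ::
    "('a, 'e::real_normed_vector) manifold \<Rightarrow> 'a \<Rightarrow> 'a \<Rightarrow> 'a \<Rightarrow> 'e \<Rightarrow>\<^sub>L 'e" where
  "coord_change M p c d =
     Blinfun (frechet_derivative (chart M d \<circ> chart_inv M c) (at (chart M c p)))"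

definition dual_map ::
    "('d::real_normed_vector \<Rightarrow>\<^sub>L 'e::real_normed_vector) \<Rightarrow> 'e covec \<Rightarrow>\<^sub>L 'd covec" where
  "dual_map T = Blinfun (\<lambda>\<alpha>. \<alpha> o\<^sub>L T)"

definition bilinear_pullback ::
    "('d::real_normed_vector \<Rightarrow>\<^sub>L 'e::real_normed_vector) \<Rightarrow> ('e \<Rightarrow>\<^sub>L 'e \<Rightarrow>\<^sub>L real) \<Rightarrow> 'd \<Rightarrow>\<^sub>L 'd \<Rightarrow>\<^sub>L real" where
  "bilinear_pullback T b = Blinfun (\<lambda>v. b (T v) o\<^sub>L T)"

definition vector_rep ::
    "('a, 'e::real_normed_vector) manifold \<Rightarrow> 'a \<Rightarrow> ('a \<Rightarrow> 'e) \<Rightarrow> 'e \<Rightarrow> 'e" where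
  "vector_rep M c X x = (let p = chart_inv M c x in coord_change M p p c (X p))"

definition form_rep ::
    "('a, 'e::real_normed_vector) manifold \<Rightarrow> 'a \<Rightarrow> ('a \<Rightarrow> 'e covec) \<Rightarrow> 'e \<Rightarrow> 'e covec" where
  "form_rep M c \<omega> x = (let p = chart_inv M c x in dual_map (coord_change M p c p) (\<omega> p))"

definition metric_rep ::
    "('a, 'e::real_normed_vector) manifold \<Rightarrow> 'a \<Rightarrow> ('a \<Rightarrow> 'e \<Rightarrow>\<^sub>L 'e \<Rightarrow>\<^sub>L real) \<Rightarrow>
     'e \<Rightarrow> 'e \<Rightarrow>\<^sub>L 'e \<Rightarrow>\<^sub>L real" where
  "metric_rep M c g x = (let p = chart_inv M c x in bilinear_pullback (coord_change M p c p) (g p))"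

definition bivector_rep ::
    "('a, 'e::real_normed_vector) manifold \<Rightarrow> 'a \<Rightarrow> ('a \<Rightarrow> 'e covec \<Rightarrow>\<^sub>L 'e covec \<Rightarrow>\<^sub>L real) \<Rightarrow>
     'e \<Rightarrow> 'e covec \<Rightarrow>\<^sub>L 'e covec \<Rightarrow>\<^sub>L real" where
  "bivector_rep M c P x =
     (let p = chart_inv M c x in bilinear_pullback (dual_map (coord_change M p p c)) (P p))"

definition one_form :: "('a, 'e::real_normed_vector) manifold \<Rightarrow> ('a \<Rightarrow> 'e covec) \<Rightarrow> bool" where
  "one_form M \<omega> \<longleftrightarrow> (\<forall>c. smooth_on (chart M c ` chart_dom M c) (form_rep M c \<omega>))"

definition riemannian_metric ::
    "('a, 'e::real_normed_vector) manifold \<Rightarrow> ('a \<Rightarrow> 'e \<Rightarrow>\<^sub>L 'e \<Rightarrow>\<^sub>L real) \<Rightarrow> bool" where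
  "riemannian_metric M g \<longleftrightarrow>
     (\<forall>c. smooth_on (chart M c ` chart_dom M c) (metric_rep M c g)) \<and>
     (\<forall>p v w. g p v w = g p w v) \<and>
     (\<forall>p v. v \<noteq> 0 \<longrightarrow> g p v v > 0)"

definition bivector_field ::
    "('a, 'e::real_normed_vector) manifold \<Rightarrow> ('a \<Rightarrow> 'e covec \<Rightarrow>\<^sub>L 'e covec \<Rightarrow>\<^sub>L real) \<Rightarrow> bool" where
  "bivector_field M P \<longleftrightarrow>
     (\<forall>c. smooth_on (chart M c ` chart_dom M c) (bivector_rep M c P)) \<and>
     (\<forall>p \<alpha>. P p \<alpha> \<alpha> = 0)"

text \<open>The cometric at a point: transport of the metric along its musical isomorphism.\<close>

definition metric_sharp ::
    "('e::real_normed_vector \<Rightarrow>\<^sub>L 'e \<Rightarrow>\<^sub>L real) \<Rightarrow> 'e covec \<Rightarrow> 'e" where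
  "metric_sharp b \<alpha> = (THE v. \<forall>w. b v w = \<alpha> w)"

definition cometric ::
    "('a \<Rightarrow> 'e::real_normed_vector \<Rightarrow>\<^sub>L 'e \<Rightarrow>\<^sub>L real) \<Rightarrow> 'a \<Rightarrow> 'e covec \<Rightarrow> 'e covec \<Rightarrow> real" where
  "cometric g p \<alpha> \<beta> = g p (metric_sharp (g p) \<alpha>) (metric_sharp (g p) \<beta>)"


section \<open>Differential calculus\<close>

definition differential ::
    "('a, 'e::real_normed_vector) manifold \<Rightarrow> ('a \<Rightarrow> real) \<Rightarrow> 'a \<Rightarrow> 'e covec" where
  "differential M f p = Blinfun (frechet_derivative (f \<circ> chart_inv M p) (at (chart M p p)))"

text \<open>
  The Lie derivative of a one-form, in coordinates
  \<open>(L_X \<eta>)_i = X^j \<partial>_j \<eta>_i + \<eta>_j \<partial>_i X^j\<close>, computed in the preferred chart at p.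
\<close>

definition lie_form ::
    "('a, 'e::real_normed_vector) manifold \<Rightarrow> ('a \<Rightarrow> 'e) \<Rightarrow> ('a \<Rightarrow> 'e covec) \<Rightarrow> 'a \<Rightarrow> 'e covec" where
  "lie_form M X \<eta> p = Blinfun (\<lambda>v.
     frechet_derivative (form_rep M p \<eta>) (at (chart M p p)) (X p) v +
     \<eta> p (frechet_derivative (vector_rep M p X) (at (chart M p p)) v))"

definition sharp ::
    "('a \<Rightarrow> 'e::real_normed_vector covec \<Rightarrow>\<^sub>L 'e covec \<Rightarrow>\<^sub>L real) \<Rightarrow> ('a \<Rightarrow> 'e covec) \<Rightarrow> 'a \<Rightarrow> 'e" where
  "sharp P \<omega> p = (THE v. \<forall>\<eta>. blinfun_apply \<eta> v = P p (\<omega> p) \<eta>)"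

definition form_bracket ::
    "('a, 'e::real_normed_vector) manifold \<Rightarrow> ('a \<Rightarrow> 'e covec \<Rightarrow>\<^sub>L 'e covec \<Rightarrow>\<^sub>L real) \<Rightarrow>
     ('a \<Rightarrow> 'e covec) \<Rightarrow> ('a \<Rightarrow> 'e covec) \<Rightarrow> 'a \<Rightarrow> 'e covec" where
  "form_bracket M P \<omega> \<eta> p =
     lie_form M (sharp P \<omega>) \<eta> p - lie_form M (sharp P \<eta>) \<omega> p
     - differential M (\<lambda>q. P q (\<omega> q) (\<eta> q)) p"


section \<open>Poisson structures\<close>

text \<open>
  The Schouten bracket of two bivector fields, evaluated on three covectors at p. In coordinates it is
  the cyclic sum over (i,j,k) of \<open>P^{il} \<partial>_l Q^{jk} + Q^{il} \<partial>_l P^{jk}\<close>;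
  other conventions differ by a global sign.
\<close>

definition schouten ::
    "('a, 'e::real_normed_vector) manifold \<Rightarrow>
     ('a \<Rightarrow> 'e covec \<Rightarrow>\<^sub>L 'e covec \<Rightarrow>\<^sub>L real) \<Rightarrow> ('a \<Rightarrow> 'e covec \<Rightarrow>\<^sub>L 'e covec \<Rightarrow>\<^sub>L real) \<Rightarrow>
     'a \<Rightarrow> 'e covec \<Rightarrow> 'e covec \<Rightarrow> 'e covec \<Rightarrow> real" where
  "schouten M P Q p \<alpha> \<beta> \<gamma> =
     (let D = (\<lambda>A B \<xi> \<eta> \<zeta>.
        frechet_derivative (bivector_rep M p B) (at (chart M p p)) (sharp A (\<lambda>_. \<xi>) p) \<eta> \<zeta>)
      in D P Q \<alpha> \<beta> \<gamma> + D P Q \<beta> \<gamma> \<alpha> + D P Q \<gamma> \<alpha> \<beta>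
         + D Q P \<alpha> \<beta> \<gamma> + D Q P \<beta> \<gamma> \<alpha> + D Q P \<gamma> \<alpha> \<beta>)"

definition poisson_tensor ::
    "('a, 'e::real_normed_vector) manifold \<Rightarrow> ('a \<Rightarrow> 'e covec \<Rightarrow>\<^sub>L 'e covec \<Rightarrow>\<^sub>L real) \<Rightarrow> bool" where
  "poisson_tensor M P \<longleftrightarrow>
     bivector_field M P \<and> (\<forall>p \<alpha> \<beta> \<gamma>. schouten M P P p \<alpha> \<beta> \<gamma> = 0)"

definition poisson_bracket ::
    "('a, 'e::real_normed_vector) manifold \<Rightarrow> ('a \<Rightarrow> 'e covec \<Rightarrow>\<^sub>L 'e covec \<Rightarrow>\<^sub>L real) \<Rightarrow>
     ('a \<Rightarrow> real) \<Rightarrow> ('a \<Rightarrow> real) \<Rightarrow> 'a \<Rightarrow> real" where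
  "poisson_bracket M P f g p = P p (differential M f p) (differential M g p)"

definition casimir ::
    "('a, 'e::real_normed_vector) manifold \<Rightarrow> ('a \<Rightarrow> 'e covec \<Rightarrow>\<^sub>L 'e covec \<Rightarrow>\<^sub>L real) \<Rightarrow>
     ('a \<Rightarrow> real) \<Rightarrow> bool" where
  "casimir M P f \<longleftrightarrow>
     smooth_function M f \<and> (\<forall>g. smooth_function M g \<longrightarrow> (\<forall>p. poisson_bracket M P f g p = 0))"


section \<open>Contravariant connections and curvature\<close>

text \<open>
  Only the values of D on smooth one-forms matter. For a vector field X, the derivative X(f) at p
  is \<open>differential M f p (X p)\<close>.
\<close>

definition contravariant_connection ::
    "('a, 'e::real_normed_vector) manifold \<Rightarrow> ('a \<Rightarrow> 'e covec \<Rightarrow>\<^sub>L 'e covec \<Rightarrow>\<^sub>L real) \<Rightarrow>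
     (('a \<Rightarrow> 'e covec) \<Rightarrow> ('a \<Rightarrow> 'e covec) \<Rightarrow> 'a \<Rightarrow> 'e covec) \<Rightarrow> bool" where
  "contravariant_connection M P D \<longleftrightarrow>
     (\<forall>\<omega> \<eta>. one_form M \<omega> \<longrightarrow> one_form M \<eta> \<longrightarrow> one_form M (D \<omega> \<eta>)) \<and>
     (\<forall>\<omega> \<omega>' \<eta> a b p. one_form M \<omega> \<longrightarrow> one_form M \<omega>' \<longrightarrow> one_form M \<eta> \<longrightarrow>
        D (\<lambda>q. a *\<^sub>R \<omega> q + b *\<^sub>R \<omega>' q) \<eta> p = a *\<^sub>R D \<omega> \<eta> p + b *\<^sub>R D \<omega>' \<eta> p) \<and>
     (\<forall>\<omega> \<eta> \<eta>' a b p. one_form M \<omega> \<longrightarrow> one_form M \<eta> \<longrightarrow> one_form M \<eta>' \<longrightarrow>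
        D \<omega> (\<lambda>q. a *\<^sub>R \<eta> q + b *\<^sub>R \<eta>' q) p = a *\<^sub>R D \<omega> \<eta> p + b *\<^sub>R D \<omega> \<eta>' p) \<and>
     (\<forall>f \<omega> \<eta> p. smooth_function M f \<longrightarrow> one_form M \<omega> \<longrightarrow> one_form M \<eta> \<longrightarrow>
        D (\<lambda>q. f q *\<^sub>R \<omega> q) \<eta> p = f p *\<^sub>R D \<omega> \<eta> p) \<and>
     (\<forall>f \<omega> \<eta> p. smooth_function M f \<longrightarrow> one_form M \<omega> \<longrightarrow> one_form M \<eta> \<longrightarrow>
        D \<omega> (\<lambda>q. f q *\<^sub>R \<eta> q) p = f p *\<^sub>R D \<omega> \<eta> p + differential M f p (sharp P \<omega> p) *\<^sub>R \<eta> p)"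

definition contravariant_levi_civita ::
    "('a, 'e::real_normed_vector) manifold \<Rightarrow> ('a \<Rightarrow> 'e covec \<Rightarrow>\<^sub>L 'e covec \<Rightarrow>\<^sub>L real) \<Rightarrow>
     ('a \<Rightarrow> 'e \<Rightarrow>\<^sub>L 'e \<Rightarrow>\<^sub>L real) \<Rightarrow>
     (('a \<Rightarrow> 'e covec) \<Rightarrow> ('a \<Rightarrow> 'e covec) \<Rightarrow> 'a \<Rightarrow> 'e covec) \<Rightarrow> bool" where
  "contravariant_levi_civita M P g D \<longleftrightarrow>
     contravariant_connection M P D \<and>
     (\<forall>\<omega> \<eta> p. one_form M \<omega> \<longrightarrow> one_form M \<eta> \<longrightarrow>
        D \<omega> \<eta> p - D \<eta> \<omega> p = form_bracket M P \<omega> \<eta> p) \<and>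
     (\<forall>\<omega> \<eta> \<gamma> p. one_form M \<omega> \<longrightarrow> one_form M \<eta> \<longrightarrow> one_form M \<gamma> \<longrightarrow>
        differential M (\<lambda>q. cometric g q (\<eta> q) (\<gamma> q)) p (sharp P \<omega> p) =
        cometric g p (D \<omega> \<eta> p) (\<gamma> p) + cometric g p (\<eta> p) (D \<omega> \<gamma> p))"

definition curvature ::
    "('a, 'e::real_normed_vector) manifold \<Rightarrow> ('a \<Rightarrow> 'e covec \<Rightarrow>\<^sub>L 'e covec \<Rightarrow>\<^sub>L real) \<Rightarrow>
     (('a \<Rightarrow> 'e covec) \<Rightarrow> ('a \<Rightarrow> 'e covec) \<Rightarrow> 'a \<Rightarrow> 'e covec) \<Rightarrow>
     ('a \<Rightarrow> 'e covec) \<Rightarrow> ('a \<Rightarrow> 'e covec) \<Rightarrow> ('a \<Rightarrow> 'e covec) \<Rightarrow> 'a \<Rightarrow> 'e covec" where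
  "curvature M P D \<omega> \<eta> \<gamma> p =
     D \<omega> (D \<eta> \<gamma>) p - D \<eta> (D \<omega> \<gamma>) p - D (form_bracket M P \<omega> \<eta>) \<gamma> p"

definition sectional_curvature ::
    "('a, 'e::real_normed_vector) manifold \<Rightarrow> ('a \<Rightarrow> 'e covec \<Rightarrow>\<^sub>L 'e covec \<Rightarrow>\<^sub>L real) \<Rightarrow>
     ('a \<Rightarrow> 'e \<Rightarrow>\<^sub>L 'e \<Rightarrow>\<^sub>L real) \<Rightarrow>
     (('a \<Rightarrow> 'e covec) \<Rightarrow> ('a \<Rightarrow> 'e covec) \<Rightarrow> 'a \<Rightarrow> 'e covec) \<Rightarrow>
     ('a \<Rightarrow> 'e covec) \<Rightarrow> ('a \<Rightarrow> 'e covec) \<Rightarrow> 'a \<Rightarrow> real" where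
  "sectional_curvature M P g D \<omega> \<eta> p =
     cometric g p (curvature M P D \<omega> \<eta> \<eta> p) (\<omega> p) /
     (cometric g p (\<omega> p) (\<omega> p) * cometric g p (\<eta> p) (\<eta> p) - (cometric g p (\<omega> p) (\<eta> p))\<^sup>2)"

text \<open>
  The sectional curvature at a pair of covectors \<open>\<alpha>\<close>, \<open>\<beta>\<close> at p is the value at p for one-forms
  \<open>\<omega>\<close>, \<open>\<eta>\<close> extending them. Such extensions always exist (multiply by a bump function), and the
  value does not depend on their choice since the curvature is tensorial for a Poisson tensor.
  The contravariant Levi-Civita connection D exists and is unique on one-forms for a Riemannian
  metric and a Poisson tensor.
\<close>

definition positive_sectional_curvature ::
    "('a, 'e::real_normed_vector) manifold \<Rightarrow> ('a \<Rightarrow> 'e covec \<Rightarrow>\<^sub>L 'e covec \<Rightarrow>\<^sub>L real) \<Rightarrow>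
     ('a \<Rightarrow> 'e \<Rightarrow>\<^sub>L 'e \<Rightarrow>\<^sub>L real) \<Rightarrow> bool" where
  "positive_sectional_curvature M P g \<longleftrightarrow>
     (\<exists>D. contravariant_levi_civita M P g D \<and>
        (\<forall>p \<alpha> \<beta>. \<alpha> \<noteq> \<beta> \<and> independent {\<alpha>, \<beta>} \<longrightarrow>
           (\<forall>\<omega> \<eta>. one_form M \<omega> \<and> one_form M \<eta> \<and> \<omega> p = \<alpha> \<and> \<eta> p = \<beta> \<longrightarrow>
              sectional_curvature M P g D \<omega> \<eta> p > 0)))"


section \<open>Warped products\<close>

text \<open>
  With the product of the preferred charts, the tangent space of the product at (p, q) is the product
  of the tangent spaces, and the differentials of the two projections are \<open>fst\<close> and \<open>snd\<close>.
\<close>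

definition prod_manifold ::
    "('a, 'e) manifold \<Rightarrow> ('b, 'f) manifold \<Rightarrow> ('a \<times> 'b, 'e \<times> 'f) manifold" where
  "prod_manifold M\<^sub>1 M\<^sub>2 = Manifold
     (\<lambda>(p, q). chart_dom M\<^sub>1 p \<times> chart_dom M\<^sub>2 q)
     (\<lambda>(p, q) (x, y). (chart M\<^sub>1 p x, chart M\<^sub>2 q y))"

definition warped_metric ::
    "('a \<Rightarrow> 'e::real_normed_vector \<Rightarrow>\<^sub>L 'e \<Rightarrow>\<^sub>L real) \<Rightarrow> ('a \<Rightarrow> real) \<Rightarrow>
     ('b \<Rightarrow> 'f::real_normed_vector \<Rightarrow>\<^sub>L 'f \<Rightarrow>\<^sub>L real) \<Rightarrow>
     'a \<times> 'b \<Rightarrow> ('e \<times> 'f) \<Rightarrow>\<^sub>L ('e \<times> 'f) \<Rightarrow>\<^sub>L real" where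
  "warped_metric g\<^sub>1 f g\<^sub>2 = (\<lambda>(p, q).
     bilinear_pullback fst_blinfun (g\<^sub>1 p) + (f p)\<^sup>2 *\<^sub>R bilinear_pullback snd_blinfun (g\<^sub>2 q))"

text \<open>
  A covector of the product at (p, q) is uniquely of the form
  \<open>\<omega>\<^sub>1 o\<^sub>L fst_blinfun + \<omega>\<^sub>2 o\<^sub>L snd_blinfun\<close>, and the duals of the two inclusions recover
  \<open>\<omega>\<^sub>1\<close> and \<open>\<omega>\<^sub>2\<close>.
\<close>

definition warped_bivector ::
    "('a \<Rightarrow> 'e::real_normed_vector covec \<Rightarrow>\<^sub>L 'e covec \<Rightarrow>\<^sub>L real) \<Rightarrow> ('a \<Rightarrow> real) \<Rightarrow>
     ('b \<Rightarrow> 'f::real_normed_vector covec \<Rightarrow>\<^sub>L 'f covec \<Rightarrow>\<^sub>L real) \<Rightarrow>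
     'a \<times> 'b \<Rightarrow> ('e \<times> 'f) covec \<Rightarrow>\<^sub>L ('e \<times> 'f) covec \<Rightarrow>\<^sub>L real" where
  "warped_bivector P\<^sub>1 \<nu> P\<^sub>2 = (\<lambda>(p, q).
     bilinear_pullback (dual_map (Blinfun (\<lambda>v. (v, 0)))) (P\<^sub>1 p) +
     \<nu> p *\<^sub>R bilinear_pullback (dual_map (Blinfun (\<lambda>w. (0, w)))) (P\<^sub>2 q))"

end

theory Submission
  imports Defs
begin

text \<open>
  Write \<open>\<omega>\<^sup>h\<close> and \<open>\<omega>\<^sup>v\<close> for forms pulled back from \<open>M\<^sub>1\<close> and \<open>M\<^sub>2\<close>, and let \<open>D\<close> be the contravariant
  Levi-Civita connection of the warped product. The theorem follows from two formulas.

  For forms from \<open>M\<^sub>1\<close> the warping is invisible: \<open>D \<omega>\<^sup>h \<eta>\<^sup>h = (D\<^sub>1 \<omega> \<eta>)\<^sup>h\<close> (lemma \<open>D_hform\<close>), so the curvatures of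
  \<open>M\<close> and \<open>M\<^sub>1\<close> agree on such pairs.

  For forms from \<open>M\<^sub>2\<close> the derivative of \<open>\<nu>\<close> enters through the bracket, and
  \<open>D \<omega>\<^sup>v \<eta>\<^sup>v = \<nu> (D\<^sub>2 \<omega> \<eta>)\<^sup>v + 1/2 \<Pi>\<^sub>2(\<omega>,\<eta>) (d\<nu>)\<^sup>h\<close>. The function \<open>f\<close> leaves no trace in this formula because it is
  Casimir: no anchored vector differentiates the factor \<open>1/f\<^sup>2\<close> of the cometric. Differentiating once more gives
  (lemma \<open>curvature_vform\<close>)
  \<open>\<langle>R(\<omega>\<^sup>v,\<eta>\<^sup>v)\<eta>\<^sup>v, \<omega>\<^sup>v\<rangle> = \<nu>\<^sup>2/f\<^sup>2 \<langle>R\<^sub>2(\<omega>,\<eta>)\<eta>, \<omega>\<rangle> - 3/4 \<Pi>\<^sub>2(\<omega>,\<eta>)\<^sup>2 |d\<nu>|\<^sup>2\<close>.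
  The correction is nonpositive, so positivity on \<open>M\<close> forces positivity on \<open>M\<^sub>2\<close>.

  Positivity on a factor includes the existence of its connection. Restricting \<open>D\<close> to a slice \<open>M\<^sub>1 \<times> {q}\<close> gives the
  connection of \<open>M\<^sub>1\<close>; restricting it to a slice \<open>{p} \<times> M\<^sub>2\<close> gives \<open>\<nu>(p)\<close> times the connection of \<open>M\<^sub>2\<close>, which can be
  divided by \<open>\<nu>(p)\<close> at a point where \<open>\<nu>\<close> does not vanish. If \<open>\<nu>\<close> vanishes identically, vertical pairs have
  curvature zero; hence there are no independent ones, \<open>\<Pi>\<^sub>2 = 0\<close>, and the zero connection serves for \<open>M\<^sub>2\<close>.

  Identities for \<open>D\<close> are obtained without local frames. A form that is claimed to vanish is paired with itself: the pairing is symmetric in two arguments by the torsion identity and skew in two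
  arguments by compatibility with the metric, hence zero (lemmas \<open>levi_civita_unique\<close>, \<open>vpart_D_hform\<close>,
  \<open>hpart_D_vform\<close>). Brackets are computed from the expression
  \<open>[\<omega>,\<eta>](v) = D\<eta>(\<sharp>\<omega>)(v) - D\<omega>(\<sharp>\<eta>)(v) + (D\<Pi> v)(\<omega>,\<eta>)\<close> in a chart (lemma \<open>form_bracket_apply\<close>).
  Bump functions serve to realise a covector as the value of a differential, for the Casimir condition and for the
  case \<open>\<nu> = 0\<close>.
\<close>

section \<open>Calculus of \<open>C\<^sup>n\<close> maps\<close>

lemma ck_on_continuous: "ck_on n S f \<Longrightarrow> continuous_on S f"
  by (cases n) (auto simp: continuous_at_imp_continuous_on differentiable_imp_continuous_within)

lemma ck_on_Suc_imp: "ck_on (Suc n) S f \<Longrightarrow> ck_on n S f"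
proof (induction n arbitrary: f)
  case 0
  then show ?case by (metis ck_on_continuous ck_on.simps(1))
next
  case (Suc n)
  have "ck_on n S (\<lambda>x. frechet_derivative f (at x) v)" for v
    using Suc.prems ck_on.simps(2)[of "Suc n" S f] by (intro Suc.IH) blast
  with Suc.prems show ?case
    using ck_on.simps(2)[of "Suc n" S f] ck_on.simps(2)[of n S f] by blast
qed

lemma frechet_derivative_cong_open:
  assumes "open S" "x \<in> S" "\<And>y. y \<in> S \<Longrightarrow> f y = g y"
  shows "frechet_derivative f (at x) = frechet_derivative g (at x)"
proof -
  have "(f has_derivative d) (at x) \<longleftrightarrow> (g has_derivative d) (at x)" for d
    using has_derivative_transform_within_open[OF _ assms(1,2)] assms(3) by metis
  then show ?thesis
    by (simp add: frechet_derivative_def)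
qed

lemma differentiable_cong_open:
  assumes "open S" "x \<in> S" "\<And>y. y \<in> S \<Longrightarrow> f y = g y" "f differentiable (at x)"
  shows "g differentiable (at x)"
proof -
  obtain d where "(f has_derivative d) (at x)"
    using assms(4) by (auto simp: differentiable_def)
  then show ?thesis
    using has_derivative_transform_within_open[OF _ assms(1,2), of f d UNIV g] assms(3)
    by (auto simp: differentiable_def)
qed

lemma ck_on_cong:
  assumes "open S" "\<And>x. x \<in> S \<Longrightarrow> f x = g x" "ck_on n S f"
  shows "ck_on n S g"
  using assms(2,3)
proof (induction n arbitrary: f g)
  case 0
  then show ?case by (simp cong: continuous_on_cong)
next
  case (Suc n)
  have "g differentiable (at x)" if "x \<in> S" for x
    using differentiable_cong_open[OF assms(1) that Suc.prems(1)] Suc.prems that by auto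
  moreover have "ck_on n S (\<lambda>x. frechet_derivative g (at x) v)" for v
  proof (rule Suc.IH)
    show "ck_on n S (\<lambda>x. frechet_derivative f (at x) v)"
      using Suc.prems(2) by simp
    show "frechet_derivative f (at x) v = frechet_derivative g (at x) v" if "x \<in> S" for x
      using frechet_derivative_cong_open[OF assms(1) that Suc.prems(1)] by simp
  qed
  ultimately show ?case by simp
qed

lemma ck_on_locally:
  assumes "\<And>x. x \<in> S \<Longrightarrow> \<exists>T. open T \<and> x \<in> T \<and> ck_on n T f"
  shows "ck_on n S f"
  using assms
proof (induction n arbitrary: f)
  case 0
  have "continuous (at x) f" if "x \<in> S" for x
    using 0[OF that] by (auto simp: continuous_on_eq_continuous_at)
  then show ?case
    by (simp add: continuous_at_imp_continuous_on)
next
  case (Suc n)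
  have "f differentiable (at x)" if "x \<in> S" for x
    using Suc.prems[OF that] by auto
  moreover have "ck_on n S (\<lambda>x. frechet_derivative f (at x) v)" for v
  proof (rule Suc.IH)
    fix x assume "x \<in> S"
    then show "\<exists>T. open T \<and> x \<in> T \<and> ck_on n T (\<lambda>x. frechet_derivative f (at x) v)"
      using Suc.prems by (simp only: ck_on.simps(2)) blast
  qed
  ultimately show ?case by simp
qed

lemma ck_on_const: "ck_on n S (\<lambda>x. c)"
  by (induction n arbitrary: c) simp_all

lemma ck_on_SucI:
  assumes "open S" "\<And>x. x \<in> S \<Longrightarrow> (f has_derivative f' x) (at x)" "\<And>v. ck_on n S (\<lambda>x. f' x v)"
  shows "ck_on (Suc n) S f"
proof -
  have "ck_on n S (\<lambda>x. frechet_derivative f (at x) v)" for v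
    by (rule ck_on_cong[OF assms(1) _ assms(3)[of v]]) (simp add: frechet_derivative_at[OF assms(2), symmetric])
  then show ?thesis
    using assms(2) by (auto simp: differentiable_def)
qed

lemma ck_on_SucD: "ck_on (Suc n) S f \<Longrightarrow> x \<in> S \<Longrightarrow> (f has_derivative frechet_derivative f (at x)) (at x)"
  using frechet_derivative_works by auto

lemma ck_on_bounded_linear:
  assumes "open S" "bounded_linear L" "ck_on n S f"
  shows "ck_on n S (\<lambda>x. L (f x))"
  using assms(3)
proof (induction n arbitrary: f)
  case 0
  then show ?case
    using bounded_linear.continuous_on[OF assms(2)] by auto
next
  case (Suc n)
  have "ck_on n S (\<lambda>x. frechet_derivative f (at x) v)" for v
    using Suc.prems by simp
  then show ?case
    by (intro ck_on_SucI[OF assms(1) bounded_linear.has_derivative[OF assms(2) ck_on_SucD[OF Suc.prems]]] Suc.IH)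
qed

lemma ck_on_add:
  assumes "open S" "ck_on n S f" "ck_on n S g"
  shows "ck_on n S (\<lambda>x. f x + g x)"
  using assms(2,3)
proof (induction n arbitrary: f g)
  case 0
  then show ?case by (auto intro: continuous_on_add)
next
  case (Suc n)
  have "ck_on n S (\<lambda>x. frechet_derivative f (at x) v)" "ck_on n S (\<lambda>x. frechet_derivative g (at x) v)" for v
    using Suc.prems by simp_all
  then show ?case
    by (intro ck_on_SucI[OF assms(1) has_derivative_add[OF ck_on_SucD[OF Suc.prems(1)] ck_on_SucD[OF Suc.prems(2)]]] Suc.IH)
qed

lemma ck_on_bilinear:
  assumes "open S" "bounded_bilinear m" "ck_on n S f" "ck_on n S g"
  shows "ck_on n S (\<lambda>x. m (f x) (g x))"
  using assms(3,4)
proof (induction n arbitrary: f g)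
  case 0
  then have "continuous_on S f" "continuous_on S g" by simp_all
  then show ?case
    unfolding ck_on.simps by (rule bounded_bilinear.continuous_on[OF assms(2)])
next
  case (Suc n)
  have f: "ck_on n S f" and g: "ck_on n S g"
    using Suc.prems ck_on_Suc_imp by blast+
  have f': "ck_on n S (\<lambda>x. frechet_derivative f (at x) v)"
    and g': "ck_on n S (\<lambda>x. frechet_derivative g (at x) v)" for v
    using Suc.prems by simp_all
  show ?case
    by (intro ck_on_SucI[OF assms(1) bounded_bilinear.FDERIV[OF assms(2)
              ck_on_SucD[OF Suc.prems(1)] ck_on_SucD[OF Suc.prems(2)]]] ck_on_add[OF assms(1)] Suc.IH f g f' g')
qed

lemma ck_on_sum:
  assumes "open S" "\<And>i. i \<in> I \<Longrightarrow> ck_on n S (f i)"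
  shows "ck_on n S (\<lambda>x. \<Sum>i\<in>I. f i x)"
  using assms(2)
  by (induction I rule: infinite_finite_induct) (simp_all add: ck_on_const ck_on_add[OF assms(1)])

lemma ck_on_compose_affine:
  assumes "open S" "bounded_linear L" "\<And>x. x \<in> S \<Longrightarrow> L x + a \<in> T" "ck_on n T f"
  shows "ck_on n S (\<lambda>x. f (L x + a))"
  using assms(4)
proof (induction n arbitrary: f)
  case 0
  have "continuous_on S (\<lambda>x. L x + a)"
    by (intro continuous_intros bounded_linear.continuous_on[OF assms(2)])
  with 0 show ?case
    using assms(3) by (auto intro: continuous_on_compose2)
next
  case (Suc n)
  have "((\<lambda>x. L x + a) has_derivative L) (at x)" for x
    using bounded_linear_imp_has_derivative[OF assms(2)] by (auto intro!: derivative_eq_intros)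
  then have "((\<lambda>x. f (L x + a)) has_derivative (\<lambda>v. frechet_derivative f (at (L x + a)) (L v))) (at x)"
    if "x \<in> S" for x
    using that by (intro has_derivative_compose[where f = "\<lambda>x. L x + a" and g = f] ck_on_SucD[OF Suc.prems assms(3)])
  moreover have "ck_on n T (\<lambda>x. frechet_derivative f (at x) (L v))" for v
    using Suc.prems by simp
  then have "ck_on n S (\<lambda>x. frechet_derivative f (at (L x + a)) (L v))" for v
    by (rule Suc.IH)
  ultimately show ?case
    by (rule ck_on_SucI[OF assms(1)])
qed

text \<open>
  A finite family of vectors together with continuous linear coordinates: the form in which
  finite-dimensionality of a normed space is used throughout.
\<close>

definition frame :: "'e::real_normed_vector set \<Rightarrow> ('e \<Rightarrow> 'e covec) \<Rightarrow> bool" where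
  "frame B c \<longleftrightarrow> finite B \<and> (\<forall>x. (\<Sum>b\<in>B. c b x *\<^sub>R b) = x)"

lemma frame_expand: "frame B c \<Longrightarrow> (\<Sum>b\<in>B. c b x *\<^sub>R b) = x"
  by (simp add: frame_def)

lemma frame_finite: "frame B c \<Longrightarrow> finite B"
  by (simp add: frame_def)

lemma frame_linear_expand:
  assumes "frame B c" "linear F"
  shows "F x = (\<Sum>b\<in>B. c b x *\<^sub>R F b)"
  by (subst frame_expand[OF assms(1), of x, symmetric])
     (simp add: linear_sum[OF assms(2)] linear_scale[OF assms(2)])

lemma frame_covec_expand:
  assumes "frame B c"
  shows "(\<Sum>b\<in>B. blinfun_apply \<alpha> b *\<^sub>R c b) = \<alpha>"
proof (rule blinfun_eqI)
  fix x
  show "blinfun_apply (\<Sum>b\<in>B. blinfun_apply \<alpha> b *\<^sub>R c b) x = blinfun_apply \<alpha> x"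
    unfolding frame_linear_expand[OF assms bounded_linear.linear[OF blinfun.bounded_linear_right], of \<alpha> x]
    by (simp add: blinfun.scaleR_left blinfun.sum_left mult.commute)
qed

text \<open>
  The derivative of the outer map has to be evaluated at a direction that varies with the point. Expanding this
  direction in a frame turns it into a finite sum of products of \<open>C\<^sup>n\<close> maps.
\<close>

lemma ck_on_compose:
  fixes \<phi> :: "'d::real_normed_vector \<Rightarrow> 'e::real_normed_vector" and B :: "'e set"
  assumes "frame B c" "open S" "open T" "\<And>x. x \<in> S \<Longrightarrow> \<phi> x \<in> T" "ck_on n S \<phi>" "ck_on n T f"
  shows "ck_on n S (\<lambda>x. f (\<phi> x))"
  using assms(5,6)
proof (induction n arbitrary: f)
  case 0
  then show ?case using assms(4) by (auto intro: continuous_on_compose2)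
next
  case (Suc n)
  have D: "((\<lambda>x. f (\<phi> x)) has_derivative
      (\<lambda>v. \<Sum>b\<in>B. c b (frechet_derivative \<phi> (at x) v) *\<^sub>R frechet_derivative f (at (\<phi> x)) b)) (at x)"
    if "x \<in> S" for x
  proof -
    have f: "(f has_derivative frechet_derivative f (at (\<phi> x))) (at (\<phi> x))"
      by (rule ck_on_SucD[OF Suc.prems(2) assms(4)[OF that]])
    have "linear (frechet_derivative f (at (\<phi> x)))"
      by (rule has_derivative_linear[OF f])
    note expand = frame_linear_expand[OF assms(1) this, symmetric]
    show ?thesis
      unfolding expand by (rule has_derivative_compose[OF ck_on_SucD[OF Suc.prems(1) that] f])
  qed
  have "ck_on n S (\<lambda>x. c b (frechet_derivative \<phi> (at x) v) *\<^sub>R frechet_derivative f (at (\<phi> x)) b)" for b v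
  proof (intro ck_on_bilinear[OF assms(2) bounded_bilinear_scaleR] ck_on_bounded_linear[OF assms(2) blinfun.bounded_linear_right])
    show "ck_on n S (\<lambda>x. frechet_derivative \<phi> (at x) v)"
      using Suc.prems(1) by simp
    show "ck_on n S (\<lambda>x. frechet_derivative f (at (\<phi> x)) b)"
    proof (rule Suc.IH)
      show "ck_on n S \<phi>"
        by (rule ck_on_Suc_imp[OF Suc.prems(1)])
      show "ck_on n T (\<lambda>x. frechet_derivative f (at x) b)"
        using Suc.prems(2) by simp
    qed
  qed
  then show ?case
    by (intro ck_on_SucI[OF assms(2) D] ck_on_sum[OF assms(2)])
qed

text \<open>
  Regularity is defined through directional derivatives. In finite dimension it gives regularity of the derivative
  as a map into the space of bounded linear maps, as needed for the differential of a function to be a one-form.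
\<close>

lemma ck_on_Blinfun_derivative:
  fixes f :: "'e::real_normed_vector \<Rightarrow> 'f::real_normed_vector" and B :: "'e set"
  assumes "frame B c" "open S" "ck_on (Suc n) S f"
  shows "ck_on n S (\<lambda>x. Blinfun (frechet_derivative f (at x)))"
proof -
  have eq: "Blinfun (frechet_derivative f (at x)) = (\<Sum>b\<in>B. blinfun_scaleR_left (frechet_derivative f (at x) b) o\<^sub>L c b)"
    if "x \<in> S" for x
  proof -
    have bl: "bounded_linear (frechet_derivative f (at x))"
      using has_derivative_bounded_linear[OF ck_on_SucD[OF assms(3) that]] .
    then show ?thesis
      using frame_linear_expand[OF assms(1) bounded_linear.linear[OF bl], symmetric]
      by (intro blinfun_eqI) (simp add: bounded_linear_Blinfun_apply blinfun.sum_left)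
  qed
  have "ck_on n S (\<lambda>x. \<Sum>b\<in>B. blinfun_scaleR_left (frechet_derivative f (at x) b) o\<^sub>L c b)"
  proof (rule ck_on_sum[OF assms(2)])
    fix b
    have "bounded_linear (\<lambda>y. blinfun_scaleR_left y o\<^sub>L c b)"
      by (rule bounded_linear_compose[OF bounded_bilinear.bounded_linear_left[OF bounded_bilinear_blinfun_compose]
            bounded_linear_blinfun_scaleR_left])
    moreover have "ck_on n S (\<lambda>x. frechet_derivative f (at x) b)"
      using assms(3) by simp
    ultimately show "ck_on n S (\<lambda>x. blinfun_scaleR_left (frechet_derivative f (at x) b) o\<^sub>L c b)"
      by (rule ck_on_bounded_linear[OF assms(2)])
  qed
  then show ?thesis
    by (rule ck_on_cong[OF assms(2), rotated]) (simp add: eq)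
qed

lemma smooth_onD: "smooth_on S f \<Longrightarrow> ck_on n S f"
  by (simp add: smooth_on_def)

lemma smooth_onI: "(\<And>n. ck_on n S f) \<Longrightarrow> smooth_on S f"
  by (simp add: smooth_on_def)

lemma smooth_on_cong:
  assumes "open S" "\<And>x. x \<in> S \<Longrightarrow> f x = g x" "smooth_on S f"
  shows "smooth_on S g"
  by (rule smooth_onI, rule ck_on_cong[OF assms(1,2) smooth_onD[OF assms(3)]])

lemma smooth_on_locally:
  assumes "\<And>x. x \<in> S \<Longrightarrow> \<exists>T. open T \<and> x \<in> T \<and> smooth_on T f"
  shows "smooth_on S f"
proof (rule smooth_onI, rule ck_on_locally)
  fix n x assume "x \<in> S"
  from assms[OF this] show "\<exists>T. open T \<and> x \<in> T \<and> ck_on n T f"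
    using smooth_onD by blast
qed

lemma smooth_on_const: "smooth_on S (\<lambda>x. c)"
  by (rule smooth_onI, rule ck_on_const)

lemma smooth_on_bounded_linear:
  assumes "open S" "bounded_linear L" "smooth_on S f"
  shows "smooth_on S (\<lambda>x. L (f x))"
  by (rule smooth_onI, rule ck_on_bounded_linear[OF assms(1,2) smooth_onD[OF assms(3)]])

lemma smooth_on_add:
  assumes "open S" "smooth_on S f" "smooth_on S g"
  shows "smooth_on S (\<lambda>x. f x + g x)"
  by (rule smooth_onI, rule ck_on_add[OF assms(1) smooth_onD[OF assms(2)] smooth_onD[OF assms(3)]])

lemma smooth_on_bilinear:
  assumes "open S" "bounded_bilinear m" "smooth_on S f" "smooth_on S g"
  shows "smooth_on S (\<lambda>x. m (f x) (g x))"
  by (rule smooth_onI, rule ck_on_bilinear[OF assms(1,2) smooth_onD[OF assms(3)] smooth_onD[OF assms(4)]])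

lemma smooth_on_compose_affine:
  assumes "open S" "bounded_linear L" "\<And>x. x \<in> S \<Longrightarrow> L x + a \<in> T" "smooth_on T f"
  shows "smooth_on S (\<lambda>x. f (L x + a))"
  by (rule smooth_onI, rule ck_on_compose_affine[OF assms(1-3) smooth_onD[OF assms(4)]])

lemma smooth_on_compose:
  fixes \<phi> :: "'d::real_normed_vector \<Rightarrow> 'e::real_normed_vector" and B :: "'e set"
  assumes "frame B c" "open S" "open T" "\<And>x. x \<in> S \<Longrightarrow> \<phi> x \<in> T" "smooth_on S \<phi>" "smooth_on T f"
  shows "smooth_on S (\<lambda>x. f (\<phi> x))"
  by (rule smooth_onI, rule ck_on_compose[OF assms(1-3) _ smooth_onD[OF assms(5)] smooth_onD[OF assms(6)]])
     (rule assms(4))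

lemma smooth_on_Blinfun_derivative:
  fixes f :: "'e::real_normed_vector \<Rightarrow> 'f::real_normed_vector" and B :: "'e set"
  assumes "frame B c" "open S" "smooth_on S f"
  shows "smooth_on S (\<lambda>x. Blinfun (frechet_derivative f (at x)))"
  by (rule smooth_onI, rule ck_on_Blinfun_derivative[OF assms(1,2) smooth_onD[OF assms(3)]])

lemma smooth_on_has_derivative:
  "smooth_on S f \<Longrightarrow> x \<in> S \<Longrightarrow> (f has_derivative frechet_derivative f (at x)) (at x)"
  by (rule ck_on_SucD[OF smooth_onD])

lemma smooth_on_ident: "smooth_on S (\<lambda>x. x)"
proof -
  have "ck_on n S (\<lambda>x. x)" for n
    by (cases n) (auto simp: ck_on_const)
  then show ?thesis by (simp add: smooth_on_def)
qed

section \<open>Inner products on finite-dimensional normed spaces\<close>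

definition inner_form :: "('e::real_normed_vector \<Rightarrow>\<^sub>L 'e \<Rightarrow>\<^sub>L real) \<Rightarrow> bool" where
  "inner_form b \<longleftrightarrow> (\<forall>v w. b v w = b w v) \<and> (\<forall>v. v \<noteq> 0 \<longrightarrow> b v v > 0)"

lemma inner_form_sym: "inner_form b \<Longrightarrow> b v w = b w v"
  by (simp add: inner_form_def)

lemma inner_form_pos: "inner_form b \<Longrightarrow> v \<noteq> 0 \<Longrightarrow> b v v > 0"
  by (simp add: inner_form_def)

lemma inner_form_nonneg: "inner_form b \<Longrightarrow> b v v \<ge> 0"
  by (cases "v = 0") (auto dest: inner_form_pos[of b v])

text \<open>
  Gram--Schmidt. An orthonormal basis of an inner form is recorded as a frame whose coordinates are
  given by the form itself. Boundedness of the form thus provides bounded coordinates without any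
  comparison of norms.
\<close>

lemma gram_schmidt:
  fixes b :: "'e::real_normed_vector \<Rightarrow>\<^sub>L 'e \<Rightarrow>\<^sub>L real"
  assumes "inner_form b" "finite A"
  shows "\<exists>B. finite B \<and> B \<subseteq> span A \<and> (\<forall>x\<in>span A. (\<Sum>u\<in>B. b u x *\<^sub>R u) = x)"
  using assms(2)
proof (induction A)
  case empty
  then show ?case by (intro exI[of _ "{}"]) simp
next
  case (insert a A)
  then obtain B where B: "finite B" "B \<subseteq> span A" and id: "\<And>x. x \<in> span A \<Longrightarrow> (\<Sum>u\<in>B. b u x *\<^sub>R u) = x"
    by blast
  define T where "T x = (\<Sum>u\<in>B. b u x *\<^sub>R u)" for x
  have T_add: "T (x + y) = T x + T y" for x y
    by (simp add: T_def blinfun.add_right scaleR_add_left sum.distrib)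
  have T_scale: "T (k *\<^sub>R x) = k *\<^sub>R T x" for k x
    by (simp add: T_def blinfun.scaleR_right scaleR_sum_right)
  have T_span: "T x \<in> span A" for x
    unfolding T_def using B(2) by (intro span_sum span_scale) auto
  have T_id: "T x = x" if "x \<in> span A" for x
    using id[OF that] by (simp add: T_def)
  have T_adj: "b (T x) y = b x (T y)" for x y
    by (simp add: T_def blinfun.sum_left blinfun.sum_right blinfun.scaleR_left blinfun.scaleR_right
        inner_form_sym[OF assms(1), of x] mult.commute)
  define r where "r = a - T a"
  have r_orth: "b r y = 0" if "y \<in> span A" for y
    using T_adj[of a y] T_id[OF that] by (simp add: r_def blinfun.diff_left blinfun.diff_right)
  have dec: "\<exists>k y. x = k *\<^sub>R a + y \<and> y \<in> span A" if "x \<in> span (insert a A)" for x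
  proof -
    obtain k where "x - k *\<^sub>R a \<in> span A"
      using \<open>x \<in> span (insert a A)\<close> by (auto simp: span_insert)
    then show ?thesis by (intro exI[of _ k] exI[of _ "x - k *\<^sub>R a"]) simp
  qed
  have sub: "span A \<subseteq> span (insert a A)"
    by (rule span_mono) auto
  show ?case
  proof (cases "r = 0")
    case True
    then have "T a = a" by (simp add: r_def)
    then have "T x = x" if "x \<in> span (insert a A)" for x
      using dec[OF that] T_id by (auto simp: T_add T_scale)
    then show ?thesis
      using B sub unfolding T_def by (intro exI[of _ B]) auto
  next
    case False
    define u where "u = (1 / sqrt (b r r)) *\<^sub>R r"
    have pos: "b r r > 0"
      by (rule inner_form_pos[OF assms(1) False])
    have u: "b u x *\<^sub>R u = (b r x / b r r) *\<^sub>R r" for x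
      using pos by (simp add: u_def blinfun.scaleR_left blinfun.scaleR_right[of b])
    have "u \<notin> B"
    proof
      assume "u \<in> B"
      then have "b r u = 0" using B(2) r_orth by auto
      then show False using pos by (simp add: u_def blinfun.scaleR_right)
    qed
    have "r \<in> span (insert a A)"
      unfolding r_def using T_span[of a] sub by (intro span_diff) (auto intro: span_base)
    then have "u \<in> span (insert a A)"
      unfolding u_def by (rule span_scale)
    have sum: "(\<Sum>w\<in>insert u B. b w x *\<^sub>R w) = (b r x / b r r) *\<^sub>R r + T x" for x
      using B(1) \<open>u \<notin> B\<close> u by (simp add: T_def)
    have "b r a = b r r"
      using r_orth[OF T_span[of a]] by (simp add: r_def blinfun.diff_right)
    then have "(b r x / b r r) *\<^sub>R r + T x = x" if xs: "x \<in> span (insert a A)" for x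
    proof -
      obtain k y where x: "x = k *\<^sub>R a + y" "y \<in> span A" using dec[OF xs] by blast
      have "b r x / b r r = k"
        using pos \<open>b r a = b r r\<close> r_orth[OF x(2)] by (simp add: x(1) blinfun.add_right blinfun.scaleR_right)
      then show ?thesis
        using T_id[OF x(2)] by (simp add: x(1) T_add T_scale r_def algebra_simps)
    qed
    then show ?thesis
      using B sub \<open>u \<in> span (insert a A)\<close> sum by (intro exI[of _ "insert u B"]) auto
  qed
qed

lemma orthonormal_frame_exists:
  fixes b :: "'e::real_normed_vector \<Rightarrow>\<^sub>L 'e \<Rightarrow>\<^sub>L real"
  assumes "inner_form b" "\<exists>A::'e set. finite A \<and> span A = UNIV"
  obtains B where "frame B (blinfun_apply b)"
proof -
  obtain A :: "'e set" where A: "finite A" "span A = UNIV"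
    using assms(2) by blast
  then obtain B where "finite B" "\<forall>x. (\<Sum>u\<in>B. b u x *\<^sub>R u) = x"
    using gram_schmidt[OF assms(1), of A] by auto
  then show ?thesis
    by (intro that[of B]) (simp add: frame_def)
qed

lemma metric_sharp_unique:
  fixes \<alpha> :: "'e::real_normed_vector covec"
  assumes "inner_form b" "\<And>w. b v w = \<alpha> w"
  shows "metric_sharp b \<alpha> = v"
  unfolding metric_sharp_def
proof (rule the_equality)
  fix u assume "\<forall>w. b u w = \<alpha> w"
  then have "b (u - v) (u - v) = 0"
    using assms(2) by (simp add: blinfun.diff_left blinfun.diff_right[of b])
  then show "u = v"
    using inner_form_pos[OF assms(1), of "u - v"] by auto
qed (use assms(2) in simp)

lemma frame_sum_apply:
  fixes \<alpha> :: "'e::real_normed_vector covec"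
  assumes "frame B (blinfun_apply b)"
  shows "b (\<Sum>u\<in>B. \<alpha> u *\<^sub>R u) w = \<alpha> w"
  unfolding frame_linear_expand[OF assms bounded_linear.linear[OF blinfun.bounded_linear_right], of \<alpha> w]
  by (simp add: blinfun.sum_left blinfun.sum_right[of b] blinfun.scaleR_left blinfun.scaleR_right[of b] mult.commute)

lemma metric_sharp_frame:
  fixes \<alpha> :: "'e::real_normed_vector covec"
  assumes "inner_form b" "frame B (blinfun_apply b)"
  shows "metric_sharp b \<alpha> = (\<Sum>u\<in>B. \<alpha> u *\<^sub>R u)"
  by (rule metric_sharp_unique[OF assms(1) frame_sum_apply[OF assms(2)]])

locale inner_frame =
  fixes b :: "'e::real_normed_vector \<Rightarrow>\<^sub>L 'e \<Rightarrow>\<^sub>L real" and B :: "'e set"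
  assumes inner: "inner_form b" and frame: "frame B (blinfun_apply b)"
begin

lemma metric_sharp_apply:
  fixes \<alpha> :: "'e covec"
  shows "b (metric_sharp b \<alpha>) w = \<alpha> w"
  unfolding metric_sharp_frame[OF inner frame] by (rule frame_sum_apply[OF frame])

lemma bounded_linear_metric_sharp: "bounded_linear (metric_sharp b)"
  unfolding metric_sharp_frame[OF inner frame]
  by (intro bounded_linear_sum bounded_linear_compose[OF bounded_linear_scaleR_left] blinfun.bounded_linear_left)

lemma parseval: "b x x = (\<Sum>u\<in>B. (b u x)\<^sup>2)"
proof -
  have "b x x = b x (\<Sum>u\<in>B. b u x *\<^sub>R u)"
    using frame_expand[OF frame, of x] by simp
  also have "\<dots> = (\<Sum>u\<in>B. (b u x)\<^sup>2)"
    by (simp add: blinfun.sum_right blinfun.scaleR_right inner_form_sym[OF inner, of x] power2_eq_square)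
  finally show ?thesis .
qed

lemma coordinate_bound: "\<bar>b u x\<bar> \<le> sqrt (b x x)" if "u \<in> B"
proof -
  have "(b u x)\<^sup>2 \<le> b x x"
    unfolding parseval using that frame_finite[OF frame] by (intro member_le_sum) auto
  then show ?thesis
    by (metis real_sqrt_abs real_sqrt_le_mono)
qed

lemma norm_le_form: "norm x \<le> sqrt (b x x) * (\<Sum>u\<in>B. norm u)"
proof -
  have "norm x = norm (\<Sum>u\<in>B. b u x *\<^sub>R u)"
    by (simp add: frame_expand[OF frame])
  also have "\<dots> \<le> (\<Sum>u\<in>B. norm (b u x *\<^sub>R u))"
    by (rule norm_sum)
  also have "\<dots> \<le> (\<Sum>u\<in>B. sqrt (b x x) * norm u)"
    using coordinate_bound by (intro sum_mono) (simp add: mult_right_mono)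
  finally show ?thesis by (simp add: sum_distrib_left)
qed

lemma coercive:
  obtains K where "K > 0" "\<And>x. (norm x)\<^sup>2 \<le> K * b x x"
proof
  let ?s = "\<Sum>u\<in>B. norm u"
  show "0 < ?s\<^sup>2 + 1"
    by (simp add: add_nonneg_pos)
  fix x
  have "(norm x)\<^sup>2 \<le> (sqrt (b x x) * ?s)\<^sup>2"
    by (intro power_mono norm_le_form) simp
  also have "\<dots> = ?s\<^sup>2 * b x x"
    using inner_form_nonneg[OF inner] by (simp add: power_mult_distrib)
  also have "\<dots> \<le> (?s\<^sup>2 + 1) * b x x"
    using inner_form_nonneg[OF inner] by (intro mult_right_mono) auto
  finally show "(norm x)\<^sup>2 \<le> (?s\<^sup>2 + 1) * b x x" .
qed

lemma compact_cube:
  assumes "finite A"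
  shows "\<exists>C::'e set. compact C \<and> (\<forall>t. (\<forall>u\<in>A. \<bar>t u\<bar> \<le> r) \<longrightarrow> (\<Sum>u\<in>A. t u *\<^sub>R u) \<in> C)"
  using assms
proof (induction A)
  case empty
  show ?case by (intro exI[of _ "{0}"]) simp
next
  case (insert a A)
  then obtain C where C: "compact C" "\<And>t. (\<forall>u\<in>A. \<bar>t u\<bar> \<le> r) \<Longrightarrow> (\<Sum>u\<in>A. t u *\<^sub>R u) \<in> C"
    by blast
  let ?C = "(\<lambda>(s, y). s *\<^sub>R a + y) ` ({-r..r} \<times> C)"
  have "compact ?C"
    using C(1) by (intro compact_continuous_image compact_Times)
      (auto intro!: continuous_intros simp: case_prod_beta)
  moreover have "(\<Sum>u\<in>insert a A. t u *\<^sub>R u) \<in> ?C" if "\<forall>u\<in>insert a A. \<bar>t u\<bar> \<le> r" for t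
    using C(2)[of t] that insert.hyps
    by (intro image_eqI[of _ _ "(t a, \<Sum>u\<in>A. t u *\<^sub>R u)"]) (auto simp: abs_le_iff)
  ultimately show ?case by blast
qed

lemma continuous_form_square: "continuous_on S (\<lambda>x. b (x - a) (x - a))"
  by (intro continuous_intros blinfun.continuous_on)

lemma compact_ball_form: "compact {x. b (x - a) (x - a) \<le> r}"
proof -
  obtain C where C: "compact C" "\<And>t. (\<forall>u\<in>B. \<bar>t u\<bar> \<le> sqrt r) \<Longrightarrow> (\<Sum>u\<in>B. t u *\<^sub>R u) \<in> C"
    using compact_cube[OF frame_finite[OF frame], of "sqrt r"] by blast
  have "x \<in> (+) a ` C" if "b (x - a) (x - a) \<le> r" for x
  proof (rule image_eqI)
    show "x = a + (x - a)" by simp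
    have "\<bar>b u (x - a)\<bar> \<le> sqrt r" if "u \<in> B" for u
      using coordinate_bound[OF that, of "x - a"] real_sqrt_le_mono[OF \<open>b (x - a) (x - a) \<le> r\<close>] by linarith
    then show "x - a \<in> C"
      using C(2)[of "\<lambda>u. b u (x - a)"] frame_expand[OF frame, of "x - a"] by simp
  qed
  moreover have "closed {x. b (x - a) (x - a) \<le> r}"
    by (intro closed_Collect_le continuous_form_square continuous_on_const)
  ultimately show ?thesis
    using compact_Int_closed[OF compact_translation[OF C(1), of a], of "{x. b (x - a) (x - a) \<le> r}"]
    by (simp add: Int_absorb1 subset_iff)
qed

end

text \<open>
  Differentiability of \<open>x \<mapsto> G(x)\<inverse> C(x)\<close>. The increment of the solution satisfies a linear equation with the fixed
  matrix \<open>G(a)\<close>; its right-hand side is differentiable up to a term of second order.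
\<close>

lemma metric_sharp_differentiable:
  fixes G :: "'x::real_normed_vector \<Rightarrow> 'e::real_normed_vector \<Rightarrow>\<^sub>L 'e \<Rightarrow>\<^sub>L real"
    and C :: "'x \<Rightarrow> 'e covec"
  assumes fin: "\<exists>A::'e set. finite A \<and> span A = UNIV"
    and U: "open U" "a \<in> U" "\<And>x. x \<in> U \<Longrightarrow> inner_form (G x)"
    and G: "(G has_derivative G') (at a)" and C: "(C has_derivative C') (at a)"
  shows "(\<lambda>x. metric_sharp (G x) (C x)) differentiable (at a)"
proof -
  obtain B where "frame B (blinfun_apply (G a))"
    using orthonormal_frame_exists[OF U(3)[OF U(2)] fin] .
  then interpret inner_frame "G a" B
    using U by unfold_locales auto
  define S where "S = metric_sharp (G a)"
  have S: "bounded_linear S"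
    unfolding S_def by (rule bounded_linear_metric_sharp)
  obtain k where k: "k > 0" "\<And>\<alpha>. norm (S \<alpha>) \<le> norm \<alpha> * k"
    using bounded_linear.pos_bounded[OF S] by blast
  define u where "u x = metric_sharp (G x) (C x)" for x
  have u: "G x (u x) = C x" if xU: "x \<in> U" for x
  proof -
    obtain B where "frame B (blinfun_apply (G x))"
      using orthonormal_frame_exists[OF U(3)[OF xU] fin] .
    then interpret x: inner_frame "G x" B
      using U xU by unfold_locales auto
    show ?thesis
      unfolding u_def by (rule blinfun_eqI, rule x.metric_sharp_apply)
  qed
  define e where "e x = u x - u a" for x
  define r where "r x = C x - G x (u a)" for x
  define m where "m x = (G x - G a) (e x)" for x
  \<comment> \<open>The increment \<open>e\<close> solves \<open>G a (e x) = r x - m x\<close>, where \<open>m\<close> is of second order.\<close>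
  have e_eq: "e x = S (r x) - S (m x)" if "x \<in> U" for x
  proof -
    have "G a (e x) = r x - m x"
      using u[OF that] u[OF U(2)]
      by (simp add: e_def r_def m_def blinfun.diff_left blinfun.diff_right)
    then have "S (r x - m x) = e x"
      unfolding S_def by (intro metric_sharp_unique[OF inner]) simp
    then show ?thesis
      by (simp add: linear_diff[OF bounded_linear.linear[OF S]])
  qed
  have r: "(r has_derivative (\<lambda>h. C' h - G' h (u a))) (at a)"
    unfolding r_def
    by (intro has_derivative_diff C bounded_linear.has_derivative[OF blinfun.bounded_linear_left G])
  have ra: "r a = 0"
    using u[OF U(2)] by (simp add: r_def)
  obtain L where L: "\<And>h. norm (C' h - G' h (u a)) \<le> norm h * L" "L > 0"
    using bounded_linear.pos_bounded[OF has_derivative_bounded_linear[OF r]] by blast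
  obtain d1 where d1: "d1 > 0" "\<And>y. norm (y - a) < d1 \<Longrightarrow> norm (r y - r a - (C' (y - a) - G' (y - a) (u a))) \<le> 1 * norm (y - a)"
    using r unfolding has_derivative_at_alt by (meson zero_less_one)
  have r_bound: "norm (r y) \<le> (L + 1) * norm (y - a)" if "norm (y - a) < d1" for y
    using d1(2)[OF that] L(1)[of "y - a"] norm_triangle_sub[of "r y" "C' (y - a) - G' (y - a) (u a)"]
    by (simp add: ra algebra_simps)
  have cont: "isCont G a"
    by (rule has_derivative_continuous[OF G])
  obtain d0 where d0: "d0 > 0" "ball a d0 \<subseteq> U"
    using U by (auto simp: open_contains_ball)
  have m: "(m has_derivative (\<lambda>_. 0)) (at a)"
    unfolding has_derivative_at_alt
  proof (intro conjI allI impI)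
    show "bounded_linear (\<lambda>_. 0::'e covec)" by simp
    fix \<epsilon> :: real assume \<epsilon>: "\<epsilon> > 0"
    define \<delta> where "\<delta> = min (1 / (2 * k)) (\<epsilon> / (2 * k * (L + 1)))"
    have \<delta>: "\<delta> > 0" using \<epsilon> k L by (simp add: \<delta>_def)
    obtain d2 where d2: "d2 > 0" "\<And>y. norm (y - a) < d2 \<Longrightarrow> norm (G y - G a) < \<delta>"
      using cont \<delta> unfolding continuous_at_eps_delta by (auto simp: dist_norm)
    show "\<exists>d>0. \<forall>y. norm (y - a) < d \<longrightarrow> norm (m y - m a - 0) \<le> \<epsilon> * norm (y - a)"
    proof (intro exI[of _ "min d0 (min d1 d2)"] conjI allI impI)
      show "min d0 (min d1 d2) > 0" using d0 d1 d2 by simp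
      fix y assume y: "norm (y - a) < min d0 (min d1 d2)"
      then have "y \<in> U" using d0(2) by (auto simp: dist_norm norm_minus_commute)
      have G_small: "norm (G y - G a) < \<delta>" using d2(2)[of y] y by simp
      have m_le: "norm (m y) \<le> norm (G y - G a) * norm (e y)"
        unfolding m_def by (rule norm_blinfun)
      also have "\<dots> \<le> \<delta> * norm (e y)"
        using G_small by (intro mult_right_mono) auto
      finally have m1: "norm (m y) \<le> \<delta> * norm (e y)" .
      have "norm (e y) \<le> norm (S (r y)) + norm (S (m y))"
        unfolding e_eq[OF \<open>y \<in> U\<close>] by (rule norm_triangle_ineq4)
      also have "\<dots> \<le> norm (r y) * k + norm (m y) * k"
        by (intro add_mono k)
      also have "\<dots> \<le> norm (r y) * k + (\<delta> * norm (e y)) * k"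
        using m1 k by (intro add_left_mono mult_right_mono) auto
      also have "(\<delta> * norm (e y)) * k \<le> (1 / (2 * k) * norm (e y)) * k"
        using k by (intro mult_right_mono) (auto simp: \<delta>_def)
      also have "(1 / (2 * k) * norm (e y)) * k = norm (e y) / 2"
        using k by simp
      finally have "norm (e y) \<le> 2 * k * norm (r y)"
        by (simp add: algebra_simps)
      also have "\<dots> \<le> 2 * k * ((L + 1) * norm (y - a))"
        using r_bound[of y] y k by (intro mult_left_mono) auto
      finally have "norm (e y) \<le> 2 * k * ((L + 1) * norm (y - a))" .
      then have "\<delta> * norm (e y) \<le> \<delta> * (2 * k * ((L + 1) * norm (y - a)))"
        using \<delta> by (intro mult_left_mono) auto
      also have "\<dots> \<le> (\<epsilon> / (2 * k * (L + 1))) * (2 * k * ((L + 1) * norm (y - a)))"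
        using k L by (intro mult_right_mono) (auto simp: \<delta>_def)
      also have "\<dots> = \<epsilon> * norm (y - a)"
        using k L by simp
      finally show "norm (m y - m a - 0) \<le> \<epsilon> * norm (y - a)"
        using m1 by (simp add: m_def)
    qed
  qed
  have "((\<lambda>x. u a + (S (r x) - S (m x))) has_derivative (\<lambda>h. 0 + (S (C' h - G' h (u a)) - S 0))) (at a)"
    by (intro has_derivative_add has_derivative_const has_derivative_diff bounded_linear.has_derivative[OF S] r m)
  then have "(u has_derivative (\<lambda>h. 0 + (S (C' h - G' h (u a)) - S 0))) (at a)"
  proof (rule has_derivative_transform_within_open[OF _ U(1,2)])
    show "u a + (S (r x) - S (m x)) = u x" if "x \<in> U" for x
      using e_eq[OF that] by (simp add: e_def algebra_simps)
  qed
  then show ?thesis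
    unfolding u_def differentiable_def by blast
qed

section \<open>Bump functions\<close>

text \<open>
  The family \<open>exp (-1/t) / t\<^sup>k\<close> for \<open>t > 0\<close>, extended by zero. It is closed under differentiation up to linear
  combinations, which is why all \<open>k\<close> are treated at once although only \<open>k = 0\<close> is of interest.
\<close>

definition flat :: "nat \<Rightarrow> real \<Rightarrow> real" where
  "flat k t = (if t \<le> 0 then 0 else exp (- (1 / t)) * (1 / t) ^ k)"

text \<open>
  Comparison with the term of order \<open>k + 2\<close> in the series of \<open>exp (1/t)\<close>. A quadratic bound makes the derivative at
  zero vanish.
\<close>

lemma flat_bound: "\<bar>flat k t\<bar> \<le> fact (k + 2) * t\<^sup>2"
proof (cases "t \<le> 0")
  case False
  then have t: "t > 0" by simp
  have "(1 / t) ^ (k + 2) /\<^sub>R fact (k + 2) \<le> (\<Sum>n. (1 / t) ^ n /\<^sub>R fact n)"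
    using sum_le_suminf[OF summable_exp_generic[of "1 / t"], of "{k + 2}"] t by simp
  then have "(1 / t) ^ (k + 2) / fact (k + 2) \<le> exp (1 / t)"
    by (simp add: exp_def divide_inverse mult.commute)
  moreover define F :: real where "F = fact (k + 2)"
  moreover have "F > 0"
    unfolding F_def by (rule fact_gt_zero)
  ultimately have "(1 / t) ^ (k + 2) \<le> exp (1 / t) * F"
    unfolding F_def by (simp only: pos_divide_le_eq)
  then have "exp (- (1 / t)) * (1 / t) ^ (k + 2) * t\<^sup>2 \<le> F * t\<^sup>2"
    by (intro mult_right_mono) (simp_all add: exp_minus inverse_eq_divide divide_le_eq mult.commute del: power_Suc power_add)
  moreover have "exp (- (1 / t)) * (1 / t) ^ (k + 2) * t\<^sup>2 = exp (- (1 / t)) * (1 / t) ^ k"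
    using t by (simp add: power_add power2_eq_square)
  ultimately have "exp (- (1 / t)) * (1 / t) ^ k \<le> F * t\<^sup>2"
    by simp
  then have "\<bar>flat k t\<bar> \<le> F * t\<^sup>2"
    using t by (simp add: flat_def)
  then show ?thesis
    by (simp add: F_def)
qed (simp add: flat_def)

lemma flat_has_derivative:
  "(flat k has_real_derivative (flat (k + 2) t - real k * flat (k + 1) t)) (at t)"
proof -
  consider "t < 0" | "t = 0" | "t > 0" by linarith
  then show ?thesis
  proof cases
    case 1
    have "((\<lambda>_. 0) has_real_derivative 0) (at t)" by simp
    then have "(flat k has_real_derivative 0) (at t)"
      by (rule has_field_derivative_transform_within_open[of _ _ _ "{..<0}"]) (use 1 in \<open>auto simp: flat_def\<close>)
    then show ?thesis using 1 by (simp add: flat_def)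
  next
    case 2
    have "((\<lambda>y. (flat k y - flat k 0) / (y - 0)) \<longlongrightarrow> 0) (at 0)"
    proof (rule Lim_null_comparison)
      show "\<forall>\<^sub>F y in at 0. norm ((flat k y - flat k 0) / (y - 0)) \<le> fact (k + 2) * \<bar>y\<bar>"
        unfolding eventually_at_filter
      proof (intro always_eventually allI impI)
        fix y :: real assume "y \<noteq> 0"
        then show "norm ((flat k y - flat k 0) / (y - 0)) \<le> fact (k + 2) * \<bar>y\<bar>"
          using flat_bound[of k y] by (simp add: flat_def[of k 0] divide_le_eq power2_eq_square mult.assoc)
      qed
      show "((\<lambda>y. fact (k + 2) * \<bar>y::real\<bar>) \<longlongrightarrow> 0) (at 0)"
        by (intro tendsto_eq_intros) auto
    qed
    then have "(flat k has_real_derivative 0) (at 0)"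
      by (simp add: has_field_derivative_iff)
    then show ?thesis using 2 by (simp add: flat_def)
  next
    case 3
    have inv: "((\<lambda>t. 1 / t) has_real_derivative - ((1 / t)\<^sup>2)) (at t)"
      using 3 by (auto intro!: derivative_eq_intros simp: power2_eq_square)
    have "((\<lambda>s. exp (- s) * s ^ k) has_real_derivative
        exp (- s) * (real k * s ^ (k - 1)) - exp (- s) * s ^ k) (at s)" for s :: real
      by (auto intro!: derivative_eq_intros)
    from DERIV_chain2[OF this inv]
    have "((\<lambda>t. exp (- (1 / t)) * (1 / t) ^ k) has_real_derivative
        (exp (- (1 / t)) * (real k * (1 / t) ^ (k - 1)) - exp (- (1 / t)) * (1 / t) ^ k) * - ((1 / t)\<^sup>2)) (at t)" .
    moreover have "(exp (- s) * (real k * s ^ (k - 1)) - exp (- s) * s ^ k) * - (s\<^sup>2) =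
        exp (- s) * s ^ (k + 2) - real k * (exp (- s) * s ^ (k + 1))" for s :: real
      by (cases k) (simp_all add: algebra_simps power2_eq_square)
    ultimately have "((\<lambda>t. exp (- (1 / t)) * (1 / t) ^ k) has_real_derivative
        exp (- (1 / t)) * (1 / t) ^ (k + 2) - real k * (exp (- (1 / t)) * (1 / t) ^ (k + 1))) (at t)"
      by metis
    then have "(flat k has_real_derivative
        exp (- (1 / t)) * (1 / t) ^ (k + 2) - real k * (exp (- (1 / t)) * (1 / t) ^ (k + 1))) (at t)"
      by (rule has_field_derivative_transform_within_open[of _ _ _ "{0<..}"]) (use 3 in \<open>auto simp: flat_def\<close>)
    then show ?thesis using 3 by (simp add: flat_def)
  qed
qed

lemma ck_on_flat: "ck_on n UNIV (flat k)"
proof (induction n arbitrary: k)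
  case 0
  show ?case
    using DERIV_isCont[OF flat_has_derivative] by (simp add: continuous_at_imp_continuous_on)
next
  case (Suc n)
  have "ck_on n UNIV (\<lambda>t. (flat (k + 2) t + (- real k) * flat (k + 1) t) * v)" for v
    by (intro ck_on_bounded_linear[OF open_UNIV bounded_linear_mult_left] ck_on_add[OF open_UNIV]
        ck_on_bounded_linear[OF open_UNIV bounded_linear_mult_right] Suc.IH)
  then have "ck_on n UNIV (\<lambda>t. (flat (k + 2) t - real k * flat (k + 1) t) * v)" for v
    by simp
  then show ?case
    by (rule ck_on_SucI[OF open_UNIV flat_has_derivative[unfolded has_field_derivative_def]])
qed

lemma smooth_on_form_square:
  fixes b :: "'e::real_normed_vector \<Rightarrow>\<^sub>L 'e \<Rightarrow>\<^sub>L real"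
  shows "smooth_on UNIV (\<lambda>x. b (x - a) (x - a))"
proof -
  have d: "smooth_on UNIV (\<lambda>x. x - a)"
    using smooth_on_add[OF open_UNIV smooth_on_ident smooth_on_const[of _ "- a"]] by simp
  show ?thesis
    by (rule smooth_on_bilinear[OF open_UNIV bounded_bilinear_blinfun_apply
          smooth_on_bounded_linear[OF open_UNIV blinfun.bounded_linear_right d] d])
qed

text \<open>
  The smooth cut-off is a function of the squared distance, which is polynomial for the norm of an inner form.
\<close>

lemma (in inner_frame) bump_function_exists:
  fixes U :: "'e set"
  assumes "open U" "a \<in> U"
  obtains \<psi> K where "smooth_on UNIV \<psi>" "\<psi> a = (1::real)" "compact K" "K \<subseteq> U" "\<And>x. x \<notin> K \<Longrightarrow> \<psi> x = 0"
proof -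
  obtain e where e: "e > 0" "ball a e \<subseteq> U"
    using assms by (auto simp: open_contains_ball)
  obtain K where K: "K > 0" "\<And>x. (norm x)\<^sup>2 \<le> K * b x x"
    using coercive by blast
  define r where "r = e\<^sup>2 / (2 * K)"
  have r: "r > 0" using e K by (simp add: r_def)
  define \<psi> where "\<psi> x = flat 0 (r - b (x - a) (x - a)) / flat 0 r" for x
  have nz: "flat 0 r \<noteq> 0" using r by (simp add: flat_def)
  have fr: "frame {1::real} (\<lambda>_. id_blinfun)"
    by (simp add: frame_def)
  have "smooth_on UNIV (\<lambda>x. - b (x - a) (x - a))"
    by (rule smooth_on_bounded_linear[OF open_UNIV bounded_linear_minus[OF bounded_linear_ident] smooth_on_form_square])
  from smooth_on_add[OF open_UNIV smooth_on_const[of _ r] this]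
  have q: "smooth_on UNIV (\<lambda>x. r - b (x - a) (x - a))"
    by simp
  have "smooth_on UNIV (flat 0)"
    by (rule smooth_onI, rule ck_on_flat)
  from smooth_on_compose[OF fr open_UNIV open_UNIV UNIV_I q this]
  have "smooth_on UNIV \<psi>"
    unfolding \<psi>_def by (rule smooth_on_bounded_linear[OF open_UNIV bounded_linear_divide])
  moreover have "\<psi> a = 1" using nz by (simp add: \<psi>_def)
  moreover have "{x. b (x - a) (x - a) \<le> r} \<subseteq> U"
  proof
    fix x assume "x \<in> {x. b (x - a) (x - a) \<le> r}"
    then have "(norm (x - a))\<^sup>2 \<le> K * r"
      using K(1) by (intro order_trans[OF K(2)] mult_left_mono) simp_all
    also have "\<dots> < e\<^sup>2" using K e by (simp add: r_def)
    finally have "norm (x - a) < e"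
      using e by (simp add: power2_less_imp_less)
    then show "x \<in> U" using e(2) by (auto simp: dist_norm norm_minus_commute)
  qed
  moreover have "\<psi> x = 0" if "x \<notin> {x. b (x - a) (x - a) \<le> r}" for x
    using that by (simp add: \<psi>_def flat_def)
  ultimately show thesis
    by (rule that[OF _ _ compact_ball_form])
qed

section \<open>Tensor fields in charts\<close>

lemma dual_map_apply [simp]: "dual_map T \<alpha> = \<alpha> o\<^sub>L T"
  unfolding dual_map_def
  by (subst bounded_linear_Blinfun_apply)
     (rule bounded_bilinear.bounded_linear_left[OF bounded_bilinear_blinfun_compose], simp)

lemma bilinear_pullback_apply [simp]: "bilinear_pullback T b v w = b (T v) (T w)"
proof -
  have "bounded_linear (\<lambda>v. b (T v) o\<^sub>L T)"
    by (rule bounded_linear_compose[OF bounded_bilinear.bounded_linear_left[OF bounded_bilinear_blinfun_compose]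
          bounded_linear_compose[OF blinfun.bounded_linear_right blinfun.bounded_linear_right]])
  then show ?thesis
    by (simp add: bilinear_pullback_def bounded_linear_Blinfun_apply)
qed

text \<open>
  Duality on the model space (existence of the anchor map) and the chain rule are applied through a fixed frame.
\<close>

locale framed_manifold =
  fixes M :: "('a::{t2_space,second_countable_topology}, 'e::real_normed_vector) manifold"
    and B :: "'e set" and cd :: "'e \<Rightarrow> 'e covec"
  assumes manifold: "smooth_manifold M" and frame: "frame B cd"
begin

abbreviation coords :: "'a \<Rightarrow> 'e set" where
  "coords c \<equiv> chart M c ` chart_dom M c"

abbreviation rep_deriv :: "('a \<Rightarrow> 'e covec) \<Rightarrow> 'a \<Rightarrow> 'e \<Rightarrow> 'e covec" where
  "rep_deriv \<omega> p \<equiv> frechet_derivative (form_rep M p \<omega>) (at (chart M p p))"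

abbreviation bivector_deriv :: "('a \<Rightarrow> 'e covec \<Rightarrow>\<^sub>L 'e covec \<Rightarrow>\<^sub>L real) \<Rightarrow> 'a \<Rightarrow> 'e \<Rightarrow> 'e covec \<Rightarrow>\<^sub>L 'e covec \<Rightarrow>\<^sub>L real" where
  "bivector_deriv P p \<equiv> frechet_derivative (bivector_rep M p P) (at (chart M p p))"

lemma chart_dom_self [simp]: "c \<in> chart_dom M c"
  using manifold by (simp add: smooth_manifold_def)

lemma open_chart_dom: "open (chart_dom M c)"
  using manifold by (simp add: smooth_manifold_def)

lemma open_coords: "open (coords c)"
  using manifold by (simp add: smooth_manifold_def)

lemma chart_homeomorphism: "homeomorphism (chart_dom M c) (coords c) (chart M c) (chart_inv M c)"
  using manifold by (simp add: smooth_manifold_def)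

lemma smooth_transition:
  "smooth_on (chart M c ` (chart_dom M c \<inter> chart_dom M d)) (chart M d \<circ> chart_inv M c)"
  using manifold by (simp add: smooth_manifold_def)

lemma finite_dimensional: "\<exists>A::'e set. finite A \<and> span A = UNIV"
  using manifold by (simp add: smooth_manifold_def)

lemma chart_inv_chart [simp]: "p \<in> chart_dom M c \<Longrightarrow> chart_inv M c (chart M c p) = p"
  using chart_homeomorphism[of c] by (simp add: homeomorphism_def)

lemma chart_chart_inv [simp]: "x \<in> coords c \<Longrightarrow> chart M c (chart_inv M c x) = x"
  using chart_homeomorphism[of c] by (auto simp: homeomorphism_def)

lemma chart_inv_dom [simp]: "x \<in> coords c \<Longrightarrow> chart_inv M c x \<in> chart_dom M c"
  by auto

lemma center_coords [simp]: "chart M c c \<in> coords c"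
  by (rule imageI) simp

lemma open_chart_image:
  assumes "open V" "V \<subseteq> chart_dom M c"
  shows "open (chart M c ` V)"
proof -
  have "chart M c ` V = chart_inv M c -` V \<inter> coords c"
    using assms(2) by force
  moreover have "continuous_on (coords c) (chart_inv M c)"
    using chart_homeomorphism[of c] by (simp add: homeomorphism_def)
  ultimately show ?thesis
    using continuous_on_open_vimage[OF open_coords, of c "chart_inv M c"] assms(1) by simp
qed

lemma open_overlap: "open (chart M c ` (chart_dom M c \<inter> chart_dom M d))"
  by (intro open_chart_image open_Int open_chart_dom) auto

lemma transition_has_derivative:
  assumes "p \<in> chart_dom M c" "p \<in> chart_dom M d"
  shows "((chart M d \<circ> chart_inv M c) has_derivative coord_change M p c d) (at (chart M c p))"
proof -
  have "((chart M d \<circ> chart_inv M c) has_derivative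
      frechet_derivative (chart M d \<circ> chart_inv M c) (at (chart M c p))) (at (chart M c p))"
    using assms by (intro smooth_on_has_derivative[OF smooth_transition]) auto
  then show ?thesis
    by (simp add: coord_change_def bounded_linear_Blinfun_apply has_derivative_bounded_linear)
qed

lemma coord_change_inverse:
  assumes "p \<in> chart_dom M c" "p \<in> chart_dom M d"
  shows "coord_change M p d c (coord_change M p c d v) = v"
proof -
  have "((chart M d \<circ> chart_inv M c) has_derivative coord_change M p c d) (at (chart M c p))"
    by (rule transition_has_derivative[OF assms])
  moreover have "((chart M c \<circ> chart_inv M d) has_derivative coord_change M p d c)
      (at ((chart M d \<circ> chart_inv M c) (chart M c p)))"
    using transition_has_derivative[OF assms(2,1)] assms by simp
  ultimately have "((\<lambda>x. (chart M c \<circ> chart_inv M d) ((chart M d \<circ> chart_inv M c) x)) has_derivative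
      (\<lambda>v. coord_change M p d c (coord_change M p c d v))) (at (chart M c p))"
    by (rule has_derivative_compose)
  then have "((\<lambda>x. x) has_derivative (\<lambda>v. coord_change M p d c (coord_change M p c d v))) (at (chart M c p))"
    by (rule has_derivative_transform_within_open[OF _ open_overlap[of c d]]) (use assms in auto)
  from has_derivative_unique[OF this has_derivative_ident] show ?thesis
    by metis
qed

lemma coord_change_self: "p \<in> chart_dom M c \<Longrightarrow> coord_change M p c c v = v"
proof -
  assume p: "p \<in> chart_dom M c"
  have "((\<lambda>x. x) has_derivative coord_change M p c c) (at (chart M c p))"
    by (rule has_derivative_transform_within_open[OF transition_has_derivative[OF p p] open_coords[of c]]) (use p in auto)
  from has_derivative_unique[OF this has_derivative_ident] show ?thesis
    by metis
qed

lemma form_rep_apply: "form_rep M c \<omega> x v = \<omega> (chart_inv M c x) (coord_change M (chart_inv M c x) c (chart_inv M c x) v)"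
  by (simp add: form_rep_def Let_def)

lemma bivector_rep_apply:
  "bivector_rep M c P x \<alpha> \<beta> =
    P (chart_inv M c x) (\<alpha> o\<^sub>L coord_change M (chart_inv M c x) (chart_inv M c x) c)
      (\<beta> o\<^sub>L coord_change M (chart_inv M c x) (chart_inv M c x) c)"
  by (simp add: bivector_rep_def Let_def)

lemma metric_rep_apply:
  "metric_rep M c g x v w =
    g (chart_inv M c x) (coord_change M (chart_inv M c x) c (chart_inv M c x) v)
      (coord_change M (chart_inv M c x) c (chart_inv M c x) w)"
  by (simp add: metric_rep_def Let_def)

text \<open>
  The representations of a form and of a bivector in a chart are contragredient, so that pairings may be computed
  in any chart.
\<close>

lemma form_rep_compose:
  assumes "x \<in> coords c"
  shows "form_rep M c \<omega> x o\<^sub>L coord_change M (chart_inv M c x) (chart_inv M c x) c = \<omega> (chart_inv M c x)"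
  using assms by (intro blinfun_eqI) (simp add: form_rep_apply coord_change_inverse)

lemma form_rep_center: "form_rep M p \<omega> (chart M p p) = \<omega> p"
  by (rule blinfun_eqI) (simp add: form_rep_apply coord_change_self)

lemma bivector_rep_center: "bivector_rep M p P (chart M p p) \<alpha> \<beta> = P p \<alpha> \<beta>"
proof -
  have "\<alpha> o\<^sub>L coord_change M p p p = \<alpha>" for \<alpha> :: "'e covec"
    by (rule blinfun_eqI) (simp add: coord_change_self)
  then show ?thesis
    by (simp add: bivector_rep_apply)
qed

lemma bivector_rep_forms:
  assumes "x \<in> coords c"
  shows "bivector_rep M c P x (form_rep M c \<omega> x) (form_rep M c \<eta> x)
    = P (chart_inv M c x) (\<omega> (chart_inv M c x)) (\<eta> (chart_inv M c x))"
  by (simp add: bivector_rep_apply form_rep_compose[OF assms])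

lemma one_formD: "one_form M \<omega> \<Longrightarrow> smooth_on (coords c) (form_rep M c \<omega>)"
  by (simp add: one_form_def)

lemma smooth_functionD: "smooth_function M f \<Longrightarrow> smooth_on (coords c) (f \<circ> chart_inv M c)"
  by (simp add: smooth_function_def)

lemma one_form_has_derivative:
  "one_form M \<omega> \<Longrightarrow> (form_rep M p \<omega> has_derivative rep_deriv \<omega> p) (at (chart M p p))"
  by (rule smooth_on_has_derivative[OF one_formD center_coords])

lemma bivector_has_derivative:
  "bivector_field M P \<Longrightarrow>
    (bivector_rep M p P has_derivative bivector_deriv P p) (at (chart M p p))"
  by (rule smooth_on_has_derivative[OF _ center_coords]) (simp add: bivector_field_def)

lemma differentialI:
  assumes "((f \<circ> chart_inv M p) has_derivative f') (at (chart M p p))"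
  shows "blinfun_apply (differential M f p) = f'"
  using frechet_derivative_at[OF assms] has_derivative_bounded_linear[OF assms]
  by (simp add: differential_def bounded_linear_Blinfun_apply)

lemma differential_has_derivative:
  assumes "(f \<circ> chart_inv M p) differentiable (at (chart M p p))"
  shows "((f \<circ> chart_inv M p) has_derivative differential M f p) (at (chart M p p))"
  using assms differentialI unfolding differentiable_def by metis

lemma smooth_function_has_derivative:
  assumes "smooth_function M f"
  shows "((f \<circ> chart_inv M p) has_derivative differential M f p) (at (chart M p p))"
  using smooth_on_has_derivative[OF smooth_functionD[OF assms] center_coords]
  by (intro differential_has_derivative) (auto simp: differentiable_def)

subsection \<open>The anchor map\<close>

lemma apply_sharp:
  fixes \<eta> :: "'e covec"
  shows "\<eta> (sharp P \<omega> p) = P p (\<omega> p) \<eta>"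
proof -
  let ?v = "\<Sum>b\<in>B. P p (\<omega> p) (cd b) *\<^sub>R b"
  have v: "blinfun_apply \<eta> ?v = P p (\<omega> p) \<eta>" for \<eta>
    unfolding frame_covec_expand[OF frame, of \<eta>, symmetric, THEN arg_cong, of "blinfun_apply (P p (\<omega> p))"]
    by (simp add: blinfun.sum_right blinfun.scaleR_right mult.commute)
  have uniq: "u = ?v" if "\<forall>\<eta>. blinfun_apply \<eta> u = P p (\<omega> p) \<eta>" for u
    using frame_expand[OF frame, of u] that by simp
  have "sharp P \<omega> p = ?v"
    unfolding sharp_def using v uniq by (intro the_equality) auto
  then show ?thesis
    using v by simp
qed

lemma vector_eqI:
  assumes "\<And>\<eta> :: 'e covec. \<eta> u = \<eta> v"
  shows "u = (v::'e)"
proof -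
  have "(\<Sum>b\<in>B. cd b u *\<^sub>R b) = (\<Sum>b\<in>B. cd b v *\<^sub>R b)"
    using assms by (intro sum.cong) auto
  then show ?thesis
    by (simp add: frame_expand[OF frame])
qed

lemma vector_rep_sharp:
  assumes "x \<in> coords c"
  shows "blinfun_apply \<eta> (vector_rep M c (sharp P \<omega>) x) = bivector_rep M c P x (form_rep M c \<omega> x) \<eta>"
proof -
  let ?p = "chart_inv M c x"
  have "blinfun_apply \<eta> (vector_rep M c (sharp P \<omega>) x) = (\<eta> o\<^sub>L coord_change M ?p ?p c) (sharp P \<omega> ?p)"
    by (simp add: vector_rep_def Let_def)
  also have "\<dots> = P ?p (\<omega> ?p) (\<eta> o\<^sub>L coord_change M ?p ?p c)"
    by (rule apply_sharp)
  finally show ?thesis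
    by (simp add: bivector_rep_apply form_rep_compose[OF assms])
qed

text \<open>
  The definition of the Lie derivative refers to the derivative of the coordinate representation of the vector
  field, so this representation has to be differentiable for the definition to be meaningful.
\<close>

lemma vector_rep_sharp_differentiable:
  assumes "bivector_field M P" "one_form M \<omega>"
  shows "vector_rep M p (sharp P \<omega>) differentiable (at (chart M p p))"
proof -
  have "((\<lambda>x. \<Sum>b\<in>B. bivector_rep M p P x (form_rep M p \<omega> x) (cd b) *\<^sub>R b) has_derivative
     (\<lambda>h. \<Sum>b\<in>B. (bivector_rep M p P (chart M p p) (rep_deriv \<omega> p h) +
        bivector_deriv P p h (form_rep M p \<omega> (chart M p p))) (cd b) *\<^sub>R b))
     (at (chart M p p))"
    by (intro has_derivative_sum has_derivative_scaleR_left bounded_linear.has_derivative[OF blinfun.bounded_linear_left]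
        bounded_bilinear.FDERIV[OF bounded_bilinear_blinfun_apply] bivector_has_derivative[OF assms(1)]
        one_form_has_derivative[OF assms(2)])
  moreover have "(\<Sum>b\<in>B. bivector_rep M p P x (form_rep M p \<omega> x) (cd b) *\<^sub>R b) = vector_rep M p (sharp P \<omega>) x"
    if "x \<in> coords p" for x
    using frame_expand[OF frame, of "vector_rep M p (sharp P \<omega>) x"] by (simp add: vector_rep_sharp[OF that])
  ultimately show ?thesis
    unfolding differentiable_def
    using has_derivative_transform_within_open[OF _ open_coords center_coords] by blast
qed

subsection \<open>The bracket of one-forms in a chart\<close>

text \<open>
  In a chart \<open>\<sharp>\<omega> = \<Pi>(\<omega>, -)\<close>, so the term \<open>\<eta>(D(\<sharp>\<omega>) v)\<close> expands by the product rule and the vector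
  field disappears from the formula.
\<close>

lemma lie_form_sharp:
  assumes "bivector_field M P" "one_form M \<omega>" "one_form M \<eta>"
  shows "lie_form M (sharp P \<omega>) \<eta> p v =
    rep_deriv \<eta> p (sharp P \<omega> p) v
    + P p (rep_deriv \<omega> p v) (\<eta> p)
    + bivector_deriv P p v (\<omega> p) (\<eta> p)"
proof -
  let ?x = "chart M p p"
  let ?W = "frechet_derivative (form_rep M p \<omega>) (at ?x)" and ?Q = "frechet_derivative (bivector_rep M p P) (at ?x)"
    and ?X = "frechet_derivative (vector_rep M p (sharp P \<omega>)) (at ?x)"
  have X: "(vector_rep M p (sharp P \<omega>) has_derivative ?X) (at ?x)"
    using vector_rep_sharp_differentiable[OF assms(1,2)] frechet_derivative_works by blast
  have "bounded_linear (\<lambda>v. blinfun_apply (frechet_derivative (form_rep M p \<eta>) (at ?x) (sharp P \<omega> p)) v + \<eta> p (?X v))"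
    by (intro bounded_linear_add blinfun.bounded_linear_right
        bounded_linear_compose[OF blinfun.bounded_linear_right has_derivative_bounded_linear[OF X]])
  then have lie: "lie_form M (sharp P \<omega>) \<eta> p v =
      frechet_derivative (form_rep M p \<eta>) (at ?x) (sharp P \<omega> p) v + \<eta> p (?X v)"
    by (simp add: lie_form_def bounded_linear_Blinfun_apply)
  have "((\<lambda>x. \<eta> p (vector_rep M p (sharp P \<omega>) x)) has_derivative (\<lambda>v. \<eta> p (?X v))) (at ?x)"
    by (rule bounded_linear.has_derivative[OF blinfun.bounded_linear_right X])
  then have d1: "((\<lambda>x. bivector_rep M p P x (form_rep M p \<omega> x) (\<eta> p)) has_derivative (\<lambda>v. \<eta> p (?X v))) (at ?x)"
    by (rule has_derivative_transform_within_open[OF _ open_coords center_coords]) (rule vector_rep_sharp)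
  have d2: "((\<lambda>x. bivector_rep M p P x (form_rep M p \<omega> x) (\<eta> p)) has_derivative
      (\<lambda>v. (bivector_rep M p P ?x (?W v) + ?Q v (form_rep M p \<omega> ?x)) (\<eta> p))) (at ?x)"
    by (intro bounded_linear.has_derivative[OF blinfun.bounded_linear_left]
        bounded_bilinear.FDERIV[OF bounded_bilinear_blinfun_apply] bivector_has_derivative[OF assms(1)]
        one_form_has_derivative[OF assms(2)])
  have "\<eta> p (?X v) = (bivector_rep M p P ?x (?W v) + ?Q v (form_rep M p \<omega> ?x)) (\<eta> p)"
    by (rule fun_cong[OF has_derivative_unique[OF d1 d2]])
  then show ?thesis
    unfolding lie by (simp add: blinfun.add_left bivector_rep_center form_rep_center)
qed

lemma bivector_pairing_has_derivative:
  assumes "bivector_field M P" "one_form M \<omega>" "one_form M \<eta>"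
  shows "(((\<lambda>q. P q (\<omega> q) (\<eta> q)) \<circ> chart_inv M p) has_derivative (\<lambda>v.
    P p (\<omega> p) (rep_deriv \<eta> p v)
    + P p (rep_deriv \<omega> p v) (\<eta> p)
    + bivector_deriv P p v (\<omega> p) (\<eta> p))) (at (chart M p p))"
proof -
  let ?x = "chart M p p"
  have "((\<lambda>x. bivector_rep M p P x (form_rep M p \<omega> x) (form_rep M p \<eta> x)) has_derivative (\<lambda>v.
      bivector_rep M p P ?x (form_rep M p \<omega> ?x) (frechet_derivative (form_rep M p \<eta>) (at ?x) v) +
      (bivector_rep M p P ?x (frechet_derivative (form_rep M p \<omega>) (at ?x) v) +
        frechet_derivative (bivector_rep M p P) (at ?x) v (form_rep M p \<omega> ?x)) (form_rep M p \<eta> ?x))) (at ?x)"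
    by (intro bounded_bilinear.FDERIV[OF bounded_bilinear_blinfun_apply] bivector_has_derivative[OF assms(1)]
        one_form_has_derivative[OF assms(2)] one_form_has_derivative[OF assms(3)])
  then have "((\<lambda>x. bivector_rep M p P x (form_rep M p \<omega> x) (form_rep M p \<eta> x)) has_derivative (\<lambda>v.
    P p (\<omega> p) (frechet_derivative (form_rep M p \<eta>) (at ?x) v)
    + P p (frechet_derivative (form_rep M p \<omega>) (at ?x) v) (\<eta> p)
    + frechet_derivative (bivector_rep M p P) (at ?x) v (\<omega> p) (\<eta> p))) (at ?x)"
    by (simp add: blinfun.add_left bivector_rep_center form_rep_center add.assoc)
  then show ?thesis
    by (rule has_derivative_transform_within_open[OF _ open_coords center_coords]) (simp add: bivector_rep_forms)
qed

lemma bivector_skew: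
  assumes "bivector_field M P"
  shows "P p \<alpha> \<beta> = - P p \<beta> \<alpha>"
proof -
  have "P p (\<alpha> + \<beta>) (\<alpha> + \<beta>) = 0" "P p \<alpha> \<alpha> = 0" "P p \<beta> \<beta> = 0"
    using assms by (auto simp: bivector_field_def)
  then show ?thesis
    by (simp add: blinfun.add_left blinfun.add_right)
qed

lemma bivector_derivative_skew:
  assumes "bivector_field M P"
  shows "bivector_deriv P p v \<alpha> \<beta> =
    - bivector_deriv P p v \<beta> \<alpha>"
proof -
  let ?Q = "bivector_deriv P p"
  have d: "((\<lambda>x. bivector_rep M p P x \<alpha> \<beta>) has_derivative (\<lambda>v. ?Q v \<alpha> \<beta>)) (at (chart M p p))" for \<alpha> \<beta>
    by (intro bounded_linear.has_derivative[OF blinfun.bounded_linear_left] bivector_has_derivative assms)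
  have "bivector_rep M p P x \<alpha> \<beta> = - bivector_rep M p P x \<beta> \<alpha>" for x
    unfolding bivector_rep_apply by (rule bivector_skew[OF assms])
  then have d': "((\<lambda>x. bivector_rep M p P x \<alpha> \<beta>) has_derivative (\<lambda>v. - ?Q v \<beta> \<alpha>)) (at (chart M p p))"
    using has_derivative_minus[OF d[of \<beta> \<alpha>]] by presburger
  show ?thesis
    by (rule fun_cong[OF has_derivative_unique[OF d d']])
qed

text \<open>
  The derivatives \<open>D\<omega> v\<close> and \<open>D\<eta> v\<close> in the direction of the argument cancel between the two Lie derivatives and the
  differential of \<open>\<Pi>(\<omega>,\<eta>)\<close>; of the three derivatives of \<open>\<Pi>\<close> one survives, by skew-symmetry. All brackets on the product
  are read off from this expression.
\<close>

lemma form_bracket_apply: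
  assumes "bivector_field M P" "one_form M \<omega>" "one_form M \<eta>"
  shows "form_bracket M P \<omega> \<eta> p v =
    rep_deriv \<eta> p (sharp P \<omega> p) v
    - rep_deriv \<omega> p (sharp P \<eta> p) v
    + bivector_deriv P p v (\<omega> p) (\<eta> p)"
  using bivector_skew[OF assms(1), of p "\<omega> p"] bivector_derivative_skew[OF assms(1), of p v "\<omega> p"]
  by (simp add: form_bracket_def blinfun.diff_left lie_form_sharp assms
      differentialI[OF bivector_pairing_has_derivative[OF assms]])

end

section \<open>Cometrics\<close>

locale inner_metric =
  fixes g :: "'a \<Rightarrow> 'e::real_normed_vector \<Rightarrow>\<^sub>L 'e \<Rightarrow>\<^sub>L real"
  assumes inner: "inner_form (g p)" and fin: "\<exists>A::'e set. finite A \<and> span A = UNIV"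
begin

lemma frame_at: obtains B where "frame B (blinfun_apply (g p))"
  using orthonormal_frame_exists[OF inner fin] .

lemma metric_sharp_apply: "g p (metric_sharp (g p) \<alpha>) w = blinfun_apply \<alpha> w"
proof -
  obtain B where "frame B (blinfun_apply (g p))"
    by (rule frame_at)
  then interpret inner_frame "g p" B
    using inner by unfold_locales
  show ?thesis by (rule metric_sharp_apply)
qed

lemma cometric_sharp: "cometric g p \<alpha> \<beta> = blinfun_apply \<alpha> (metric_sharp (g p) \<beta>)"
  by (simp add: cometric_def metric_sharp_apply)

lemma cometric_frame:
  assumes "frame B (blinfun_apply (g p))"
  shows "cometric g p \<alpha> \<beta> = (\<Sum>u\<in>B. blinfun_apply \<alpha> u * blinfun_apply \<beta> u)"
  by (simp add: cometric_sharp metric_sharp_frame[OF inner assms] blinfun.sum_right blinfun.scaleR_right mult.commute)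

lemma cometric_commute: "cometric g p \<alpha> \<beta> = cometric g p \<beta> \<alpha>"
  by (simp add: cometric_def inner_form_sym[OF inner])

lemma cometric_add_left: "cometric g p (\<alpha> + \<beta>) \<gamma> = cometric g p \<alpha> \<gamma> + cometric g p \<beta> \<gamma>"
  and cometric_diff_left: "cometric g p (\<alpha> - \<beta>) \<gamma> = cometric g p \<alpha> \<gamma> - cometric g p \<beta> \<gamma>"
  and cometric_scaleR_left: "cometric g p (r *\<^sub>R \<alpha>) \<gamma> = r * cometric g p \<alpha> \<gamma>"
  and cometric_zero_left: "cometric g p 0 \<gamma> = 0"
  by (simp_all add: cometric_sharp blinfun.bilinear_simps)

lemma cometric_add_right: "cometric g p \<gamma> (\<alpha> + \<beta>) = cometric g p \<gamma> \<alpha> + cometric g p \<gamma> \<beta>"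
  and cometric_diff_right: "cometric g p \<gamma> (\<alpha> - \<beta>) = cometric g p \<gamma> \<alpha> - cometric g p \<gamma> \<beta>"
  and cometric_scaleR_right: "cometric g p \<gamma> (r *\<^sub>R \<alpha>) = r * cometric g p \<gamma> \<alpha>"
  and cometric_zero_right: "cometric g p \<gamma> 0 = 0"
  by (simp_all add: cometric_commute[of p \<gamma>] cometric_add_left cometric_diff_left cometric_scaleR_left cometric_zero_left)

lemmas cometric_simps = cometric_add_left cometric_diff_left cometric_scaleR_left cometric_zero_left
  cometric_add_right cometric_diff_right cometric_scaleR_right cometric_zero_right

lemma cometric_eq_0:
  assumes "cometric g p \<alpha> \<alpha> = 0"
  shows "\<alpha> = 0"
proof -
  have "metric_sharp (g p) \<alpha> = 0"
    using assms inner_form_pos[OF inner] unfolding cometric_def by (metis less_irrefl)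
  then show ?thesis
    using metric_sharp_apply[of p \<alpha>] by (intro blinfun_eqI) simp
qed

lemma cometric_nonneg: "cometric g p \<alpha> \<alpha> \<ge> 0"
  unfolding cometric_def by (rule inner_form_nonneg[OF inner])

text \<open>
  Makes the denominator of the sectional curvature nonnegative.
\<close>

lemma cometric_Cauchy_Schwarz: "(cometric g p \<alpha> \<beta>)\<^sup>2 \<le> cometric g p \<alpha> \<alpha> * cometric g p \<beta> \<beta>"
proof -
  obtain B where B: "frame B (blinfun_apply (g p))"
    by (rule frame_at)
  show ?thesis
    unfolding cometric_frame[OF B] power2_eq_square[symmetric]
    by (rule Cauchy_Schwarz_ineq_sum)
qed

end

context framed_manifold
begin

lemma riemannian_inner_metric: "riemannian_metric M g \<Longrightarrow> inner_metric g"
  using finite_dimensional by unfold_locales (auto simp: riemannian_metric_def inner_form_def)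

text \<open>
  The cometric is the inverse of the metric, so this needs the differentiability of the solution of a linear system.
  Without it the differential of the pairing in the metric identity would be an arbitrary value, and the identity could
  not be transported between the product and its factors.
\<close>

lemma cometric_differentiable:
  assumes "riemannian_metric M g" "one_form M \<eta>" "one_form M \<gamma>"
  shows "((\<lambda>q. cometric g q (\<eta> q) (\<gamma> q)) \<circ> chart_inv M p) differentiable (at (chart M p p))"
proof -
  interpret inner_metric g
    by (rule riemannian_inner_metric[OF assms(1)])
  let ?G = "metric_rep M p g" and ?N = "form_rep M p \<eta>" and ?C = "form_rep M p \<gamma>"
  have G_inner: "inner_form (?G x)" if "x \<in> coords p" for x
    unfolding inner_form_def
  proof (intro conjI allI impI)
    fix v w
    show "?G x v w = ?G x w v"
      by (simp add: metric_rep_apply inner_form_sym[OF inner, of _ "coord_change M (chart_inv M p x) p (chart_inv M p x) v"])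
  next
    fix v :: 'e assume "v \<noteq> 0"
    then have "coord_change M (chart_inv M p x) p (chart_inv M p x) v \<noteq> 0"
      using coord_change_inverse[of "chart_inv M p x" p "chart_inv M p x" v] that by auto
    then show "?G x v v > 0"
      by (simp add: metric_rep_apply inner_form_pos[OF inner])
  qed
  have eq: "?N x (metric_sharp (?G x) (?C x)) = cometric g (chart_inv M p x) (\<eta> (chart_inv M p x)) (\<gamma> (chart_inv M p x))"
    if x: "x \<in> coords p" for x
  proof -
    let ?q = "chart_inv M p x"
    let ?s = "metric_sharp (g ?q) (\<gamma> ?q)"
    have "metric_sharp (?G x) (?C x) = coord_change M ?q ?q p ?s"
      by (rule metric_sharp_unique[OF G_inner[OF x]])
         (simp add: metric_rep_apply coord_change_inverse chart_inv_dom[OF x] metric_sharp_apply form_rep_apply)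
    then show ?thesis
      by (simp add: form_rep_apply coord_change_inverse chart_inv_dom[OF x] cometric_sharp)
  qed
  have "smooth_on (coords p) ?G"
    using assms(1) by (simp add: riemannian_metric_def)
  then have "(?G has_derivative frechet_derivative ?G (at (chart M p p))) (at (chart M p p))"
    by (rule smooth_on_has_derivative) simp
  from metric_sharp_differentiable[OF finite_dimensional open_coords center_coords G_inner this one_form_has_derivative[OF assms(3)]]
  have "(\<lambda>x. metric_sharp (?G x) (?C x)) differentiable (at (chart M p p))" .
  then obtain u' where "((\<lambda>x. metric_sharp (?G x) (?C x)) has_derivative u') (at (chart M p p))"
    by (auto simp: differentiable_def)
  from bounded_bilinear.FDERIV[OF bounded_bilinear_blinfun_apply one_form_has_derivative[OF assms(2)] this]
  have "(\<lambda>x. ?N x (metric_sharp (?G x) (?C x))) differentiable (at (chart M p p))"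
    by (auto simp: differentiable_def)
  then show ?thesis
    by (rule differentiable_cong_open[OF open_coords center_coords, rotated]) (simp add: eq)
qed

section \<open>Smooth functions and one-forms\<close>

lemma smooth_function_const: "smooth_function M (\<lambda>_. r)"
  by (simp add: smooth_function_def o_def smooth_on_const)

lemma smooth_function_mult:
  assumes "smooth_function M f" "smooth_function M h"
  shows "smooth_function M (\<lambda>q. f q * h q)"
  using smooth_on_bilinear[OF open_coords bounded_bilinear_mult smooth_functionD[OF assms(1)] smooth_functionD[OF assms(2)]]
  by (simp add: smooth_function_def o_def)

lemma smooth_function_pairing:
  assumes "bivector_field M P" "one_form M \<omega>" "one_form M \<eta>"
  shows "smooth_function M (\<lambda>q. P q (\<omega> q) (\<eta> q))"
  unfolding smooth_function_def
proof
  fix c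
  have P: "smooth_on (coords c) (bivector_rep M c P)"
    using assms(1) by (simp add: bivector_field_def)
  have "smooth_on (coords c) (\<lambda>x. bivector_rep M c P x (form_rep M c \<omega> x) (form_rep M c \<eta> x))"
    by (rule smooth_on_bilinear[OF open_coords bounded_bilinear_blinfun_apply
          smooth_on_bilinear[OF open_coords bounded_bilinear_blinfun_apply P one_formD[OF assms(2)]] one_formD[OF assms(3)]])
  then show "smooth_on (coords c) ((\<lambda>q. P q (\<omega> q) (\<eta> q)) \<circ> chart_inv M c)"
    by (rule smooth_on_cong[OF open_coords, rotated]) (simp add: bivector_rep_forms)
qed

lemma one_form_scaleR:
  assumes "smooth_function M f" "one_form M \<omega>"
  shows "one_form M (\<lambda>q. f q *\<^sub>R \<omega> q)"
  unfolding one_form_def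
proof
  fix c
  have "form_rep M c (\<lambda>q. f q *\<^sub>R \<omega> q) = (\<lambda>x. (f \<circ> chart_inv M c) x *\<^sub>R form_rep M c \<omega> x)"
    by (intro ext blinfun_eqI) (simp add: form_rep_apply blinfun.scaleR_left)
  then show "smooth_on (coords c) (form_rep M c (\<lambda>q. f q *\<^sub>R \<omega> q))"
    using smooth_on_bilinear[OF open_coords bounded_bilinear_scaleR smooth_functionD[OF assms(1)] one_formD[OF assms(2)]]
    by simp
qed

lemma one_form_add:
  assumes "one_form M \<omega>" "one_form M \<eta>"
  shows "one_form M (\<lambda>q. \<omega> q + \<eta> q)"
  unfolding one_form_def
proof
  fix c
  have "form_rep M c (\<lambda>q. \<omega> q + \<eta> q) = (\<lambda>x. form_rep M c \<omega> x + form_rep M c \<eta> x)"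
    by (intro ext blinfun_eqI) (simp add: form_rep_apply blinfun.add_left)
  then show "smooth_on (coords c) (form_rep M c (\<lambda>q. \<omega> q + \<eta> q))"
    using smooth_on_add[OF open_coords one_formD[OF assms(1)] one_formD[OF assms(2)]] by simp
qed

lemma one_form_diff:
  assumes "one_form M \<omega>" "one_form M \<eta>"
  shows "one_form M (\<lambda>q. \<omega> q - \<eta> q)"
  using one_form_add[OF assms(1) one_form_scaleR[OF smooth_function_const[of "- 1"] assms(2)]] by simp

lemma one_form_zero: "one_form M (\<lambda>_. 0)"
proof -
  have "form_rep M c (\<lambda>_. 0) = (\<lambda>x. 0)" for c
    by (intro ext blinfun_eqI) (simp add: form_rep_apply)
  then show ?thesis
    by (simp add: one_form_def smooth_on_const)
qed

text \<open>
  By the chain rule the components of \<open>df\<close> in any chart are the partial derivatives of \<open>f\<close> in that chart, although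
  the differential is defined in a chart depending on the point.
\<close>

lemma form_rep_differential:
  assumes "smooth_function M f" "x \<in> coords c"
  shows "form_rep M c (differential M f) x = Blinfun (frechet_derivative (f \<circ> chart_inv M c) (at x))"
proof -
  let ?p = "chart_inv M c x"
  have p: "?p \<in> chart_dom M c" "chart M c ?p = x"
    using assms(2) by simp_all
  have "((chart M ?p \<circ> chart_inv M c) has_derivative coord_change M ?p c ?p) (at x)"
    using transition_has_derivative[of ?p c ?p] p by simp
  moreover have "((f \<circ> chart_inv M ?p) has_derivative differential M f ?p) (at ((chart M ?p \<circ> chart_inv M c) x))"
    using smooth_function_has_derivative[OF assms(1), of ?p] by simp
  ultimately have "((\<lambda>y. (f \<circ> chart_inv M ?p) ((chart M ?p \<circ> chart_inv M c) y)) has_derivative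
      (\<lambda>v. differential M f ?p (coord_change M ?p c ?p v))) (at x)"
    by (rule has_derivative_compose)
  then have "((f \<circ> chart_inv M c) has_derivative (\<lambda>v. differential M f ?p (coord_change M ?p c ?p v))) (at x)"
  proof (rule has_derivative_transform_within_open[OF _ open_overlap[of c ?p]])
    show "x \<in> chart M c ` (chart_dom M c \<inter> chart_dom M ?p)"
      by (rule image_eqI[of _ _ ?p]) (use p in auto)
  qed auto
  from frechet_derivative_at[OF this, symmetric] has_derivative_bounded_linear[OF this] show ?thesis
    by (intro blinfun_eqI) (simp add: form_rep_apply bounded_linear_Blinfun_apply)
qed

lemma one_form_differential:
  assumes "smooth_function M f"
  shows "one_form M (differential M f)"
  unfolding one_form_def
proof
  fix c
  have "smooth_on (coords c) (\<lambda>x. Blinfun (frechet_derivative (f \<circ> chart_inv M c) (at x)))"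
    by (rule smooth_on_Blinfun_derivative[OF frame open_coords smooth_functionD[OF assms]])
  then show "smooth_on (coords c) (form_rep M c (differential M f))"
    by (rule smooth_on_cong[OF open_coords, rotated]) (simp add: form_rep_differential[OF assms])
qed

text \<open>
  A linear function in a chart, cut off by a bump function. The Hausdorff property makes the
  extension by zero smooth: the support is compact, hence closed.
\<close>

lemma function_with_differential_exists:
  fixes g :: "'a \<Rightarrow> 'e \<Rightarrow>\<^sub>L 'e \<Rightarrow>\<^sub>L real"
  assumes "inner_metric g"
  obtains f where "smooth_function M f" "differential M f p = \<alpha>"
proof -
  interpret inner_metric g by (rule assms)
  obtain Bg where "frame Bg (blinfun_apply (g p))"
    by (rule frame_at)
  then interpret inner_frame "g p" Bg
    using inner by unfold_locales
  define a where "a = chart M p p"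
  obtain \<psi> K where \<psi>: "smooth_on UNIV \<psi>" "\<psi> a = (1::real)" and K: "compact K" "K \<subseteq> coords p" "\<And>x. x \<notin> K \<Longrightarrow> \<psi> x = 0"
    using bump_function_exists[OF open_coords, of a p] unfolding a_def by (metis center_coords)
  define F where "F x = \<alpha> (x + - a) * \<psi> x" for x
  have "smooth_on UNIV (\<lambda>x. \<alpha> (x + - a))"
    by (rule smooth_on_bounded_linear[OF open_UNIV blinfun.bounded_linear_right
          smooth_on_add[OF open_UNIV smooth_on_ident smooth_on_const]])
  then have F: "smooth_on UNIV F"
    unfolding F_def by (rule smooth_on_bilinear[OF open_UNIV bounded_bilinear_mult _ \<psi>(1)])
  define f where "f q = (if q \<in> chart_dom M p then F (chart M p q) else 0)" for q
  define K' where "K' = chart_inv M p ` K"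
  have "continuous_on K (chart_inv M p)"
    using chart_homeomorphism[of p] K(2) by (auto simp: homeomorphism_def intro: continuous_on_subset)
  then have "closed K'"
    unfolding K'_def using K(1) by (intro compact_imp_closed compact_continuous_image)
  have f0: "f q = 0" if "q \<notin> K'" for q
  proof (cases "q \<in> chart_dom M p")
    case True
    then have "chart M p q \<notin> K"
      using that unfolding K'_def by (metis chart_inv_chart imageI)
    then show ?thesis by (simp add: f_def F_def K(3))
  qed (simp add: f_def)
  have "smooth_function M f"
    unfolding smooth_function_def
  proof (intro allI smooth_on_locally)
    fix c x assume x: "x \<in> coords c"
    let ?q = "chart_inv M c x"
    show "\<exists>T. open T \<and> x \<in> T \<and> smooth_on T (f \<circ> chart_inv M c)"
    proof (cases "?q \<in> chart_dom M p")
      case True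
      let ?T = "chart M c ` (chart_dom M c \<inter> chart_dom M p)"
      have "smooth_on ?T (\<lambda>y. F ((chart M p \<circ> chart_inv M c) y))"
        by (rule smooth_on_compose[OF frame open_overlap open_UNIV UNIV_I smooth_transition F])
      then have "smooth_on ?T (f \<circ> chart_inv M c)"
        by (rule smooth_on_cong[OF open_overlap, rotated]) (auto simp: f_def)
      moreover have "x \<in> ?T"
        by (rule image_eqI[of _ _ ?q]) (use x True in auto)
      ultimately show ?thesis
        using open_overlap by blast
    next
      case False
      let ?T = "chart M c ` (chart_dom M c - K')"
      have T: "open ?T"
        using \<open>closed K'\<close> open_chart_dom by (intro open_chart_image open_Diff) auto
      have "smooth_on ?T (f \<circ> chart_inv M c)"
        by (rule smooth_on_cong[OF T _ smooth_on_const[of _ 0]]) (auto simp: f0)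
      moreover have "K' \<subseteq> chart_dom M p"
        using K(2) unfolding K'_def by auto
      then have "x \<in> ?T"
        by (intro image_eqI[of _ _ ?q]) (use x False in auto)
      ultimately show ?thesis
        using T by blast
    qed
  qed
  moreover have "differential M f p = \<alpha>"
  proof (rule blinfun_eqI)
    fix v
    have "((\<lambda>x. \<alpha> (x + - a)) has_derivative \<alpha>) (at a)"
      by (rule bounded_linear.has_derivative[OF blinfun.bounded_linear_right]) (auto intro!: derivative_eq_intros)
    from has_derivative_mult[OF this smooth_on_has_derivative[OF \<psi>(1) UNIV_I]]
    have "(F has_derivative \<alpha>) (at a)"
      unfolding F_def using \<psi>(2) by simp
    then have "((f \<circ> chart_inv M p) has_derivative \<alpha>) (at (chart M p p))"
      unfolding a_def[symmetric]
      by (rule has_derivative_transform_within_open[OF _ open_coords[of p]]) (auto simp: f_def a_def)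
    from differentialI[OF this] show "differential M f p v = \<alpha> v" by simp
  qed
  ultimately show thesis by (rule that)
qed

lemma one_form_extension_exists:
  fixes g :: "'a \<Rightarrow> 'e \<Rightarrow>\<^sub>L 'e \<Rightarrow>\<^sub>L real"
  assumes "inner_metric g"
  obtains \<omega> where "one_form M \<omega>" "\<omega> p = \<alpha>"
  using function_with_differential_exists[OF assms] one_form_differential by metis

text \<open>
  The Casimir condition tests against differentials of functions only; these exhaust the covectors at a point.
\<close>

lemma casimir_anchor:
  fixes g :: "'a \<Rightarrow> 'e \<Rightarrow>\<^sub>L 'e \<Rightarrow>\<^sub>L real"
  assumes "inner_metric g" "casimir M P f"
  shows "P p (differential M f p) \<alpha> = 0"
proof -
  obtain h where "smooth_function M h" "differential M h p = \<alpha>"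
    by (rule function_with_differential_exists[OF assms(1)])
  then show ?thesis
    using assms(2) unfolding casimir_def poisson_bracket_def by metis
qed

section \<open>Uniqueness of the Levi-Civita connection\<close>

text \<open>
  The pairing \<open>S \<omega> \<eta> \<gamma>\<close> of the difference of two connections with a third form is symmetric in
  the first two arguments and skew in the last two, hence zero. Pairing the difference with itself
  avoids any choice of local frames.
\<close>

lemma levi_civita_unique:
  assumes "inner_metric g"
    and D: "\<And>\<omega> \<eta>. one_form M \<omega> \<Longrightarrow> one_form M \<eta> \<Longrightarrow> one_form M (D \<omega> \<eta>)"
    and D': "\<And>\<omega> \<eta>. one_form M \<omega> \<Longrightarrow> one_form M \<eta> \<Longrightarrow> one_form M (D' \<omega> \<eta>)"
    and torsion: "\<And>\<omega> \<eta>. one_form M \<omega> \<Longrightarrow> one_form M \<eta> \<Longrightarrow>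
      D \<omega> \<eta> p - D \<eta> \<omega> p = D' \<omega> \<eta> p - D' \<eta> \<omega> p"
    and metric: "\<And>\<omega> \<eta> \<gamma>. one_form M \<omega> \<Longrightarrow> one_form M \<eta> \<Longrightarrow> one_form M \<gamma> \<Longrightarrow>
      cometric g p (D \<omega> \<eta> p) (\<gamma> p) + cometric g p (\<eta> p) (D \<omega> \<gamma> p) =
      cometric g p (D' \<omega> \<eta> p) (\<gamma> p) + cometric g p (\<eta> p) (D' \<omega> \<gamma> p)"
    and forms: "one_form M \<omega>" "one_form M \<eta>"
  shows "D \<omega> \<eta> p = D' \<omega> \<eta> p"
proof -
  interpret inner_metric g by (rule assms(1))
  define S where "S \<omega> \<eta> \<gamma> = cometric g p (D \<omega> \<eta> p - D' \<omega> \<eta> p) (\<gamma> p)" for \<omega> \<eta> \<gamma>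
  have sym: "S \<omega> \<eta> \<gamma> = S \<eta> \<omega> \<gamma>" if "one_form M \<omega>" "one_form M \<eta>" for \<omega> \<eta> \<gamma>
  proof -
    have "D \<omega> \<eta> p - D' \<omega> \<eta> p = D \<eta> \<omega> p - D' \<eta> \<omega> p"
      using torsion[OF that] by (simp add: algebra_simps)
    then show ?thesis by (simp add: S_def)
  qed
  have skew: "S \<omega> \<eta> \<gamma> = - S \<omega> \<gamma> \<eta>" if "one_form M \<omega>" "one_form M \<eta>" "one_form M \<gamma>" for \<omega> \<eta> \<gamma>
    using metric[OF that] by (simp add: S_def cometric_simps cometric_commute[of p "\<eta> p"])
  define \<gamma> where "\<gamma> = (\<lambda>q. D \<omega> \<eta> q - D' \<omega> \<eta> q)"
  have \<gamma>: "one_form M \<gamma>"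
    unfolding \<gamma>_def using forms D D' by (intro one_form_diff)
  have "S \<omega> \<eta> \<gamma> = S \<eta> \<omega> \<gamma>" by (rule sym[OF forms])
  also have "\<dots> = - S \<eta> \<gamma> \<omega>" by (rule skew[OF forms(2,1) \<gamma>])
  also have "\<dots> = - S \<gamma> \<eta> \<omega>" by (simp add: sym[OF forms(2) \<gamma>])
  also have "\<dots> = S \<gamma> \<omega> \<eta>" by (simp add: skew[OF \<gamma> forms(2,1)])
  also have "\<dots> = S \<omega> \<gamma> \<eta>" by (rule sym[OF \<gamma> forms(1)])
  also have "\<dots> = - S \<omega> \<eta> \<gamma>" by (rule skew[OF forms(1) \<gamma> forms(2)])
  finally have "S \<omega> \<eta> \<gamma> = 0" by simp
  then show ?thesis
    using cometric_eq_0[of p "D \<omega> \<eta> p - D' \<omega> \<eta> p"] by (simp add: S_def \<gamma>_def)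
qed

end

section \<open>Covectors on a product\<close>

definition inl :: "'e::real_normed_vector \<Rightarrow>\<^sub>L ('e \<times> 'f::real_normed_vector)" where
  "inl = Blinfun (\<lambda>v. (v, 0))"

definition inr :: "'f::real_normed_vector \<Rightarrow>\<^sub>L ('e::real_normed_vector \<times> 'f)" where
  "inr = Blinfun (\<lambda>w. (0, w))"

lemma inl_apply [simp]: "inl v = (v, 0)"
  unfolding inl_def
  by (subst bounded_linear_Blinfun_apply) (intro bounded_linear_Pair bounded_linear_ident bounded_linear_zero, simp)

lemma inr_apply [simp]: "inr w = (0, w)"
  unfolding inr_def
  by (subst bounded_linear_Blinfun_apply) (intro bounded_linear_Pair bounded_linear_ident bounded_linear_zero, simp)

text \<open>
  A covector on a product splits into a horizontal part (restriction to the first factor) and a vertical part; the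
  lifts are the corresponding inclusions of covectors of the factors.
\<close>

definition hpart :: "('e::real_normed_vector \<times> 'f::real_normed_vector) covec \<Rightarrow> 'e covec" where
  "hpart \<alpha> = \<alpha> o\<^sub>L inl"

definition vpart :: "('e::real_normed_vector \<times> 'f::real_normed_vector) covec \<Rightarrow> 'f covec" where
  "vpart \<alpha> = \<alpha> o\<^sub>L inr"

definition hlift :: "'e::real_normed_vector covec \<Rightarrow> ('e \<times> 'f::real_normed_vector) covec" where
  "hlift \<alpha> = \<alpha> o\<^sub>L fst_blinfun"

definition vlift :: "'f::real_normed_vector covec \<Rightarrow> ('e::real_normed_vector \<times> 'f) covec" where
  "vlift \<alpha> = \<alpha> o\<^sub>L snd_blinfun"

lemma hpart_apply [simp]: "hpart \<alpha> v = \<alpha> (v, 0)"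
  and vpart_apply [simp]: "vpart \<alpha> w = \<alpha> (0, w)"
  and hlift_apply [simp]: "hlift \<beta> z = \<beta> (fst z)"
  and vlift_apply [simp]: "vlift \<gamma> z = \<gamma> (snd z)"
  by (simp_all add: hpart_def vpart_def hlift_def vlift_def)

lemma bounded_linear_hpart: "bounded_linear hpart"
  and bounded_linear_vpart: "bounded_linear vpart"
  and bounded_linear_hlift: "bounded_linear hlift"
  and bounded_linear_vlift: "bounded_linear vlift"
  unfolding hpart_def[abs_def] vpart_def[abs_def] hlift_def[abs_def] vlift_def[abs_def]
  by (rule bounded_bilinear.bounded_linear_left[OF bounded_bilinear_blinfun_compose])+

lemma part_lift [simp]:
  "hpart (hlift \<alpha>) = \<alpha>" "vpart (vlift \<beta>) = \<beta>" "hpart (vlift \<beta>) = 0" "vpart (hlift \<alpha>) = 0"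
  by (rule blinfun_eqI, simp)+

lemma part_linear [simp]:
  "hpart (\<alpha> + \<beta>) = hpart \<alpha> + hpart \<beta>" "vpart (\<alpha> + \<beta>) = vpart \<alpha> + vpart \<beta>"
  "hpart (\<alpha> - \<beta>) = hpart \<alpha> - hpart \<beta>" "vpart (\<alpha> - \<beta>) = vpart \<alpha> - vpart \<beta>"
  "hpart (r *\<^sub>R \<alpha>) = r *\<^sub>R hpart \<alpha>" "vpart (r *\<^sub>R \<alpha>) = r *\<^sub>R vpart \<alpha>"
  "hpart 0 = 0" "vpart 0 = 0"
  by (rule blinfun_eqI, simp add: blinfun.bilinear_simps)+

lemma lift_linear:
  "hlift (\<alpha> + \<beta>) = hlift \<alpha> + hlift \<beta>" "vlift (\<gamma> + \<delta>) = vlift \<gamma> + vlift \<delta>"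
  "hlift (\<alpha> - \<beta>) = hlift \<alpha> - hlift \<beta>" "vlift (\<gamma> - \<delta>) = vlift \<gamma> - vlift \<delta>"
  "hlift (r *\<^sub>R \<alpha>) = r *\<^sub>R hlift \<alpha>" "vlift (r *\<^sub>R \<gamma>) = r *\<^sub>R vlift \<gamma>"
  "hlift 0 = 0" "vlift 0 = 0"
  by (rule blinfun_eqI, simp add: blinfun.bilinear_simps)+

lemma covec_split: "blinfun_apply \<alpha> z = hpart \<alpha> (fst z) + vpart \<alpha> (snd z)"
  by (simp add: blinfun.add_right[symmetric])

lemma covec_prod_eqI:
  assumes "hpart \<alpha> = hpart \<beta>" "vpart \<alpha> = vpart \<beta>"
  shows "\<alpha> = \<beta>"
  by (rule blinfun_eqI) (simp only: covec_split[of \<alpha>] covec_split[of \<beta>] assms)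

definition hform :: "('a \<Rightarrow> 'e::real_normed_vector covec) \<Rightarrow> 'a \<times> 'b \<Rightarrow> ('e \<times> 'f::real_normed_vector) covec" where
  "hform \<omega> z = hlift (\<omega> (fst z))"

definition vform :: "('b \<Rightarrow> 'f::real_normed_vector covec) \<Rightarrow> 'a \<times> 'b \<Rightarrow> ('e::real_normed_vector \<times> 'f) covec" where
  "vform \<omega> z = vlift (\<omega> (snd z))"

lemma part_form [simp]:
  "hpart (hform \<omega> z) = \<omega> (fst z)" "vpart (hform \<omega> z) = 0"
  "hpart (vform \<eta> z) = 0" "vpart (vform \<eta> z) = \<eta> (snd z)"
  by (simp_all add: hform_def vform_def)

lemma hform_linear: "hform (\<lambda>q. a *\<^sub>R \<omega> q + b *\<^sub>R \<omega>' q) = (\<lambda>z. a *\<^sub>R hform \<omega> z + b *\<^sub>R hform \<omega>' z)"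
  and hform_scaleR: "hform (\<lambda>q. h q *\<^sub>R \<omega> q) = (\<lambda>z. h (fst z) *\<^sub>R hform \<omega> z)"
  and vform_linear: "vform (\<lambda>q. a *\<^sub>R \<eta> q + b *\<^sub>R \<eta>' q) = (\<lambda>z. a *\<^sub>R vform \<eta> z + b *\<^sub>R vform \<eta>' z)"
  and vform_scaleR: "vform (\<lambda>q. k q *\<^sub>R \<eta> q) = (\<lambda>z. k (snd z) *\<^sub>R vform \<eta> z)"
  by (simp_all add: hform_def vform_def lift_linear fun_eq_iff)

lemma warped_bivector_apply:
  "warped_bivector P\<^sub>1 \<nu> P\<^sub>2 z \<alpha> \<beta> =
    P\<^sub>1 (fst z) (hpart \<alpha>) (hpart \<beta>) + \<nu> (fst z) * P\<^sub>2 (snd z) (vpart \<alpha>) (vpart \<beta>)"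
  by (simp add: warped_bivector_def case_prod_beta blinfun.add_left blinfun.scaleR_left
      hpart_def vpart_def inl_def inr_def)

lemma warped_metric_apply:
  "warped_metric g\<^sub>1 f g\<^sub>2 z v w =
    g\<^sub>1 (fst z) (fst v) (fst w) + (f (fst z))\<^sup>2 * g\<^sub>2 (snd z) (snd v) (snd w)"
  by (simp add: warped_metric_def case_prod_beta blinfun.add_left blinfun.scaleR_left)

section \<open>Product manifolds\<close>

lemma frame_Times:
  fixes B\<^sub>1 :: "'e::real_normed_vector set" and B\<^sub>2 :: "'f::real_normed_vector set"
  assumes "frame B\<^sub>1 c\<^sub>1" "frame B\<^sub>2 c\<^sub>2"
  obtains B :: "('e \<times> 'f) set" and c where "frame B c"
proof
  let ?I = "\<lambda>b. (b, 0) :: 'e \<times> 'f" and ?J = "\<lambda>b. (0, b) :: 'e \<times> 'f"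
  define c where "c z = (if snd z = 0 then hlift (c\<^sub>1 (fst z)) else vlift (c\<^sub>2 (snd z)))" for z :: "'e \<times> 'f"
  have fin: "finite B\<^sub>1" "finite B\<^sub>2"
    using assms by (auto dest: frame_finite)
  have "(\<Sum>z\<in>?I ` B\<^sub>1 \<union> ?J ` B\<^sub>2. c z x *\<^sub>R z) = x" for x
  proof -
    have "(\<Sum>z\<in>?I ` B\<^sub>1 \<union> ?J ` B\<^sub>2. c z x *\<^sub>R z) = (\<Sum>z\<in>?I ` B\<^sub>1. c z x *\<^sub>R z) + (\<Sum>z\<in>?J ` B\<^sub>2. c z x *\<^sub>R z)"
      using fin by (intro sum.union_inter_neutral) (auto simp: zero_prod_def)
    also have "(\<Sum>z\<in>?I ` B\<^sub>1. c z x *\<^sub>R z) = (\<Sum>b\<in>B\<^sub>1. (c\<^sub>1 b (fst x) *\<^sub>R b, 0))"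
      by (subst sum.reindex) (auto simp: inj_on_def c_def)
    also have "(\<Sum>z\<in>?J ` B\<^sub>2. c z x *\<^sub>R z) = (\<Sum>b\<in>B\<^sub>2. (0, c\<^sub>2 b (snd x) *\<^sub>R b))"
      by (subst sum.reindex) (auto simp: inj_on_def c_def intro!: sum.cong)
    also have "(\<Sum>b\<in>B\<^sub>1. (c\<^sub>1 b (fst x) *\<^sub>R b, 0)) + (\<Sum>b\<in>B\<^sub>2. (0, c\<^sub>2 b (snd x) *\<^sub>R b)) = x"
      by (rule prod_eqI) (simp_all add: fst_sum snd_sum frame_expand[OF assms(1)] frame_expand[OF assms(2)])
    finally show ?thesis .
  qed
  then show "frame (?I ` B\<^sub>1 \<union> ?J ` B\<^sub>2) c"
    using fin by (simp add: frame_def)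
qed

text \<open>
  The three frames are independent parameters, so that the lemmas on framed manifolds apply to both factors and to the
  product.
\<close>

locale product_manifold =
  M1: framed_manifold M\<^sub>1 B\<^sub>1 cd\<^sub>1 + M2: framed_manifold M\<^sub>2 B\<^sub>2 cd\<^sub>2
  for M\<^sub>1 :: "('a::{t2_space,second_countable_topology}, 'e::real_normed_vector) manifold" and B\<^sub>1 cd\<^sub>1
    and M\<^sub>2 :: "('b::{t2_space,second_countable_topology}, 'f::real_normed_vector) manifold" and B\<^sub>2 cd\<^sub>2 +
  fixes B :: "('e \<times> 'f) set" and cd
  assumes frame_prod: "frame B cd"
begin

abbreviation N :: "('a \<times> 'b, 'e \<times> 'f) manifold" where
  "N \<equiv> prod_manifold M\<^sub>1 M\<^sub>2"

lemma chart_dom_prod [simp]: "chart_dom N (c, d) = chart_dom M\<^sub>1 c \<times> chart_dom M\<^sub>2 d"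
  by (simp add: prod_manifold_def)

lemma chart_prod [simp]: "chart N (c, d) z = (chart M\<^sub>1 c (fst z), chart M\<^sub>2 d (snd z))"
  by (simp add: prod_manifold_def case_prod_beta)

lemma chart_prod_image: "chart N (c, d) ` (S \<times> T) = (chart M\<^sub>1 c ` S) \<times> (chart M\<^sub>2 d ` T)"
  by (force simp: image_iff)

lemma chart_inv_prod [simp]:
  assumes "x \<in> M1.coords c" "y \<in> M2.coords d"
  shows "chart_inv N (c, d) (x, y) = (chart_inv M\<^sub>1 c x, chart_inv M\<^sub>2 d y)"
  unfolding chart_inv_def[of N]
proof (rule inv_into_f_eq)
  show "inj_on (chart N (c, d)) (chart_dom N (c, d))"
    by (rule inj_on_inverseI[of _ "\<lambda>z. (chart_inv M\<^sub>1 c (fst z), chart_inv M\<^sub>2 d (snd z))"]) auto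
qed (use assms in auto)

lemma manifold_prod: "smooth_manifold N"
  unfolding smooth_manifold_def
proof (intro conjI allI)
  obtain A\<^sub>1 :: "'e set" and A\<^sub>2 :: "'f set" where A: "finite A\<^sub>1" "span A\<^sub>1 = UNIV" "finite A\<^sub>2" "span A\<^sub>2 = UNIV"
    using M1.finite_dimensional M2.finite_dimensional by blast
  let ?A = "(\<lambda>v. (v, 0)) ` A\<^sub>1 \<union> (\<lambda>w. (0, w)) ` A\<^sub>2 :: ('e \<times> 'f) set"
  have l: "linear (\<lambda>v::'e. (v, 0::'f))" "linear (\<lambda>w::'f. (0::'e, w))"
    by (auto intro!: linearI)
  have "(v, w) \<in> span ?A" for v w
  proof -
    have "(v, 0) \<in> span ((\<lambda>v. (v, 0)) ` A\<^sub>1 :: ('e \<times> 'f) set)"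
      unfolding linear_span_image[OF l(1)] A by simp
    moreover have "(0, w) \<in> span ((\<lambda>w. (0, w)) ` A\<^sub>2 :: ('e \<times> 'f) set)"
      unfolding linear_span_image[OF l(2)] A by simp
    ultimately have "(v, 0) \<in> span ?A" "(0, w) \<in> span ?A"
      using span_mono[of "(\<lambda>v. (v, 0)) ` A\<^sub>1" ?A] span_mono[of "(\<lambda>w. (0, w)) ` A\<^sub>2" ?A] by auto
    from span_add[OF this] show ?thesis by simp
  qed
  then have "span ?A = UNIV" by auto
  with A show "\<exists>A::('e \<times> 'f) set. finite A \<and> span A = UNIV"
    by (intro exI[of _ ?A]) auto
next
  fix z :: "'a \<times> 'b"
  obtain c d where z: "z = (c, d)" by fastforce
  have coords: "chart N z ` chart_dom N z = M1.coords c \<times> M2.coords d"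
    unfolding z chart_dom_prod chart_prod_image ..
  show "z \<in> chart_dom N z" "open (chart_dom N z)" "open (chart N z ` chart_dom N z)"
    unfolding coords by (simp_all add: z open_Times M1.open_chart_dom M2.open_chart_dom M1.open_coords M2.open_coords)
  show "homeomorphism (chart_dom N z) (chart N z ` chart_dom N z) (chart N z) (chart_inv N z)"
    unfolding coords homeomorphism_def
  proof (intro conjI ballI)
    have c1: "continuous_on (chart_dom M\<^sub>1 c) (chart M\<^sub>1 c)" "continuous_on (M1.coords c) (chart_inv M\<^sub>1 c)"
      and c2: "continuous_on (chart_dom M\<^sub>2 d) (chart M\<^sub>2 d)" "continuous_on (M2.coords d) (chart_inv M\<^sub>2 d)"
      using M1.chart_homeomorphism M2.chart_homeomorphism by (auto simp: homeomorphism_def)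
    have "continuous_on (chart_dom M\<^sub>1 c \<times> chart_dom M\<^sub>2 d) (\<lambda>z. (chart M\<^sub>1 c (fst z), chart M\<^sub>2 d (snd z)))"
      by (intro continuous_on_Pair continuous_on_compose2[OF c1(1)] continuous_on_compose2[OF c2(1)] continuous_intros) auto
    then show "continuous_on (chart_dom N z) (chart N z)"
      by (simp add: z)
    have "continuous_on (M1.coords c \<times> M2.coords d) (\<lambda>z. (chart_inv M\<^sub>1 c (fst z), chart_inv M\<^sub>2 d (snd z)))"
      by (intro continuous_on_Pair continuous_on_compose2[OF c1(2)] continuous_on_compose2[OF c2(2)] continuous_intros) auto
    then show "continuous_on (M1.coords c \<times> M2.coords d) (chart_inv N z)"
      by (rule continuous_on_eq) (auto simp: z)
    have "chart_inv N z ` (M1.coords c \<times> M2.coords d) = (\<lambda>w. (chart_inv M\<^sub>1 c (fst w), chart_inv M\<^sub>2 d (snd w))) ` (M1.coords c \<times> M2.coords d)"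
      by (rule image_cong) (auto simp: z)
    also have "\<dots> = chart_dom M\<^sub>1 c \<times> chart_dom M\<^sub>2 d"
      by (force simp: image_iff)
    finally show "chart_inv N z ` (M1.coords c \<times> M2.coords d) = chart_dom N z"
      by (simp add: z)
  qed (auto simp: z)
next
  fix z z' :: "'a \<times> 'b"
  obtain c d c' d' where z: "z = (c, d)" "z' = (c', d')" by fastforce
  let ?S = "chart M\<^sub>1 c ` (chart_dom M\<^sub>1 c \<inter> chart_dom M\<^sub>1 c')" and ?T = "chart M\<^sub>2 d ` (chart_dom M\<^sub>2 d \<inter> chart_dom M\<^sub>2 d')"
  have set: "chart N z ` (chart_dom N z \<inter> chart_dom N z') = ?S \<times> ?T"
    unfolding z chart_dom_prod Times_Int_Times chart_prod_image ..
  have op: "open (?S \<times> ?T)"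
    by (intro open_Times M1.open_overlap M2.open_overlap)
  have "smooth_on (?S \<times> ?T) (\<lambda>w. (chart M\<^sub>1 c' \<circ> chart_inv M\<^sub>1 c) (fst w + 0))"
    by (rule smooth_on_compose_affine[OF op bounded_linear_fst _ M1.smooth_transition]) auto
  from smooth_on_bounded_linear[OF op blinfun.bounded_linear_right[of inl] this]
  have s1: "smooth_on (?S \<times> ?T) (\<lambda>w. (inl ((chart M\<^sub>1 c' \<circ> chart_inv M\<^sub>1 c) (fst w + 0)) :: 'e \<times> 'f))" .
  have "smooth_on (?S \<times> ?T) (\<lambda>w. (chart M\<^sub>2 d' \<circ> chart_inv M\<^sub>2 d) (snd w + 0))"
    by (rule smooth_on_compose_affine[OF op bounded_linear_snd _ M2.smooth_transition]) auto
  from smooth_on_bounded_linear[OF op blinfun.bounded_linear_right[of inr] this]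
  have s2: "smooth_on (?S \<times> ?T) (\<lambda>w. (inr ((chart M\<^sub>2 d' \<circ> chart_inv M\<^sub>2 d) (snd w + 0)) :: 'e \<times> 'f))" .
  show "smooth_on (chart N z ` (chart_dom N z \<inter> chart_dom N z')) (chart N z' \<circ> chart_inv N z)"
    unfolding set by (rule smooth_on_cong[OF op _ smooth_on_add[OF op s1 s2]]) (auto simp: z)
qed

sublocale N: framed_manifold N B cd
  by unfold_locales (rule manifold_prod, rule frame_prod)

lemma coords_prod [simp]: "N.coords (c, d) = M1.coords c \<times> M2.coords d"
  unfolding chart_dom_prod chart_prod_image ..

lemma coord_change_prod [simp]:
  assumes "p \<in> chart_dom M\<^sub>1 c" "p \<in> chart_dom M\<^sub>1 c'" "q \<in> chart_dom M\<^sub>2 d" "q \<in> chart_dom M\<^sub>2 d'"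
  shows "coord_change N (p, q) (c, d) (c', d') w = (coord_change M\<^sub>1 p c c' (fst w), coord_change M\<^sub>2 q d d' (snd w))"
proof -
  let ?S = "chart M\<^sub>1 c ` (chart_dom M\<^sub>1 c \<inter> chart_dom M\<^sub>1 c')" and ?T = "chart M\<^sub>2 d ` (chart_dom M\<^sub>2 d \<inter> chart_dom M\<^sub>2 d')"
  let ?x = "(chart M\<^sub>1 c p, chart M\<^sub>2 d q)"
  have "((\<lambda>w. (chart M\<^sub>1 c' \<circ> chart_inv M\<^sub>1 c) (fst w)) has_derivative (\<lambda>w. coord_change M\<^sub>1 p c c' (fst w))) (at ?x)"
    by (rule has_derivative_compose[OF bounded_linear_imp_has_derivative[OF bounded_linear_fst]])
       (use M1.transition_has_derivative[OF assms(1,2)] in \<open>simp add: o_def\<close>)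
  moreover have "((\<lambda>w. (chart M\<^sub>2 d' \<circ> chart_inv M\<^sub>2 d) (snd w)) has_derivative (\<lambda>w. coord_change M\<^sub>2 q d d' (snd w))) (at ?x)"
    by (rule has_derivative_compose[OF bounded_linear_imp_has_derivative[OF bounded_linear_snd]])
       (use M2.transition_has_derivative[OF assms(3,4)] in \<open>simp add: o_def\<close>)
  ultimately have "((\<lambda>w. ((chart M\<^sub>1 c' \<circ> chart_inv M\<^sub>1 c) (fst w), (chart M\<^sub>2 d' \<circ> chart_inv M\<^sub>2 d) (snd w)))
      has_derivative (\<lambda>w. (coord_change M\<^sub>1 p c c' (fst w), coord_change M\<^sub>2 q d d' (snd w)))) (at ?x)"
    by (rule has_derivative_Pair)
  then have d1: "((chart N (c', d') \<circ> chart_inv N (c, d))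
      has_derivative (\<lambda>w. (coord_change M\<^sub>1 p c c' (fst w), coord_change M\<^sub>2 q d d' (snd w)))) (at ?x)"
  proof (rule has_derivative_transform_within_open[where s = "?S \<times> ?T"])
    show "open (?S \<times> ?T)"
      by (intro open_Times M1.open_overlap M2.open_overlap)
    show "?x \<in> ?S \<times> ?T" using assms by auto
  qed auto
  have d2: "((chart N (c', d') \<circ> chart_inv N (c, d)) has_derivative coord_change N (p, q) (c, d) (c', d')) (at ?x)"
    using N.transition_has_derivative[of "(p, q)" "(c, d)" "(c', d')"] assms by simp
  show ?thesis
    by (rule fun_cong[OF has_derivative_unique[OF d2 d1]])
qed

text \<open>
  Charts of the product are products of charts, so the parts of a form on the product are represented slice by slice.
\<close>

lemma form_rep_prod:
  assumes "x \<in> M1.coords c" "y \<in> M2.coords d"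
  shows "hpart (form_rep N (c, d) \<zeta> (x, y)) = form_rep M\<^sub>1 c (\<lambda>p. hpart (\<zeta> (p, chart_inv M\<^sub>2 d y))) x"
    and "vpart (form_rep N (c, d) \<zeta> (x, y)) = form_rep M\<^sub>2 d (\<lambda>q. vpart (\<zeta> (chart_inv M\<^sub>1 c x, q))) y"
  by (rule blinfun_eqI, simp add: N.form_rep_apply M1.form_rep_apply M2.form_rep_apply assms)+

lemma form_rep_hform:
  assumes "z \<in> M1.coords c \<times> M2.coords d"
  shows "form_rep N (c, d) (hform \<omega>) z = hlift (form_rep M\<^sub>1 c \<omega> (fst z))"
  using assms by (intro blinfun_eqI) (auto simp: N.form_rep_apply M1.form_rep_apply hform_def)

lemma form_rep_vform:
  assumes "z \<in> M1.coords c \<times> M2.coords d"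
  shows "form_rep N (c, d) (vform \<omega>) z = vlift (form_rep M\<^sub>2 d \<omega> (snd z))"
  using assms by (intro blinfun_eqI) (auto simp: N.form_rep_apply M2.form_rep_apply vform_def)

lemma open_coords_prod: "open (M1.coords c \<times> M2.coords d)"
  by (intro open_Times M1.open_coords M2.open_coords)

lemma one_form_hform:
  assumes "one_form M\<^sub>1 \<omega>"
  shows "one_form N (hform \<omega>)"
  unfolding one_form_def
proof (safe, unfold coords_prod)
  fix c d
  have "smooth_on (M1.coords c \<times> M2.coords d) (\<lambda>z. form_rep M\<^sub>1 c \<omega> (fst z + 0))"
    by (rule smooth_on_compose_affine[OF open_coords_prod bounded_linear_fst _ M1.one_formD[OF assms]]) auto
  from smooth_on_bounded_linear[OF open_coords_prod bounded_linear_hlift this]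
  show "smooth_on (M1.coords c \<times> M2.coords d) (form_rep N (c, d) (hform \<omega>))"
    by (rule smooth_on_cong[OF open_coords_prod, rotated]) (simp add: form_rep_hform)
qed

lemma one_form_vform:
  assumes "one_form M\<^sub>2 \<omega>"
  shows "one_form N (vform \<omega>)"
  unfolding one_form_def
proof (safe, unfold coords_prod)
  fix c d
  have "smooth_on (M1.coords c \<times> M2.coords d) (\<lambda>z. form_rep M\<^sub>2 d \<omega> (snd z + 0))"
    by (rule smooth_on_compose_affine[OF open_coords_prod bounded_linear_snd _ M2.one_formD[OF assms]]) auto
  from smooth_on_bounded_linear[OF open_coords_prod bounded_linear_vlift this]
  show "smooth_on (M1.coords c \<times> M2.coords d) (form_rep N (c, d) (vform \<omega>))"
    by (rule smooth_on_cong[OF open_coords_prod, rotated]) (simp add: form_rep_vform)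
qed

lemma one_form_hslice:
  assumes "one_form N \<zeta>"
  shows "one_form M\<^sub>1 (\<lambda>p. hpart (\<zeta> (p, q)))"
  unfolding one_form_def
proof
  fix c
  have "smooth_on (M1.coords c) (\<lambda>x. form_rep N (c, q) \<zeta> (inl x + (0, chart M\<^sub>2 q q)))"
    by (rule smooth_on_compose_affine[OF M1.open_coords blinfun.bounded_linear_right _ N.one_formD[OF assms]])
       (unfold coords_prod, simp)
  from smooth_on_bounded_linear[OF M1.open_coords bounded_linear_hpart this]
  show "smooth_on (M1.coords c) (form_rep M\<^sub>1 c (\<lambda>p. hpart (\<zeta> (p, q))))"
    by (rule smooth_on_cong[OF M1.open_coords, rotated]) (simp add: form_rep_prod)
qed

lemma one_form_vslice:
  assumes "one_form N \<zeta>"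
  shows "one_form M\<^sub>2 (\<lambda>q. vpart (\<zeta> (p, q)))"
  unfolding one_form_def
proof
  fix d
  have "smooth_on (M2.coords d) (\<lambda>y. form_rep N (p, d) \<zeta> (inr y + (chart M\<^sub>1 p p, 0)))"
    by (rule smooth_on_compose_affine[OF M2.open_coords blinfun.bounded_linear_right _ N.one_formD[OF assms]])
       (unfold coords_prod, simp)
  from smooth_on_bounded_linear[OF M2.open_coords bounded_linear_vpart this]
  show "smooth_on (M2.coords d) (form_rep M\<^sub>2 d (\<lambda>q. vpart (\<zeta> (p, q))))"
    by (rule smooth_on_cong[OF M2.open_coords, rotated]) (simp add: form_rep_prod)
qed

lemma one_form_projections:
  assumes "one_form N \<zeta>"
  shows "one_form N (\<lambda>z. hlift (hpart (\<zeta> z)))" "one_form N (\<lambda>z. vlift (vpart (\<zeta> z)))"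
proof -
  have h: "form_rep N (c, d) (\<lambda>z. hlift (hpart (\<zeta> z))) z = hlift (hpart (form_rep N (c, d) \<zeta> z))"
    and v: "form_rep N (c, d) (\<lambda>z. vlift (vpart (\<zeta> z))) z = vlift (vpart (form_rep N (c, d) \<zeta> z))"
    if "z \<in> M1.coords c \<times> M2.coords d" for c d z
    using that by (auto intro!: blinfun_eqI simp: N.form_rep_apply)
  show "one_form N (\<lambda>z. hlift (hpart (\<zeta> z)))"
    unfolding one_form_def
  proof (safe, unfold coords_prod)
    fix c d
    have "smooth_on (M1.coords c \<times> M2.coords d) (\<lambda>z. hlift (hpart (form_rep N (c, d) \<zeta> z)))"
      by (rule smooth_on_bounded_linear[OF open_coords_prod bounded_linear_hlift
            smooth_on_bounded_linear[OF open_coords_prod bounded_linear_hpart N.one_formD[OF assms, of "(c, d)", unfolded coords_prod]]])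
    then show "smooth_on (M1.coords c \<times> M2.coords d) (form_rep N (c, d) (\<lambda>z. hlift (hpart (\<zeta> z))))"
      by (rule smooth_on_cong[OF open_coords_prod, rotated]) (simp add: h)
  qed
  show "one_form N (\<lambda>z. vlift (vpart (\<zeta> z)))"
    unfolding one_form_def
  proof (safe, unfold coords_prod)
    fix c d
    have "smooth_on (M1.coords c \<times> M2.coords d) (\<lambda>z. vlift (vpart (form_rep N (c, d) \<zeta> z)))"
      by (rule smooth_on_bounded_linear[OF open_coords_prod bounded_linear_vlift
            smooth_on_bounded_linear[OF open_coords_prod bounded_linear_vpart N.one_formD[OF assms, of "(c, d)", unfolded coords_prod]]])
    then show "smooth_on (M1.coords c \<times> M2.coords d) (form_rep N (c, d) (\<lambda>z. vlift (vpart (\<zeta> z))))"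
      by (rule smooth_on_cong[OF open_coords_prod, rotated]) (simp add: v)
  qed
qed

lemma smooth_function_fst:
  assumes "smooth_function M\<^sub>1 f"
  shows "smooth_function N (\<lambda>z. f (fst z))"
  unfolding smooth_function_def
proof (safe, unfold coords_prod)
  fix c d
  have "smooth_on (M1.coords c \<times> M2.coords d) (\<lambda>z. (f \<circ> chart_inv M\<^sub>1 c) (fst z + 0))"
    by (rule smooth_on_compose_affine[OF open_coords_prod bounded_linear_fst _ M1.smooth_functionD[OF assms]]) auto
  then show "smooth_on (M1.coords c \<times> M2.coords d) ((\<lambda>z. f (fst z)) \<circ> chart_inv N (c, d))"
    by (rule smooth_on_cong[OF open_coords_prod, rotated]) auto
qed

lemma smooth_function_snd:
  assumes "smooth_function M\<^sub>2 f"
  shows "smooth_function N (\<lambda>z. f (snd z))"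
  unfolding smooth_function_def
proof (safe, unfold coords_prod)
  fix c d
  have "smooth_on (M1.coords c \<times> M2.coords d) (\<lambda>z. (f \<circ> chart_inv M\<^sub>2 d) (snd z + 0))"
    by (rule smooth_on_compose_affine[OF open_coords_prod bounded_linear_snd _ M2.smooth_functionD[OF assms]]) auto
  then show "smooth_on (M1.coords c \<times> M2.coords d) ((\<lambda>z. f (snd z)) \<circ> chart_inv N (c, d))"
    by (rule smooth_on_cong[OF open_coords_prod, rotated]) auto
qed

text \<open>
  Stated for functions differentiable at one point of one chart, which is what is known of the cometric pairings.
\<close>

lemma differential_prod:
  assumes "(h \<circ> chart_inv M\<^sub>1 p) differentiable (at (chart M\<^sub>1 p p))" "(k \<circ> chart_inv M\<^sub>2 q) differentiable (at (chart M\<^sub>2 q q))"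
  shows "differential N (\<lambda>z. h (fst z) * k (snd z)) (p, q) w =
    h p * differential M\<^sub>2 k q (snd w) + differential M\<^sub>1 h p (fst w) * k q"
proof -
  let ?x = "(chart M\<^sub>1 p p, chart M\<^sub>2 q q)"
  have h: "((\<lambda>z. (h \<circ> chart_inv M\<^sub>1 p) (fst z)) has_derivative (\<lambda>w. differential M\<^sub>1 h p (fst w))) (at ?x)"
    by (rule has_derivative_compose[OF bounded_linear_imp_has_derivative[OF bounded_linear_fst]])
       (use M1.differential_has_derivative[OF assms(1)] in \<open>simp add: o_def\<close>)
  have k: "((\<lambda>z. (k \<circ> chart_inv M\<^sub>2 q) (snd z)) has_derivative (\<lambda>w. differential M\<^sub>2 k q (snd w))) (at ?x)"
    by (rule has_derivative_compose[OF bounded_linear_imp_has_derivative[OF bounded_linear_snd]])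
       (use M2.differential_has_derivative[OF assms(2)] in \<open>simp add: o_def\<close>)
  have "((\<lambda>z. (h \<circ> chart_inv M\<^sub>1 p) (fst z) * (k \<circ> chart_inv M\<^sub>2 q) (snd z)) has_derivative
      (\<lambda>w. h p * differential M\<^sub>2 k q (snd w) + differential M\<^sub>1 h p (fst w) * k q)) (at ?x)"
    using has_derivative_mult[OF h k] by simp
  then have "(((\<lambda>z. h (fst z) * k (snd z)) \<circ> chart_inv N (p, q)) has_derivative
      (\<lambda>w. h p * differential M\<^sub>2 k q (snd w) + differential M\<^sub>1 h p (fst w) * k q)) (at ?x)"
    by (rule has_derivative_transform_within_open[OF _ open_coords_prod[of p q]]) auto
  then have "(((\<lambda>z. h (fst z) * k (snd z)) \<circ> chart_inv N (p, q)) has_derivative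
      (\<lambda>w. h p * differential M\<^sub>2 k q (snd w) + differential M\<^sub>1 h p (fst w) * k q)) (at (chart N (p, q) (p, q)))"
    by simp
  from N.differentialI[OF this] show ?thesis by simp
qed

lemma differential_fst:
  assumes "(h \<circ> chart_inv M\<^sub>1 p) differentiable (at (chart M\<^sub>1 p p))"
  shows "differential N (\<lambda>z. h (fst z)) (p, q) w = differential M\<^sub>1 h p (fst w)"
proof -
  have "differential M\<^sub>2 (\<lambda>_. 1) q = 0"
    using M2.differentialI[of "\<lambda>_. 1" q "\<lambda>_. 0"] by (intro blinfun_eqI) (simp add: o_def)
  then show ?thesis
    using differential_prod[OF assms, of "\<lambda>_. 1" q w] by (simp add: o_def)
qed

lemma differential_snd:
  assumes "(k \<circ> chart_inv M\<^sub>2 q) differentiable (at (chart M\<^sub>2 q q))"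
  shows "differential N (\<lambda>z. k (snd z)) (p, q) w = differential M\<^sub>2 k q (snd w)"
proof -
  have "differential M\<^sub>1 (\<lambda>_. 1) p = 0"
    using M1.differentialI[of "\<lambda>_. 1" p "\<lambda>_. 0"] by (intro blinfun_eqI) (simp add: o_def)
  then show ?thesis
    using differential_prod[OF _ assms, of "\<lambda>_. 1" p w] by (simp add: o_def)
qed

lemma rep_deriv_hform:
  assumes "one_form M\<^sub>1 \<omega>"
  shows "N.rep_deriv (hform \<omega>) (p, q) w = hlift (M1.rep_deriv \<omega> p (fst w))"
proof -
  have "((\<lambda>z. form_rep M\<^sub>1 p \<omega> (fst z)) has_derivative
      (\<lambda>w. M1.rep_deriv \<omega> p (fst w))) (at (chart M\<^sub>1 p p, chart M\<^sub>2 q q))"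
    by (rule has_derivative_compose[OF bounded_linear_imp_has_derivative[OF bounded_linear_fst]])
       (simp add: M1.one_form_has_derivative[OF assms])
  from bounded_linear.has_derivative[OF bounded_linear_hlift this]
  have "(form_rep N (p, q) (hform \<omega>) has_derivative
      (\<lambda>w. hlift (M1.rep_deriv \<omega> p (fst w)))) (at (chart M\<^sub>1 p p, chart M\<^sub>2 q q))"
    by (rule has_derivative_transform_within_open[OF _ open_coords_prod[of p q]]) (auto simp: form_rep_hform)
  from fun_cong[OF frechet_derivative_at[OF this], of w] show ?thesis by simp
qed

lemma rep_deriv_vform:
  assumes "one_form M\<^sub>2 \<omega>"
  shows "N.rep_deriv (vform \<omega>) (p, q) w = vlift (M2.rep_deriv \<omega> q (snd w))"
proof -
  have "((\<lambda>z. form_rep M\<^sub>2 q \<omega> (snd z)) has_derivative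
      (\<lambda>w. M2.rep_deriv \<omega> q (snd w))) (at (chart M\<^sub>1 p p, chart M\<^sub>2 q q))"
    by (rule has_derivative_compose[OF bounded_linear_imp_has_derivative[OF bounded_linear_snd]])
       (simp add: M2.one_form_has_derivative[OF assms])
  from bounded_linear.has_derivative[OF bounded_linear_vlift this]
  have "(form_rep N (p, q) (vform \<omega>) has_derivative
      (\<lambda>w. vlift (M2.rep_deriv \<omega> q (snd w)))) (at (chart M\<^sub>1 p p, chart M\<^sub>2 q q))"
    by (rule has_derivative_transform_within_open[OF _ open_coords_prod[of p q]]) (auto simp: form_rep_vform)
  from fun_cong[OF frechet_derivative_at[OF this], of w] show ?thesis by simp
qed

text \<open>
  A vertical form may depend on all coordinates; its derivatives are still vertical.
\<close>

lemma hpart_rep_deriv: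
  assumes "one_form N \<zeta>" "\<And>z. hpart (\<zeta> z) = 0"
  shows "hpart (N.rep_deriv \<zeta> (p, q) w) = 0"
proof -
  have "hpart (form_rep N (p, q) \<zeta> z) = 0" if "z \<in> M1.coords p \<times> M2.coords q" for z
    using that by (auto simp: form_rep_prod assms(2) M1.form_rep_apply intro!: blinfun_eqI)
  then have "((\<lambda>z. hpart (form_rep N (p, q) \<zeta> z)) has_derivative (\<lambda>_. 0)) (at (chart N (p, q) (p, q)))"
    by (intro has_derivative_transform_within_open[OF has_derivative_const open_coords_prod[of p q]]) auto
  from fun_cong[OF has_derivative_unique[OF bounded_linear.has_derivative[OF bounded_linear_hpart N.one_form_has_derivative[OF assms(1)]] this]]
  show ?thesis .
qed

lemma vpart_rep_deriv:
  assumes "one_form N \<zeta>" "\<And>z. vpart (\<zeta> z) = 0"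
  shows "vpart (N.rep_deriv \<zeta> (p, q) w) = 0"
proof -
  have "vpart (form_rep N (p, q) \<zeta> z) = 0" if "z \<in> M1.coords p \<times> M2.coords q" for z
    using that by (auto simp: form_rep_prod assms(2) M2.form_rep_apply intro!: blinfun_eqI)
  then have "((\<lambda>z. vpart (form_rep N (p, q) \<zeta> z)) has_derivative (\<lambda>_. 0)) (at (chart N (p, q) (p, q)))"
    by (intro has_derivative_transform_within_open[OF has_derivative_const open_coords_prod[of p q]]) auto
  from fun_cong[OF has_derivative_unique[OF bounded_linear.has_derivative[OF bounded_linear_vpart N.one_form_has_derivative[OF assms(1)]] this]]
  show ?thesis .
qed

end

section \<open>Warped products\<close>

locale warped_product = product_manifold M\<^sub>1 B\<^sub>1 cd\<^sub>1 M\<^sub>2 B\<^sub>2 cd\<^sub>2 B cd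
  for M\<^sub>1 :: "('a::{t2_space,second_countable_topology}, 'e::real_normed_vector) manifold" and B\<^sub>1 cd\<^sub>1
    and M\<^sub>2 :: "('b::{t2_space,second_countable_topology}, 'f::real_normed_vector) manifold" and B\<^sub>2 cd\<^sub>2
    and B :: "('e \<times> 'f) set" and cd +
  fixes P\<^sub>1 :: "'a \<Rightarrow> 'e covec \<Rightarrow>\<^sub>L 'e covec \<Rightarrow>\<^sub>L real" and P\<^sub>2 :: "'b \<Rightarrow> 'f covec \<Rightarrow>\<^sub>L 'f covec \<Rightarrow>\<^sub>L real"
    and g\<^sub>1 :: "'a \<Rightarrow> 'e \<Rightarrow>\<^sub>L 'e \<Rightarrow>\<^sub>L real" and g\<^sub>2 :: "'b \<Rightarrow> 'f \<Rightarrow>\<^sub>L 'f \<Rightarrow>\<^sub>L real"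
    and f \<nu> :: "'a \<Rightarrow> real"
  assumes P\<^sub>1: "bivector_field M\<^sub>1 P\<^sub>1" and P\<^sub>2: "bivector_field M\<^sub>2 P\<^sub>2"
    and g\<^sub>1: "riemannian_metric M\<^sub>1 g\<^sub>1" and g\<^sub>2: "riemannian_metric M\<^sub>2 g\<^sub>2"
    and f: "smooth_function M\<^sub>1 f" and f_pos: "f p > 0"
    and \<nu>: "smooth_function M\<^sub>1 \<nu>"
    and bivector_warped: "bivector_field (prod_manifold M\<^sub>1 M\<^sub>2) (warped_bivector P\<^sub>1 \<nu> P\<^sub>2)"
    and casimir: "P\<^sub>1 p (differential M\<^sub>1 f p) \<alpha> = 0"
begin

abbreviation Q where "Q \<equiv> warped_bivector P\<^sub>1 \<nu> P\<^sub>2"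
abbreviation W where "W \<equiv> warped_metric g\<^sub>1 f g\<^sub>2"

sublocale G1: inner_metric g\<^sub>1
  by (rule M1.riemannian_inner_metric[OF g\<^sub>1])

sublocale G2: inner_metric g\<^sub>2
  by (rule M2.riemannian_inner_metric[OF g\<^sub>2])

sublocale W: inner_metric W
proof unfold_locales
  fix z
  show "inner_form (W z)"
    unfolding inner_form_def
  proof (intro conjI allI impI)
    fix v w
    show "W z v w = W z w v"
      unfolding warped_metric_apply
      using inner_form_sym[OF G1.inner[of "fst z"], of "fst v"] inner_form_sym[OF G2.inner[of "snd z"], of "snd v"] by simp
  next
    fix v :: "'e \<times> 'f" assume "v \<noteq> 0"
    then have "fst v \<noteq> 0 \<or> snd v \<noteq> 0"
      by (auto simp: prod_eq_iff)
    moreover have "(f (fst z))\<^sup>2 > 0"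
      using f_pos[of "fst z"] by simp
    ultimately show "W z v v > 0"
      using inner_form_pos[OF G1.inner[of "fst z"], of "fst v"] inner_form_pos[OF G2.inner[of "snd z"], of "snd v"]
        inner_form_nonneg[OF G1.inner[of "fst z"], of "fst v"] inner_form_nonneg[OF G2.inner[of "snd z"], of "snd v"]
      unfolding warped_metric_apply by (auto intro: add_pos_nonneg add_nonneg_pos mult_pos_pos)
  qed
qed (rule N.finite_dimensional)

lemma cometric_warped:
  "cometric W z \<alpha> \<beta> = cometric g\<^sub>1 (fst z) (hpart \<alpha>) (hpart \<beta>) + 1 / (f (fst z))\<^sup>2 * cometric g\<^sub>2 (snd z) (vpart \<alpha>) (vpart \<beta>)"
proof -
  let ?h = "metric_sharp (g\<^sub>1 (fst z)) (hpart \<beta>)" and ?v = "metric_sharp (g\<^sub>2 (snd z)) (vpart \<beta>)"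
  have f0: "f (fst z) \<noteq> 0" using f_pos[of "fst z"] by simp
  have "metric_sharp (W z) \<beta> = (?h, (1 / (f (fst z))\<^sup>2) *\<^sub>R ?v)"
  proof (rule metric_sharp_unique[OF W.inner])
    fix w
    have "W z (?h, (1 / (f (fst z))\<^sup>2) *\<^sub>R ?v) w = g\<^sub>1 (fst z) ?h (fst w) + g\<^sub>2 (snd z) ?v (snd w)"
      using f0 by (simp add: warped_metric_apply blinfun.scaleR_left blinfun.scaleR_right)
    then show "W z (?h, (1 / (f (fst z))\<^sup>2) *\<^sub>R ?v) w = \<beta> w"
      by (simp only: G1.metric_sharp_apply G2.metric_sharp_apply covec_split[of \<beta> w])
  qed
  then have "cometric W z \<alpha> \<beta> = \<alpha> (?h, (1 / (f (fst z))\<^sup>2) *\<^sub>R ?v)"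
    by (simp add: W.cometric_sharp)
  then show ?thesis
    by (simp only: covec_split[of \<alpha>] G1.cometric_sharp G2.cometric_sharp fst_conv snd_conv blinfun.scaleR_right real_scaleR_def)
qed

lemma apply_fst_sharp: "blinfun_apply \<eta> (fst (sharp Q \<zeta> z)) = P\<^sub>1 (fst z) (hpart (\<zeta> z)) \<eta>"
  using N.apply_sharp[of "hlift \<eta>" Q \<zeta> z] by (simp add: warped_bivector_apply)

lemma apply_snd_sharp: "blinfun_apply \<eta> (snd (sharp Q \<zeta> z)) = \<nu> (fst z) * P\<^sub>2 (snd z) (vpart (\<zeta> z)) \<eta>"
  using N.apply_sharp[of "vlift \<eta>" Q \<zeta> z] by (simp add: warped_bivector_apply)

lemma fst_sharp_vertical: "hpart (\<zeta> z) = 0 \<Longrightarrow> fst (sharp Q \<zeta> z) = 0"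
  by (rule M1.vector_eqI) (simp add: apply_fst_sharp)

lemma snd_sharp_horizontal: "vpart (\<zeta> z) = 0 \<Longrightarrow> snd (sharp Q \<zeta> z) = 0"
  by (rule M2.vector_eqI) (simp add: apply_snd_sharp)

lemma sharp_hform: "sharp Q (hform \<omega>) z = (sharp P\<^sub>1 \<omega> (fst z), 0)"
proof (rule prod_eqI)
  show "fst (sharp Q (hform \<omega>) z) = fst (sharp P\<^sub>1 \<omega> (fst z), 0)"
    by (rule M1.vector_eqI) (simp add: apply_fst_sharp M1.apply_sharp)
qed (simp add: snd_sharp_horizontal)

lemma sharp_vform: "sharp Q (vform \<omega>) z = (0, \<nu> (fst z) *\<^sub>R sharp P\<^sub>2 \<omega> (snd z))"
proof (rule prod_eqI)
  show "snd (sharp Q (vform \<omega>) z) = snd (0, \<nu> (fst z) *\<^sub>R sharp P\<^sub>2 \<omega> (snd z))"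
    by (rule M2.vector_eqI) (simp add: apply_snd_sharp M2.apply_sharp blinfun.scaleR_right)
qed (simp add: fst_sharp_vertical)

text \<open>
  The middle term, the derivative of \<open>\<nu>\<close>, is the only one in which a derivative along one factor meets the bivector of the other. It
  is the source of the horizontal component in the bracket and in the connection.
\<close>

lemma bivector_warped_derivative:
  "N.bivector_deriv Q (p, q) w \<alpha> \<beta> =
    M1.bivector_deriv P\<^sub>1 p (fst w) (hpart \<alpha>) (hpart \<beta>)
    + differential M\<^sub>1 \<nu> p (fst w) * P\<^sub>2 q (vpart \<alpha>) (vpart \<beta>)
    + \<nu> p * M2.bivector_deriv P\<^sub>2 q (snd w) (vpart \<alpha>) (vpart \<beta>)"
proof -
  let ?x = "(chart M\<^sub>1 p p, chart M\<^sub>2 q q)"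
  let ?Q1 = "M1.bivector_deriv P\<^sub>1 p"
  let ?Q2 = "M2.bivector_deriv P\<^sub>2 q"
  have rep: "bivector_rep N (p, q) Q z \<alpha> \<beta> = bivector_rep M\<^sub>1 p P\<^sub>1 (fst z) (hpart \<alpha>) (hpart \<beta>)
      + (\<nu> \<circ> chart_inv M\<^sub>1 p) (fst z) * bivector_rep M\<^sub>2 q P\<^sub>2 (snd z) (vpart \<alpha>) (vpart \<beta>)"
    if mem: "z \<in> M1.coords p \<times> M2.coords q" for z
  proof -
    obtain x y where z: "z = (x, y)" "x \<in> M1.coords p" "y \<in> M2.coords q"
      using mem by (rule SigmaE)
    let ?c = "coord_change N (chart_inv M\<^sub>1 p x, chart_inv M\<^sub>2 q y) (chart_inv M\<^sub>1 p x, chart_inv M\<^sub>2 q y) (p, q)"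
    have "hpart (\<alpha> o\<^sub>L ?c) = hpart \<alpha> o\<^sub>L coord_change M\<^sub>1 (chart_inv M\<^sub>1 p x) (chart_inv M\<^sub>1 p x) p"
      "vpart (\<alpha> o\<^sub>L ?c) = vpart \<alpha> o\<^sub>L coord_change M\<^sub>2 (chart_inv M\<^sub>2 q y) (chart_inv M\<^sub>2 q y) q" for \<alpha>
      by (rule blinfun_eqI, simp add: M1.chart_inv_dom[OF z(2)] M2.chart_inv_dom[OF z(3)])+
    then show ?thesis
      by (simp add: z N.bivector_rep_apply M1.bivector_rep_apply M2.bivector_rep_apply warped_bivector_apply)
  qed
  have "((\<lambda>z. bivector_rep M\<^sub>1 p P\<^sub>1 (fst z)) has_derivative (\<lambda>w. ?Q1 (fst w))) (at ?x)"
    by (rule has_derivative_compose[OF bounded_linear_imp_has_derivative[OF bounded_linear_fst]])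
       (use M1.bivector_has_derivative[OF P\<^sub>1] in simp)
  from bounded_linear.has_derivative[OF blinfun.bounded_linear_left bounded_linear.has_derivative[OF blinfun.bounded_linear_left this]]
  have d1: "((\<lambda>z. bivector_rep M\<^sub>1 p P\<^sub>1 (fst z) (hpart \<alpha>) (hpart \<beta>)) has_derivative (\<lambda>w. ?Q1 (fst w) (hpart \<alpha>) (hpart \<beta>))) (at ?x)" .
  have "((\<lambda>z. bivector_rep M\<^sub>2 q P\<^sub>2 (snd z)) has_derivative (\<lambda>w. ?Q2 (snd w))) (at ?x)"
    by (rule has_derivative_compose[OF bounded_linear_imp_has_derivative[OF bounded_linear_snd]])
       (use M2.bivector_has_derivative[OF P\<^sub>2] in simp)
  from bounded_linear.has_derivative[OF blinfun.bounded_linear_left bounded_linear.has_derivative[OF blinfun.bounded_linear_left this]]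
  have d2: "((\<lambda>z. bivector_rep M\<^sub>2 q P\<^sub>2 (snd z) (vpart \<alpha>) (vpart \<beta>)) has_derivative (\<lambda>w. ?Q2 (snd w) (vpart \<alpha>) (vpart \<beta>))) (at ?x)" .
  have d3: "((\<lambda>z. (\<nu> \<circ> chart_inv M\<^sub>1 p) (fst z)) has_derivative (\<lambda>w. differential M\<^sub>1 \<nu> p (fst w))) (at ?x)"
    by (rule has_derivative_compose[OF bounded_linear_imp_has_derivative[OF bounded_linear_fst]])
       (use M1.smooth_function_has_derivative[OF \<nu>] in \<open>simp add: o_def\<close>)
  have "((\<lambda>z. bivector_rep N (p, q) Q z \<alpha> \<beta>) has_derivative
      (\<lambda>w. ?Q1 (fst w) (hpart \<alpha>) (hpart \<beta>) +
        ((\<nu> \<circ> chart_inv M\<^sub>1 p) (fst ?x) * ?Q2 (snd w) (vpart \<alpha>) (vpart \<beta>) +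
         differential M\<^sub>1 \<nu> p (fst w) * bivector_rep M\<^sub>2 q P\<^sub>2 (snd ?x) (vpart \<alpha>) (vpart \<beta>)))) (at ?x)"
    by (rule has_derivative_transform_within_open[OF has_derivative_add[OF d1 has_derivative_mult[OF d3 d2]] open_coords_prod[of p q]])
       (auto simp: rep)
  moreover have "((\<lambda>z. bivector_rep N (p, q) Q z \<alpha> \<beta>) has_derivative
      (\<lambda>w. N.bivector_deriv Q (p, q) w \<alpha> \<beta>)) (at (chart N (p, q) (p, q)))"
    by (rule bounded_linear.has_derivative[OF blinfun.bounded_linear_left bounded_linear.has_derivative[OF blinfun.bounded_linear_left
          N.bivector_has_derivative[OF bivector_warped]]])
  ultimately have "(\<lambda>w. N.bivector_deriv Q (p, q) w \<alpha> \<beta>) =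
      (\<lambda>w. ?Q1 (fst w) (hpart \<alpha>) (hpart \<beta>) +
        ((\<nu> \<circ> chart_inv M\<^sub>1 p) (fst ?x) * ?Q2 (snd w) (vpart \<alpha>) (vpart \<beta>) +
         differential M\<^sub>1 \<nu> p (fst w) * bivector_rep M\<^sub>2 q P\<^sub>2 (snd ?x) (vpart \<alpha>) (vpart \<beta>)))"
    using has_derivative_unique by simp
  from fun_cong[OF this, of w] show ?thesis
    by (simp add: M2.bivector_rep_center)
qed

subsection \<open>Brackets of pulled back forms\<close>

lemma bracket_hh:
  assumes "one_form M\<^sub>1 \<omega>" "one_form M\<^sub>1 \<eta>"
  shows "form_bracket N Q (hform \<omega>) (hform \<eta>) z = hlift (form_bracket M\<^sub>1 P\<^sub>1 \<omega> \<eta> (fst z))"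
proof (cases z)
  case (Pair p q)
  show ?thesis
    unfolding Pair
    by (rule blinfun_eqI)
      (simp only: N.form_bracket_apply[OF bivector_warped one_form_hform[OF assms(1)] one_form_hform[OF assms(2)]]
       rep_deriv_hform[OF assms(1)] rep_deriv_hform[OF assms(2)] bivector_warped_derivative sharp_hform part_form hlift_apply
       M1.form_bracket_apply[OF P\<^sub>1 assms] fst_conv blinfun.zero_left blinfun.zero_right mult_zero_right add_0_right)
qed

text \<open>
  The scaling by \<open>\<nu>\<close> contributes through the anchor, and its derivative through the bivector.
\<close>

lemma bracket_vv:
  assumes "one_form M\<^sub>2 \<omega>" "one_form M\<^sub>2 \<eta>"
  shows "form_bracket N Q (vform \<omega>) (vform \<eta>) z =
    \<nu> (fst z) *\<^sub>R vform (form_bracket M\<^sub>2 P\<^sub>2 \<omega> \<eta>) z + P\<^sub>2 (snd z) (\<omega> (snd z)) (\<eta> (snd z)) *\<^sub>R hform (differential M\<^sub>1 \<nu>) z"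
proof (cases z)
  case (Pair p q)
  have lin: "linear (M2.rep_deriv \<zeta> q)" if "one_form M\<^sub>2 \<zeta>" for \<zeta>
    by (rule has_derivative_linear[OF M2.one_form_has_derivative[OF that]])
  show ?thesis
    unfolding Pair
  proof (rule blinfun_eqI)
    fix w
    show "form_bracket N Q (vform \<omega>) (vform \<eta>) (p, q) w =
      (\<nu> (fst (p, q)) *\<^sub>R vform (form_bracket M\<^sub>2 P\<^sub>2 \<omega> \<eta>) (p, q) +
        P\<^sub>2 (snd (p, q)) (\<omega> (snd (p, q))) (\<eta> (snd (p, q))) *\<^sub>R hform (differential M\<^sub>1 \<nu>) (p, q)) w"
      unfolding N.form_bracket_apply[OF bivector_warped one_form_vform[OF assms(1)] one_form_vform[OF assms(2)]]
         rep_deriv_vform[OF assms(1)] rep_deriv_vform[OF assms(2)] bivector_warped_derivative sharp_vform part_form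
      by (simp add: vform_def hform_def M2.form_bracket_apply[OF P\<^sub>2 assms] linear_scale[OF lin[OF assms(1)]] linear_scale[OF lin[OF assms(2)]]
          blinfun.add_left blinfun.scaleR_left algebra_simps)
  qed
qed

text \<open>
  The other form is an arbitrary vertical form on the product, not necessarily a pull-back: the form whose vanishing is
  to be shown will be taken here. The same holds for the counterpart below.
\<close>

lemma hpart_bracket_hform:
  assumes "one_form M\<^sub>1 \<omega>" "one_form N \<gamma>" "\<And>z. hpart (\<gamma> z) = 0"
  shows "hpart (form_bracket N Q (hform \<omega>) \<gamma> z) = 0"
proof (cases z)
  case (Pair p q)
  have lin: "linear (M1.rep_deriv \<omega> p)"
    by (rule has_derivative_linear[OF M1.one_form_has_derivative[OF assms(1)]])
  have "fst (sharp Q \<gamma> (p, q)) = 0"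
    by (rule fst_sharp_vertical) (rule assms(3))
  moreover have "blinfun_apply (N.rep_deriv \<gamma> (p, q) w) (v, 0) = 0" for w v
    using hpart_rep_deriv[OF assms(2,3), of p q w] hpart_apply[of "N.rep_deriv \<gamma> (p, q) w" v] by simp
  ultimately show ?thesis
    unfolding Pair
    by (intro blinfun_eqI)
      (simp only: hpart_apply N.form_bracket_apply[OF bivector_warped one_form_hform[OF assms(1)] assms(2)]
        rep_deriv_hform[OF assms(1)] bivector_warped_derivative part_form assms(3) hlift_apply linear_0[OF lin]
        blinfun.zero_left blinfun.zero_right mult_zero_right add_0_right diff_self)
qed

lemma vpart_bracket_vform:
  assumes "one_form M\<^sub>2 \<omega>" "one_form N \<gamma>" "\<And>z. vpart (\<gamma> z) = 0"
  shows "vpart (form_bracket N Q (vform \<omega>) \<gamma> z) = 0"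
proof (cases z)
  case (Pair p q)
  have lin: "linear (M2.rep_deriv \<omega> q)"
    by (rule has_derivative_linear[OF M2.one_form_has_derivative[OF assms(1)]])
  have "snd (sharp Q \<gamma> (p, q)) = 0"
    by (rule snd_sharp_horizontal) (rule assms(3))
  moreover have "blinfun_apply (N.rep_deriv \<gamma> (p, q) w) (0, v) = 0" for w v
    using vpart_rep_deriv[OF assms(2,3), of p q w] vpart_apply[of "N.rep_deriv \<gamma> (p, q) w" v] by simp
  ultimately show ?thesis
    unfolding Pair
    by (intro blinfun_eqI)
      (simp only: vpart_apply N.form_bracket_apply[OF bivector_warped one_form_vform[OF assms(1)] assms(2)]
        rep_deriv_vform[OF assms(1)] bivector_warped_derivative part_form assms(3) vlift_apply linear_0[OF lin]
        blinfun.zero_left blinfun.zero_right mult_zero_right add_0_right diff_self)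
qed

subsection \<open>Derivatives of pairings\<close>

lemma differential_zero: "differential N (\<lambda>_. 0) z = 0"
  using N.differentialI[of "\<lambda>_. 0" z "\<lambda>_. 0"] by (intro blinfun_eqI) (simp add: o_def)

lemma differential_cometric_hform:
  assumes "one_form M\<^sub>1 \<eta>" "one_form M\<^sub>1 \<gamma>"
  shows "differential N (\<lambda>z. cometric W z (hform \<eta> z) (hform \<gamma> z)) z w =
    differential M\<^sub>1 (\<lambda>p. cometric g\<^sub>1 p (\<eta> p) (\<gamma> p)) (fst z) (fst w)"
  using differential_fst[OF M1.cometric_differentiable[OF g\<^sub>1 assms], of "fst z" "snd z" w]
  by (simp add: cometric_warped G2.cometric_simps)

lemma differential_warping:
  "((\<lambda>p. 1 / (f p)\<^sup>2) \<circ> chart_inv M\<^sub>1 p) differentiable (at (chart M\<^sub>1 p p))"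
  "differential M\<^sub>1 (\<lambda>p. 1 / (f p)\<^sup>2) p v = - 2 / (f p) ^ 3 * differential M\<^sub>1 f p v"
proof -
  have f0: "f q \<noteq> 0" for q using f_pos[of q] by simp
  have "((\<lambda>x. 1 / ((f \<circ> chart_inv M\<^sub>1 p) x)\<^sup>2) has_derivative (\<lambda>v. - 2 / (f p) ^ 3 * differential M\<^sub>1 f p v)) (at (chart M\<^sub>1 p p))"
    by (rule derivative_eq_intros M1.smooth_function_has_derivative[OF f] refl | simp add: f0)+
       (simp add: f0 fun_eq_iff field_simps power2_eq_square power3_eq_cube)
  then have d: "(((\<lambda>p. 1 / (f p)\<^sup>2) \<circ> chart_inv M\<^sub>1 p) has_derivative (\<lambda>v. - 2 / (f p) ^ 3 * differential M\<^sub>1 f p v)) (at (chart M\<^sub>1 p p))"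
    by (simp add: o_def)
  then show "((\<lambda>p. 1 / (f p)\<^sup>2) \<circ> chart_inv M\<^sub>1 p) differentiable (at (chart M\<^sub>1 p p))"
    unfolding differentiable_def by blast
  show "differential M\<^sub>1 (\<lambda>p. 1 / (f p)\<^sup>2) p v = - 2 / (f p) ^ 3 * differential M\<^sub>1 f p v"
    using M1.differentialI[OF d] by simp
qed

text \<open>
  Here the Casimir property of \<open>f\<close> enters: \<open>df\<close> vanishes on the horizontal component of an anchored vector, so the
  factor \<open>1/f\<^sup>2\<close> behaves as a constant.
\<close>

lemma differential_cometric_vform:
  assumes "one_form M\<^sub>2 \<eta>" "one_form M\<^sub>2 \<gamma>"
  shows "differential N (\<lambda>z. cometric W z (vform \<eta> z) (vform \<gamma> z)) z (sharp Q \<zeta> z) =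
    1 / (f (fst z))\<^sup>2 * differential M\<^sub>2 (\<lambda>q. cometric g\<^sub>2 q (\<eta> q) (\<gamma> q)) (snd z) (snd (sharp Q \<zeta> z))"
proof -
  have "differential M\<^sub>1 f (fst z) (fst (sharp Q \<zeta> z)) = 0"
    using M1.bivector_skew[OF P\<^sub>1, of "fst z" "hpart (\<zeta> z)"] by (simp add: apply_fst_sharp casimir)
  then show ?thesis
    using differential_prod[OF differential_warping(1) M2.cometric_differentiable[OF g\<^sub>2 assms], of "fst z" "snd z" "sharp Q \<zeta> z"]
    by (simp add: cometric_warped G1.cometric_simps differential_warping(2))
qed

end

section \<open>The Levi-Civita connection of a warped product\<close>

lemma levi_civita_rules:
  assumes "contravariant_levi_civita M P g D"
  shows levi_civita_form: "one_form M \<omega> \<Longrightarrow> one_form M \<eta> \<Longrightarrow> one_form M (D \<omega> \<eta>)"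
    and levi_civita_linear_left: "one_form M \<omega> \<Longrightarrow> one_form M \<omega>' \<Longrightarrow> one_form M \<eta> \<Longrightarrow>
      D (\<lambda>q. a *\<^sub>R \<omega> q + b *\<^sub>R \<omega>' q) \<eta> p = a *\<^sub>R D \<omega> \<eta> p + b *\<^sub>R D \<omega>' \<eta> p"
    and levi_civita_linear_right: "one_form M \<omega> \<Longrightarrow> one_form M \<eta> \<Longrightarrow> one_form M \<eta>' \<Longrightarrow>
      D \<omega> (\<lambda>q. a *\<^sub>R \<eta> q + b *\<^sub>R \<eta>' q) p = a *\<^sub>R D \<omega> \<eta> p + b *\<^sub>R D \<omega> \<eta>' p"
    and levi_civita_scaleR_left: "smooth_function M f \<Longrightarrow> one_form M \<omega> \<Longrightarrow> one_form M \<eta> \<Longrightarrow>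
      D (\<lambda>q. f q *\<^sub>R \<omega> q) \<eta> p = f p *\<^sub>R D \<omega> \<eta> p"
    and levi_civita_leibniz: "smooth_function M f \<Longrightarrow> one_form M \<omega> \<Longrightarrow> one_form M \<eta> \<Longrightarrow>
      D \<omega> (\<lambda>q. f q *\<^sub>R \<eta> q) p = f p *\<^sub>R D \<omega> \<eta> p + differential M f p (sharp P \<omega> p) *\<^sub>R \<eta> p"
    and levi_civita_torsion: "one_form M \<omega> \<Longrightarrow> one_form M \<eta> \<Longrightarrow>
      D \<omega> \<eta> p - D \<eta> \<omega> p = form_bracket M P \<omega> \<eta> p"
    and levi_civita_metric: "one_form M \<omega> \<Longrightarrow> one_form M \<eta> \<Longrightarrow> one_form M \<gamma> \<Longrightarrow>
      differential M (\<lambda>q. cometric g q (\<eta> q) (\<gamma> q)) p (sharp P \<omega> p) =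
      cometric g p (D \<omega> \<eta> p) (\<gamma> p) + cometric g p (\<eta> p) (D \<omega> \<gamma> p)"
proof -
  note lc = assms[unfolded contravariant_levi_civita_def contravariant_connection_def]
  note c1 = lc[THEN conjunct1] and c2 = lc[THEN conjunct2]
  show "one_form M \<omega> \<Longrightarrow> one_form M \<eta> \<Longrightarrow> one_form M (D \<omega> \<eta>)"
    by (rule c1[THEN conjunct1, rule_format])
  show "one_form M \<omega> \<Longrightarrow> one_form M \<omega>' \<Longrightarrow> one_form M \<eta> \<Longrightarrow>
      D (\<lambda>q. a *\<^sub>R \<omega> q + b *\<^sub>R \<omega>' q) \<eta> p = a *\<^sub>R D \<omega> \<eta> p + b *\<^sub>R D \<omega>' \<eta> p"
    by (rule c1[THEN conjunct2, THEN conjunct1, rule_format])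
  show "one_form M \<omega> \<Longrightarrow> one_form M \<eta> \<Longrightarrow> one_form M \<eta>' \<Longrightarrow>
      D \<omega> (\<lambda>q. a *\<^sub>R \<eta> q + b *\<^sub>R \<eta>' q) p = a *\<^sub>R D \<omega> \<eta> p + b *\<^sub>R D \<omega> \<eta>' p"
    by (rule c1[THEN conjunct2, THEN conjunct2, THEN conjunct1, rule_format])
  show "smooth_function M f \<Longrightarrow> one_form M \<omega> \<Longrightarrow> one_form M \<eta> \<Longrightarrow>
      D (\<lambda>q. f q *\<^sub>R \<omega> q) \<eta> p = f p *\<^sub>R D \<omega> \<eta> p"
    by (rule c1[THEN conjunct2, THEN conjunct2, THEN conjunct2, THEN conjunct1, rule_format])
  show "smooth_function M f \<Longrightarrow> one_form M \<omega> \<Longrightarrow> one_form M \<eta> \<Longrightarrow>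
      D \<omega> (\<lambda>q. f q *\<^sub>R \<eta> q) p = f p *\<^sub>R D \<omega> \<eta> p + differential M f p (sharp P \<omega> p) *\<^sub>R \<eta> p"
    by (rule c1[THEN conjunct2, THEN conjunct2, THEN conjunct2, THEN conjunct2, rule_format])
  show "one_form M \<omega> \<Longrightarrow> one_form M \<eta> \<Longrightarrow> D \<omega> \<eta> p - D \<eta> \<omega> p = form_bracket M P \<omega> \<eta> p"
    by (rule c2[THEN conjunct1, rule_format])
  show "one_form M \<omega> \<Longrightarrow> one_form M \<eta> \<Longrightarrow> one_form M \<gamma> \<Longrightarrow>
      differential M (\<lambda>q. cometric g q (\<eta> q) (\<gamma> q)) p (sharp P \<omega> p) =
      cometric g p (D \<omega> \<eta> p) (\<gamma> p) + cometric g p (\<eta> p) (D \<omega> \<gamma> p)"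
    by (rule c2[THEN conjunct2, rule_format])
qed

locale warped_levi_civita = warped_product M\<^sub>1 B\<^sub>1 cd\<^sub>1 M\<^sub>2 B\<^sub>2 cd\<^sub>2 B cd P\<^sub>1 P\<^sub>2 g\<^sub>1 g\<^sub>2 f \<nu>
  for M\<^sub>1 :: "('a::{t2_space,second_countable_topology}, 'e::real_normed_vector) manifold" and B\<^sub>1 cd\<^sub>1
    and M\<^sub>2 :: "('b::{t2_space,second_countable_topology}, 'f::real_normed_vector) manifold" and B\<^sub>2 cd\<^sub>2
    and B :: "('e \<times> 'f) set" and cd and P\<^sub>1 P\<^sub>2 g\<^sub>1 g\<^sub>2 f \<nu> +
  fixes D
  assumes levi_civita: "contravariant_levi_civita (prod_manifold M\<^sub>1 M\<^sub>2) (warped_bivector P\<^sub>1 \<nu> P\<^sub>2) (warped_metric g\<^sub>1 f g\<^sub>2) D"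
begin

lemmas D_form = levi_civita_form[OF levi_civita]
  and D_linear_left = levi_civita_linear_left[OF levi_civita]
  and D_linear_right = levi_civita_linear_right[OF levi_civita]
  and D_scale_left = levi_civita_scaleR_left[OF levi_civita]
  and D_leibniz = levi_civita_leibniz[OF levi_civita]
  and D_torsion = levi_civita_torsion[OF levi_civita]
  and D_metric = levi_civita_metric[OF levi_civita]

lemma D_add_left: "one_form N \<omega> \<Longrightarrow> one_form N \<omega>' \<Longrightarrow> one_form N \<eta> \<Longrightarrow>
    D (\<lambda>q. \<omega> q + \<omega>' q) \<eta> z = D \<omega> \<eta> z + D \<omega>' \<eta> z"
  using D_linear_left[of \<omega> \<omega>' \<eta> 1 1 z] by simp

lemma D_add_right: "one_form N \<omega> \<Longrightarrow> one_form N \<eta> \<Longrightarrow> one_form N \<eta>' \<Longrightarrow>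
    D \<omega> (\<lambda>q. \<eta> q + \<eta>' q) z = D \<omega> \<eta> z + D \<omega> \<eta>' z"
  using D_linear_right[of \<omega> \<eta> \<eta>' 1 1 z] by simp

text \<open>
  The restrictions of \<open>D\<close> to the slices \<open>M\<^sub>1 \<times> {q}\<close> and \<open>{p} \<times> M\<^sub>2\<close>.
\<close>

definition D\<^sub>h :: "'b \<Rightarrow> ('a \<Rightarrow> 'e covec) \<Rightarrow> ('a \<Rightarrow> 'e covec) \<Rightarrow> 'a \<Rightarrow> 'e covec" where
  "D\<^sub>h q \<omega> \<eta> p = hpart (D (hform \<omega>) (hform \<eta>) (p, q))"

definition D\<^sub>v :: "'a \<Rightarrow> ('b \<Rightarrow> 'f covec) \<Rightarrow> ('b \<Rightarrow> 'f covec) \<Rightarrow> 'b \<Rightarrow> 'f covec" where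
  "D\<^sub>v p \<omega> \<eta> q = vpart (D (vform \<omega>) (vform \<eta>) (p, q))"

lemma D\<^sub>h_form: "one_form M\<^sub>1 \<omega> \<Longrightarrow> one_form M\<^sub>1 \<eta> \<Longrightarrow> one_form M\<^sub>1 (D\<^sub>h q \<omega> \<eta>)"
  unfolding D\<^sub>h_def[abs_def] by (intro one_form_hslice D_form one_form_hform)

lemma D\<^sub>v_form: "one_form M\<^sub>2 \<omega> \<Longrightarrow> one_form M\<^sub>2 \<eta> \<Longrightarrow> one_form M\<^sub>2 (D\<^sub>v p \<omega> \<eta>)"
  unfolding D\<^sub>v_def[abs_def] by (intro one_form_vslice D_form one_form_vform)

lemma D\<^sub>h_torsion:
  assumes "one_form M\<^sub>1 \<omega>" "one_form M\<^sub>1 \<eta>"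
  shows "D\<^sub>h q \<omega> \<eta> p - D\<^sub>h q \<eta> \<omega> p = form_bracket M\<^sub>1 P\<^sub>1 \<omega> \<eta> p"
proof -
  have "D\<^sub>h q \<omega> \<eta> p - D\<^sub>h q \<eta> \<omega> p = hpart (D (hform \<omega>) (hform \<eta>) (p, q) - D (hform \<eta>) (hform \<omega>) (p, q))"
    by (simp add: D\<^sub>h_def)
  then show ?thesis
    by (simp add: D_torsion one_form_hform assms bracket_hh)
qed

text \<open>
  A vertical slice carries the bivector \<open>\<nu>(p) \<Pi>\<^sub>2\<close> and the metric of \<open>M\<^sub>2\<close> scaled by a constant, so its connection has the
  torsion and metric identities of \<open>M\<^sub>2\<close> with the bivector multiplied by \<open>\<nu>(p)\<close>.
\<close>

lemma D\<^sub>v_torsion: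
  assumes "one_form M\<^sub>2 \<omega>" "one_form M\<^sub>2 \<eta>"
  shows "D\<^sub>v p \<omega> \<eta> q - D\<^sub>v p \<eta> \<omega> q = \<nu> p *\<^sub>R form_bracket M\<^sub>2 P\<^sub>2 \<omega> \<eta> q"
proof -
  have "D\<^sub>v p \<omega> \<eta> q - D\<^sub>v p \<eta> \<omega> q = vpart (D (vform \<omega>) (vform \<eta>) (p, q) - D (vform \<eta>) (vform \<omega>) (p, q))"
    by (simp add: D\<^sub>v_def)
  then show ?thesis
    by (simp add: D_torsion one_form_vform assms bracket_vv)
qed

lemma D\<^sub>h_metric:
  assumes "one_form M\<^sub>1 \<omega>" "one_form M\<^sub>1 \<eta>" "one_form M\<^sub>1 \<gamma>"
  shows "differential M\<^sub>1 (\<lambda>p. cometric g\<^sub>1 p (\<eta> p) (\<gamma> p)) p (sharp P\<^sub>1 \<omega> p) =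
    cometric g\<^sub>1 p (D\<^sub>h q \<omega> \<eta> p) (\<gamma> p) + cometric g\<^sub>1 p (\<eta> p) (D\<^sub>h q \<omega> \<gamma> p)"
  using D_metric[of "hform \<omega>" "hform \<eta>" "hform \<gamma>" "(p, q)"]
  by (simp add: one_form_hform assms differential_cometric_hform sharp_hform)
     (simp add: cometric_warped D\<^sub>h_def G2.cometric_simps)

lemma D\<^sub>v_metric:
  assumes "one_form M\<^sub>2 \<omega>" "one_form M\<^sub>2 \<eta>" "one_form M\<^sub>2 \<gamma>"
  shows "\<nu> p * differential M\<^sub>2 (\<lambda>q. cometric g\<^sub>2 q (\<eta> q) (\<gamma> q)) q (sharp P\<^sub>2 \<omega> q) =
    cometric g\<^sub>2 q (D\<^sub>v p \<omega> \<eta> q) (\<gamma> q) + cometric g\<^sub>2 q (\<eta> q) (D\<^sub>v p \<omega> \<gamma> q)" (is "?l = ?r")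
proof -
  have "1 / (f p)\<^sup>2 * ?l = 1 / (f p)\<^sup>2 * ?r"
    using D_metric[of "vform \<omega>" "vform \<eta>" "vform \<gamma>" "(p, q)"]
    unfolding differential_cometric_vform[OF assms(2,3)]
    by (simp add: one_form_vform assms sharp_vform cometric_warped D\<^sub>v_def G1.cometric_simps blinfun.scaleR_right algebra_simps add_divide_distrib)
  then show ?thesis
    using f_pos[of p] by simp
qed

text \<open>
  Each horizontal slice carries the same bivector and the same metric, so uniqueness applies.
\<close>

lemma D\<^sub>h_independent:
  assumes "one_form M\<^sub>1 \<omega>" "one_form M\<^sub>1 \<eta>"
  shows "D\<^sub>h q \<omega> \<eta> p = D\<^sub>h q' \<omega> \<eta> p"
proof (rule M1.levi_civita_unique[OF G1.inner_metric_axioms, where D = "D\<^sub>h q" and D' = "D\<^sub>h q'"])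
  fix \<omega> \<eta> assume "one_form M\<^sub>1 \<omega>" "one_form M\<^sub>1 \<eta>"
  then show "D\<^sub>h q \<omega> \<eta> p - D\<^sub>h q \<eta> \<omega> p = D\<^sub>h q' \<omega> \<eta> p - D\<^sub>h q' \<eta> \<omega> p"
    by (simp only: D\<^sub>h_torsion)
next
  fix \<omega> \<eta> \<gamma> assume "one_form M\<^sub>1 \<omega>" "one_form M\<^sub>1 \<eta>" "one_form M\<^sub>1 \<gamma>"
  then show "cometric g\<^sub>1 p (D\<^sub>h q \<omega> \<eta> p) (\<gamma> p) + cometric g\<^sub>1 p (\<eta> p) (D\<^sub>h q \<omega> \<gamma> p) =
      cometric g\<^sub>1 p (D\<^sub>h q' \<omega> \<eta> p) (\<gamma> p) + cometric g\<^sub>1 p (\<eta> p) (D\<^sub>h q' \<omega> \<gamma> p)"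
    by (simp only: D\<^sub>h_metric[symmetric])
qed (use assms D\<^sub>h_form in auto)

text \<open>
  The identities for \<open>D'\<close> are multiplied by \<open>\<nu>(p)\<close>, so that the statement covers both the Levi-Civita connection of
  \<open>M\<^sub>2\<close> at all points and, where \<open>\<nu>(p) = 0\<close>, an arbitrary \<open>D'\<close>: the slice connection is then zero.
\<close>

lemma D\<^sub>v_eq_scaleR:
  assumes form: "\<And>\<omega> \<eta>. one_form M\<^sub>2 \<omega> \<Longrightarrow> one_form M\<^sub>2 \<eta> \<Longrightarrow> one_form M\<^sub>2 (\<lambda>q. \<nu> p *\<^sub>R D' \<omega> \<eta> q)"
    and torsion: "\<And>\<omega> \<eta>. one_form M\<^sub>2 \<omega> \<Longrightarrow> one_form M\<^sub>2 \<eta> \<Longrightarrow>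
      \<nu> p *\<^sub>R (D' \<omega> \<eta> q - D' \<eta> \<omega> q) = \<nu> p *\<^sub>R form_bracket M\<^sub>2 P\<^sub>2 \<omega> \<eta> q"
    and metric: "\<And>\<omega> \<eta> \<gamma>. one_form M\<^sub>2 \<omega> \<Longrightarrow> one_form M\<^sub>2 \<eta> \<Longrightarrow> one_form M\<^sub>2 \<gamma> \<Longrightarrow>
      \<nu> p * differential M\<^sub>2 (\<lambda>q. cometric g\<^sub>2 q (\<eta> q) (\<gamma> q)) q (sharp P\<^sub>2 \<omega> q) =
      \<nu> p * (cometric g\<^sub>2 q (D' \<omega> \<eta> q) (\<gamma> q) + cometric g\<^sub>2 q (\<eta> q) (D' \<omega> \<gamma> q))"
    and forms: "one_form M\<^sub>2 \<omega>" "one_form M\<^sub>2 \<eta>"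
  shows "D\<^sub>v p \<omega> \<eta> q = \<nu> p *\<^sub>R D' \<omega> \<eta> q"
proof (rule M2.levi_civita_unique[OF G2.inner_metric_axioms, where D = "D\<^sub>v p" and D' = "\<lambda>\<omega> \<eta> q. \<nu> p *\<^sub>R D' \<omega> \<eta> q"])
  fix \<omega> \<eta> assume "one_form M\<^sub>2 \<omega>" "one_form M\<^sub>2 \<eta>"
  then show "D\<^sub>v p \<omega> \<eta> q - D\<^sub>v p \<eta> \<omega> q = \<nu> p *\<^sub>R D' \<omega> \<eta> q - \<nu> p *\<^sub>R D' \<eta> \<omega> q"
    by (simp only: D\<^sub>v_torsion torsion[symmetric] scaleR_diff_right)
next
  fix \<omega> \<eta> \<gamma> assume "one_form M\<^sub>2 \<omega>" "one_form M\<^sub>2 \<eta>" "one_form M\<^sub>2 \<gamma>"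
  then show "cometric g\<^sub>2 q (D\<^sub>v p \<omega> \<eta> q) (\<gamma> q) + cometric g\<^sub>2 q (\<eta> q) (D\<^sub>v p \<omega> \<gamma> q) =
      cometric g\<^sub>2 q (\<nu> p *\<^sub>R D' \<omega> \<eta> q) (\<gamma> q) + cometric g\<^sub>2 q (\<eta> q) (\<nu> p *\<^sub>R D' \<omega> \<gamma> q)"
    by (simp only: D\<^sub>v_metric[symmetric] metric G2.cometric_simps distrib_left)
qed (use form forms D\<^sub>v_form in auto)

text \<open>
  For vertical \<open>\<gamma>\<close>, the pairing of \<open>D \<omega>\<^sup>h \<eta>\<^sup>h\<close> with \<open>\<gamma>\<close> is symmetric, since the bracket of horizontal pull-backs is
  horizontal, and equals the negative of the pairing of \<open>\<eta>\<^sup>h\<close> with \<open>D \<gamma> \<omega>\<^sup>h\<close>. The latter is skew, since a vertical vector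
  does not differentiate the pairing of \<open>\<omega>\<^sup>h\<close> and \<open>\<eta>\<^sup>h\<close>. The choice of \<open>\<gamma>\<close> as the vertical part itself finishes the proof.
\<close>

lemma vpart_D_hform:
  assumes "one_form M\<^sub>1 \<omega>" "one_form M\<^sub>1 \<eta>"
  shows "vpart (D (hform \<omega>) (hform \<eta>) z) = 0"
proof -
  define \<gamma> where "\<gamma> = (\<lambda>z. vlift (vpart (D (hform \<omega>) (hform \<eta>) z)) :: ('e \<times> 'f) covec)"
  have \<gamma>: "one_form N \<gamma>" "hpart (\<gamma> y) = 0" "vpart (\<gamma> y) = vpart (D (hform \<omega>) (hform \<eta>) y)" for y
    unfolding \<gamma>_def by (intro one_form_projections D_form one_form_hform assms) simp_all
  define S where "S a b = cometric W z (D (hform a) (hform b) z) (\<gamma> z)" for a b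
  have S1: "S a b = - cometric W z (hform b z) (D \<gamma> (hform a) z)" if a: "one_form M\<^sub>1 a" and b: "one_form M\<^sub>1 b" for a b
  proof -
    have "S a b = - cometric W z (hform b z) (D (hform a) \<gamma> z)"
      using D_metric[OF one_form_hform[OF a] one_form_hform[OF b] \<gamma>(1), of z]
      by (simp add: S_def cometric_warped \<gamma>(2) G1.cometric_simps G2.cometric_simps differential_zero)
    moreover have "D (hform a) \<gamma> z = D \<gamma> (hform a) z + form_bracket N Q (hform a) \<gamma> z"
      using D_torsion[OF one_form_hform[OF a] \<gamma>(1), of z] by (simp add: algebra_simps)
    moreover have "cometric W z (hform b z) (form_bracket N Q (hform a) \<gamma> z) = 0"
      by (simp add: cometric_warped hpart_bracket_hform[OF a \<gamma>(1,2)] G1.cometric_simps G2.cometric_simps)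
    ultimately show ?thesis
      by (simp add: W.cometric_simps)
  qed
  have skew: "S a b = - S b a" if a: "one_form M\<^sub>1 a" and b: "one_form M\<^sub>1 b" for a b
  proof -
    have "differential N (\<lambda>z. cometric W z (hform a z) (hform b z)) z (sharp Q \<gamma> z) = 0"
      by (simp add: differential_cometric_hform[OF a b] fst_sharp_vertical[of \<gamma>, OF \<gamma>(2)])
    then show ?thesis
      using D_metric[OF \<gamma>(1) one_form_hform[OF a] one_form_hform[OF b], of z]
      by (simp add: S1 a b W.cometric_commute[of z "hform b z"])
  qed
  have "S \<omega> \<eta> - S \<eta> \<omega> = cometric W z (form_bracket N Q (hform \<omega>) (hform \<eta>) z) (\<gamma> z)"
    by (simp add: S_def W.cometric_diff_left[symmetric] D_torsion one_form_hform assms)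
  also have "\<dots> = 0"
    by (simp add: bracket_hh assms cometric_warped \<gamma>(2) G1.cometric_simps G2.cometric_simps)
  finally have "S \<omega> \<eta> = 0"
    using skew[OF assms] by simp
  then have "cometric g\<^sub>2 (snd z) (vpart (\<gamma> z)) (vpart (\<gamma> z)) = 0"
    using f_pos[of "fst z"] by (simp add: S_def cometric_warped \<gamma> G1.cometric_simps)
  from G2.cometric_eq_0[OF this] show ?thesis by (simp add: \<gamma>(3))
qed

text \<open>
  As for the vertical part of \<open>D \<omega>\<^sup>h \<eta>\<^sup>h\<close>, the pairing with a horizontal form is skew up to the horizontal part
  \<open>\<Pi>\<^sub>2(\<omega>,\<eta>) (d\<nu>)\<^sup>h\<close> of the bracket. Half of this part is therefore the value.
\<close>

lemma hpart_D_vform: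
  assumes "one_form M\<^sub>2 \<omega>" "one_form M\<^sub>2 \<eta>"
  shows "hpart (D (vform \<omega>) (vform \<eta>) z) = (1/2 * P\<^sub>2 (snd z) (\<omega> (snd z)) (\<eta> (snd z))) *\<^sub>R differential M\<^sub>1 \<nu> (fst z)"
proof -
  define \<pi> where "\<pi> = (\<lambda>y::'a \<times> 'b. 1/2 * P\<^sub>2 (snd y) (\<omega> (snd y)) (\<eta> (snd y)))"
  have \<pi>: "smooth_function N \<pi>"
    unfolding \<pi>_def
    by (intro N.smooth_function_mult N.smooth_function_const smooth_function_snd M2.smooth_function_pairing[OF P\<^sub>2 assms])
  have d\<nu>: "one_form N (hform (differential M\<^sub>1 \<nu>))"
    by (intro one_form_hform M1.one_form_differential \<nu>)
  define \<gamma> where "\<gamma> = (\<lambda>z. hlift (hpart (D (vform \<omega>) (vform \<eta>) z)) - \<pi> z *\<^sub>R hform (differential M\<^sub>1 \<nu>) z :: ('e \<times> 'f) covec)"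
  have "one_form N \<gamma>"
    unfolding \<gamma>_def by (intro N.one_form_diff one_form_projections D_form one_form_vform assms N.one_form_scaleR \<pi> d\<nu>)
  then have \<gamma>: "one_form N \<gamma>" "vpart (\<gamma> y) = 0"
    "hpart (\<gamma> y) = hpart (D (vform \<omega>) (vform \<eta>) y) - \<pi> y *\<^sub>R differential M\<^sub>1 \<nu> (fst y)" for y
    unfolding \<gamma>_def by simp_all
  define S where "S a b = cometric W z (D (vform a) (vform b) z) (\<gamma> z)" for a b
  have S1: "S a b = - cometric W z (vform b z) (D \<gamma> (vform a) z)" if a: "one_form M\<^sub>2 a" and b: "one_form M\<^sub>2 b" for a b
  proof -
    have "S a b = - cometric W z (vform b z) (D (vform a) \<gamma> z)"
      using D_metric[OF one_form_vform[OF a] one_form_vform[OF b] \<gamma>(1), of z]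
      by (simp add: S_def cometric_warped \<gamma>(2) G1.cometric_simps G2.cometric_simps differential_zero)
    moreover have "D (vform a) \<gamma> z = D \<gamma> (vform a) z + form_bracket N Q (vform a) \<gamma> z"
      using D_torsion[OF one_form_vform[OF a] \<gamma>(1), of z] by (simp add: algebra_simps)
    moreover have "cometric W z (vform b z) (form_bracket N Q (vform a) \<gamma> z) = 0"
      by (simp add: cometric_warped vpart_bracket_vform[OF a \<gamma>(1,2)] G1.cometric_simps G2.cometric_simps)
    ultimately show ?thesis
      by (simp add: W.cometric_simps)
  qed
  have skew: "S a b = - S b a" if a: "one_form M\<^sub>2 a" and b: "one_form M\<^sub>2 b" for a b
  proof -
    have "differential N (\<lambda>z. cometric W z (vform a z) (vform b z)) z (sharp Q \<gamma> z) = 0"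
      by (simp add: differential_cometric_vform[OF a b] snd_sharp_horizontal[of \<gamma>, OF \<gamma>(2)])
    then show ?thesis
      using D_metric[OF \<gamma>(1) one_form_vform[OF a] one_form_vform[OF b], of z]
      by (simp add: S1 a b W.cometric_commute[of z "vform b z"])
  qed
  have "S \<omega> \<eta> - S \<eta> \<omega> = cometric W z (form_bracket N Q (vform \<omega>) (vform \<eta>) z) (\<gamma> z)"
    by (simp add: S_def W.cometric_diff_left[symmetric] D_torsion one_form_vform assms)
  also have "\<dots> = 2 * (\<pi> z * cometric g\<^sub>1 (fst z) (differential M\<^sub>1 \<nu> (fst z)) (hpart (\<gamma> z)))"
    by (simp add: bracket_vv assms cometric_warped \<gamma>(2) G1.cometric_simps G2.cometric_simps \<pi>_def)
  finally have "S \<omega> \<eta> = \<pi> z * cometric g\<^sub>1 (fst z) (differential M\<^sub>1 \<nu> (fst z)) (hpart (\<gamma> z))"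
    using skew[OF assms] by simp
  then have "cometric g\<^sub>1 (fst z) (hpart (\<gamma> z)) (hpart (\<gamma> z)) = 0"
    unfolding \<gamma>(3)[of z, THEN arg_cong, of "\<lambda>\<beta>. cometric g\<^sub>1 (fst z) \<beta> (hpart (\<gamma> z))"]
    by (simp add: S_def cometric_warped \<gamma>(2) G1.cometric_simps G2.cometric_simps)
  from G1.cometric_eq_0[OF this] show ?thesis
    unfolding \<gamma>(3) by (simp add: \<pi>_def)
qed

lemma D_hform:
  assumes "one_form M\<^sub>1 \<omega>" "one_form M\<^sub>1 \<eta>"
  shows "D (hform \<omega>) (hform \<eta>) = hform (D\<^sub>h q \<omega> \<eta>)"
proof (rule ext, rule covec_prod_eqI)
  fix z
  show "hpart (D (hform \<omega>) (hform \<eta>) z) = hpart (hform (D\<^sub>h q \<omega> \<eta>) z)"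
    using D\<^sub>h_independent[OF assms, of "snd z" "fst z" q] by (simp add: D\<^sub>h_def)
  show "vpart (D (hform \<omega>) (hform \<eta>) z) = vpart (hform (D\<^sub>h q \<omega> \<eta>) z)"
    by (simp add: vpart_D_hform[OF assms])
qed

lemma curvature_hform:
  assumes "one_form M\<^sub>1 \<omega>" "one_form M\<^sub>1 \<eta>" "one_form M\<^sub>1 \<gamma>"
  shows "curvature N Q D (hform \<omega>) (hform \<eta>) (hform \<gamma>) z = hform (curvature M\<^sub>1 P\<^sub>1 (D\<^sub>h q) \<omega> \<eta> \<gamma>) z"
proof -
  have bracket: "form_bracket N Q (hform \<omega>) (hform \<eta>) = hform (form_bracket M\<^sub>1 P\<^sub>1 \<omega> \<eta>)"
    by (rule ext) (simp add: bracket_hh assms hform_def)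
  have "form_bracket M\<^sub>1 P\<^sub>1 \<omega> \<eta> = (\<lambda>p. D\<^sub>h q \<omega> \<eta> p - D\<^sub>h q \<eta> \<omega> p)"
    by (rule ext) (simp add: D\<^sub>h_torsion assms)
  then have "one_form M\<^sub>1 (form_bracket M\<^sub>1 P\<^sub>1 \<omega> \<eta>)"
    by (simp add: M1.one_form_diff D\<^sub>h_form assms)
  then show ?thesis
    by (simp add: curvature_def bracket D_hform[where q = q] D\<^sub>h_form assms hform_def lift_linear)
qed

text \<open>
  Every axiom on \<open>M\<^sub>1\<close> is the corresponding axiom on the product for pulled back arguments.
\<close>

lemma levi_civita_fst: "contravariant_levi_civita M\<^sub>1 P\<^sub>1 g\<^sub>1 (D\<^sub>h q)"
  unfolding contravariant_levi_civita_def contravariant_connection_def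
proof (intro conjI allI impI)
  fix \<omega> \<omega>' \<eta> a b p assume "one_form M\<^sub>1 \<omega>" "one_form M\<^sub>1 \<omega>'" "one_form M\<^sub>1 \<eta>"
  then show "D\<^sub>h q (\<lambda>q. a *\<^sub>R \<omega> q + b *\<^sub>R \<omega>' q) \<eta> p = a *\<^sub>R D\<^sub>h q \<omega> \<eta> p + b *\<^sub>R D\<^sub>h q \<omega>' \<eta> p"
    by (simp add: D\<^sub>h_def hform_linear D_linear_left one_form_hform)
next
  fix \<omega> \<eta> \<eta>' a b p assume "one_form M\<^sub>1 \<omega>" "one_form M\<^sub>1 \<eta>" "one_form M\<^sub>1 \<eta>'"
  then show "D\<^sub>h q \<omega> (\<lambda>q. a *\<^sub>R \<eta> q + b *\<^sub>R \<eta>' q) p = a *\<^sub>R D\<^sub>h q \<omega> \<eta> p + b *\<^sub>R D\<^sub>h q \<omega> \<eta>' p"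
    by (simp add: D\<^sub>h_def hform_linear D_linear_right one_form_hform)
next
  fix h \<omega> \<eta> p assume "smooth_function M\<^sub>1 h" "one_form M\<^sub>1 \<omega>" "one_form M\<^sub>1 \<eta>"
  then show "D\<^sub>h q (\<lambda>q. h q *\<^sub>R \<omega> q) \<eta> p = h p *\<^sub>R D\<^sub>h q \<omega> \<eta> p"
    by (simp add: D\<^sub>h_def hform_scaleR D_scale_left one_form_hform smooth_function_fst)
next
  fix h \<omega> \<eta> p assume h: "smooth_function M\<^sub>1 h" and "one_form M\<^sub>1 \<omega>" "one_form M\<^sub>1 \<eta>"
  moreover have "(h \<circ> chart_inv M\<^sub>1 p) differentiable (at (chart M\<^sub>1 p p))"
    using M1.smooth_function_has_derivative[OF h] unfolding differentiable_def by blast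
  ultimately show "D\<^sub>h q \<omega> (\<lambda>q. h q *\<^sub>R \<eta> q) p = h p *\<^sub>R D\<^sub>h q \<omega> \<eta> p + differential M\<^sub>1 h p (sharp P\<^sub>1 \<omega> p) *\<^sub>R \<eta> p"
    by (simp add: D\<^sub>h_def hform_scaleR D_leibniz one_form_hform smooth_function_fst differential_fst sharp_hform)
qed (simp_all only: D\<^sub>h_form D\<^sub>h_torsion D\<^sub>h_metric)

lemma levi_civita_snd:
  assumes "\<nu> p \<noteq> 0"
  shows "contravariant_levi_civita M\<^sub>2 P\<^sub>2 g\<^sub>2 (\<lambda>\<omega> \<eta> q. (1 / \<nu> p) *\<^sub>R D\<^sub>v p \<omega> \<eta> q)"
  unfolding contravariant_levi_civita_def contravariant_connection_def
proof (intro conjI allI impI)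
  fix \<omega> \<eta> assume "one_form M\<^sub>2 \<omega>" "one_form M\<^sub>2 \<eta>"
  then show "one_form M\<^sub>2 (\<lambda>q. (1 / \<nu> p) *\<^sub>R D\<^sub>v p \<omega> \<eta> q)"
    by (intro M2.one_form_scaleR M2.smooth_function_const D\<^sub>v_form)
next
  fix \<omega> \<omega>' \<eta> a b q assume "one_form M\<^sub>2 \<omega>" "one_form M\<^sub>2 \<omega>'" "one_form M\<^sub>2 \<eta>"
  then show "(1 / \<nu> p) *\<^sub>R D\<^sub>v p (\<lambda>q. a *\<^sub>R \<omega> q + b *\<^sub>R \<omega>' q) \<eta> q =
      a *\<^sub>R (1 / \<nu> p) *\<^sub>R D\<^sub>v p \<omega> \<eta> q + b *\<^sub>R (1 / \<nu> p) *\<^sub>R D\<^sub>v p \<omega>' \<eta> q"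
    by (simp add: D\<^sub>v_def vform_linear D_linear_left one_form_vform scaleR_add_right mult.commute)
next
  fix \<omega> \<eta> \<eta>' a b q assume "one_form M\<^sub>2 \<omega>" "one_form M\<^sub>2 \<eta>" "one_form M\<^sub>2 \<eta>'"
  then show "(1 / \<nu> p) *\<^sub>R D\<^sub>v p \<omega> (\<lambda>q. a *\<^sub>R \<eta> q + b *\<^sub>R \<eta>' q) q =
      a *\<^sub>R (1 / \<nu> p) *\<^sub>R D\<^sub>v p \<omega> \<eta> q + b *\<^sub>R (1 / \<nu> p) *\<^sub>R D\<^sub>v p \<omega> \<eta>' q"
    by (simp add: D\<^sub>v_def vform_linear D_linear_right one_form_vform scaleR_add_right mult.commute)
next
  fix h \<omega> \<eta> q assume "smooth_function M\<^sub>2 h" "one_form M\<^sub>2 \<omega>" "one_form M\<^sub>2 \<eta>"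
  then show "(1 / \<nu> p) *\<^sub>R D\<^sub>v p (\<lambda>q. h q *\<^sub>R \<omega> q) \<eta> q = h q *\<^sub>R (1 / \<nu> p) *\<^sub>R D\<^sub>v p \<omega> \<eta> q"
    by (simp add: D\<^sub>v_def vform_scaleR D_scale_left one_form_vform smooth_function_snd)
next
  fix h \<omega> \<eta> q assume h: "smooth_function M\<^sub>2 h" and "one_form M\<^sub>2 \<omega>" "one_form M\<^sub>2 \<eta>"
  moreover have "(h \<circ> chart_inv M\<^sub>2 q) differentiable (at (chart M\<^sub>2 q q))"
    using M2.smooth_function_has_derivative[OF h] unfolding differentiable_def by blast
  ultimately show "(1 / \<nu> p) *\<^sub>R D\<^sub>v p \<omega> (\<lambda>q. h q *\<^sub>R \<eta> q) q =
      h q *\<^sub>R (1 / \<nu> p) *\<^sub>R D\<^sub>v p \<omega> \<eta> q + differential M\<^sub>2 h q (sharp P\<^sub>2 \<omega> q) *\<^sub>R \<eta> q"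
    using assms
    by (simp add: D\<^sub>v_def vform_scaleR D_leibniz one_form_vform smooth_function_snd differential_snd sharp_vform blinfun.scaleR_right scaleR_add_right)
next
  fix \<omega> \<eta> q assume "one_form M\<^sub>2 \<omega>" "one_form M\<^sub>2 \<eta>"
  then show "(1 / \<nu> p) *\<^sub>R D\<^sub>v p \<omega> \<eta> q - (1 / \<nu> p) *\<^sub>R D\<^sub>v p \<eta> \<omega> q = form_bracket M\<^sub>2 P\<^sub>2 \<omega> \<eta> q"
    using assms by (simp add: scaleR_diff_right[symmetric] D\<^sub>v_torsion)
next
  fix \<omega> \<eta> \<gamma> q assume "one_form M\<^sub>2 \<omega>" "one_form M\<^sub>2 \<eta>" "one_form M\<^sub>2 \<gamma>"
  from D\<^sub>v_metric[OF this, of p q] show "differential M\<^sub>2 (\<lambda>q. cometric g\<^sub>2 q (\<eta> q) (\<gamma> q)) q (sharp P\<^sub>2 \<omega> q) =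
      cometric g\<^sub>2 q ((1 / \<nu> p) *\<^sub>R D\<^sub>v p \<omega> \<eta> q) (\<gamma> q) + cometric g\<^sub>2 q (\<eta> q) ((1 / \<nu> p) *\<^sub>R D\<^sub>v p \<omega> \<gamma> q)"
    using assms by (simp add: G2.cometric_simps field_simps)
qed

text \<open>
  Each of the three terms of the curvature contributes its counterpart on \<open>M\<^sub>2\<close>, scaled by \<open>\<nu>\<^sup>2/f\<^sup>2\<close>. With
  \<open>\<pi> = \<Pi>\<^sub>2(\<omega>,\<eta>)\<close>, the horizontal component \<open>1/2 \<pi> (d\<nu>)\<^sup>h\<close> of \<open>D \<omega>\<^sup>v \<eta>\<^sup>v\<close> contributes \<open>- 1/4 \<pi>\<^sup>2 |d\<nu>|\<^sup>2\<close> in the second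
  term, and the horizontal component \<open>\<pi> (d\<nu>)\<^sup>h\<close> of the bracket contributes \<open>- 1/2 \<pi>\<^sup>2 |d\<nu>|\<^sup>2\<close> in the third.
\<close>

lemma curvature_vform:
  assumes D\<^sub>2: "contravariant_levi_civita M\<^sub>2 P\<^sub>2 g\<^sub>2 D\<^sub>2"
    and \<omega>: "one_form M\<^sub>2 \<omega>" and \<eta>: "one_form M\<^sub>2 \<eta>"
  shows "cometric W (p, q) (curvature N Q D (vform \<omega>) (vform \<eta>) (vform \<eta>) (p, q)) (vform \<omega> (p, q)) =
    (\<nu> p)\<^sup>2 / (f p)\<^sup>2 * cometric g\<^sub>2 q (curvature M\<^sub>2 P\<^sub>2 D\<^sub>2 \<omega> \<eta> \<eta> q) (\<omega> q)
    - 3/4 * (P\<^sub>2 q (\<omega> q) (\<eta> q))\<^sup>2 * cometric g\<^sub>1 p (differential M\<^sub>1 \<nu> p) (differential M\<^sub>1 \<nu> p)"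
proof -
  let ?z = "(p, q)"
  let ?A = "differential M\<^sub>1 \<nu>"
  define \<pi> where "\<pi> = (\<lambda>y::'a \<times> 'b. P\<^sub>2 (snd y) (\<omega> (snd y)) (\<eta> (snd y)))"
  define n where "n = (\<lambda>y::'a \<times> 'b. \<nu> (fst y))"
  note D2_form = levi_civita_form[OF D\<^sub>2] and D2_torsion = levi_civita_torsion[OF D\<^sub>2]
    and D2_metric = levi_civita_metric[OF D\<^sub>2]
  have Dv: "D\<^sub>v x a b y = \<nu> x *\<^sub>R D\<^sub>2 a b y" if "one_form M\<^sub>2 a" "one_form M\<^sub>2 b" for x y a b
    by (rule D\<^sub>v_eq_scaleR) (simp_all add: that D2_form M2.one_form_scaleR M2.smooth_function_const D2_torsion D2_metric)
  have DV: "vpart (D (vform a) (vform b) z) = n z *\<^sub>R D\<^sub>2 a b (snd z)" if "one_form M\<^sub>2 a" "one_form M\<^sub>2 b" for a b z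
    using Dv[OF that, of "fst z" "snd z"] by (simp add: D\<^sub>v_def n_def)
  have DF: "D (vform a) (vform b) =
      (\<lambda>z. n z *\<^sub>R vform (D\<^sub>2 a b) z + (1/2 * P\<^sub>2 (snd z) (a (snd z)) (b (snd z))) *\<^sub>R hform ?A z)"
    if "one_form M\<^sub>2 a" "one_form M\<^sub>2 b" for a b
    by (rule ext, rule covec_prod_eqI) (simp_all add: DV[OF that] hpart_D_vform[OF that])
  have np: "n ?z = \<nu> p"
    by (simp add: n_def)
  have n: "smooth_function N n"
    unfolding n_def by (rule smooth_function_fst[OF \<nu>])
  have \<pi>: "smooth_function N \<pi>"
    unfolding \<pi>_def by (intro smooth_function_snd M2.smooth_function_pairing[OF P\<^sub>2 \<omega> \<eta>])
  have \<pi>2: "smooth_function N (\<lambda>z. 1/2 * \<pi> z)"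
    by (intro N.smooth_function_mult N.smooth_function_const \<pi>)
  have A: "one_form M\<^sub>1 ?A"
    by (rule M1.one_form_differential[OF \<nu>])
  have dn: "differential N n z (sharp Q (vform a) z) = 0" for a z
  proof -
    have "(\<nu> \<circ> chart_inv M\<^sub>1 (fst z)) differentiable (at (chart M\<^sub>1 (fst z) (fst z)))"
      using M1.smooth_function_has_derivative[OF \<nu>] unfolding differentiable_def by blast
    from differential_fst[OF this, of "snd z"] show ?thesis
      by (simp add: n_def sharp_vform)
  qed
  have Dn: "D (vform a) (\<lambda>z. n z *\<^sub>R vform b z) z = n z *\<^sub>R D (vform a) (vform b) z"
    if "one_form M\<^sub>2 a" "one_form M\<^sub>2 b" for a b z
    by (simp add: D_leibniz[OF n one_form_vform[OF that(1)] one_form_vform[OF that(2)]] dn)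
  \<comment> \<open>The metric identity moves the derivative onto \<open>\<omega>\<^sup>v\<close>, where the horizontal part is known.\<close>
  have mixed: "cometric W ?z (D (vform \<eta>) (hform ?A) ?z) (vform \<omega> ?z) = 1/2 * \<pi> ?z * cometric g\<^sub>1 p (?A p) (?A p)"
  proof -
    have "cometric W ?z (D (vform \<eta>) (hform ?A) ?z) (vform \<omega> ?z) = - cometric W ?z (hform ?A ?z) (D (vform \<eta>) (vform \<omega>) ?z)"
      using D_metric[OF one_form_vform[OF \<eta>] one_form_hform[OF A] one_form_vform[OF \<omega>], of ?z]
      by (simp add: cometric_warped G1.cometric_simps G2.cometric_simps differential_zero)
    also have "\<dots> = 1/2 * \<pi> ?z * cometric g\<^sub>1 p (?A p) (?A p)"
      using M2.bivector_skew[OF P\<^sub>2, of q "\<eta> q" "\<omega> q"]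
      by (simp add: cometric_warped hpart_D_vform[OF \<eta> \<omega>] G1.cometric_simps G2.cometric_simps \<pi>_def
            del: scaleR_minus_left)
    finally show ?thesis .
  qed
  have mixed': "cometric W ?z (D (hform ?A) (vform \<eta>) ?z) (vform \<omega> ?z) = 1/2 * \<pi> ?z * cometric g\<^sub>1 p (?A p) (?A p)"
  proof -
    have "vpart (D (vform \<eta>) (hform ?A) ?z - D (hform ?A) (vform \<eta>) ?z) = 0"
      unfolding D_torsion[OF one_form_vform[OF \<eta>] one_form_hform[OF A]]
      by (rule vpart_bracket_vform[OF \<eta> one_form_hform[OF A]]) simp
    then have "vpart (D (hform ?A) (vform \<eta>) ?z) = vpart (D (vform \<eta>) (hform ?A) ?z)"
      by simp
    then show ?thesis
      using mixed by (simp add: cometric_warped G1.cometric_simps)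
  qed
  have vert: "cometric W ?z \<alpha> (vform \<omega> ?z) = 1 / (f p)\<^sup>2 * cometric g\<^sub>2 q (vpart \<alpha>) (\<omega> q)" for \<alpha>
    by (simp add: cometric_warped G1.cometric_simps)
  have first: "cometric W ?z (D (vform \<omega>) (D (vform \<eta>) (vform \<eta>)) ?z) (vform \<omega> ?z) =
      (\<nu> p)\<^sup>2 / (f p)\<^sup>2 * cometric g\<^sub>2 q (D\<^sub>2 \<omega> (D\<^sub>2 \<eta> \<eta>) q) (\<omega> q)"
  proof -
    have "P\<^sub>2 y (\<eta> y) (\<eta> y) = 0" for y
      using P\<^sub>2 by (simp add: bivector_field_def)
    then have "D (vform \<eta>) (vform \<eta>) = (\<lambda>z. n z *\<^sub>R vform (D\<^sub>2 \<eta> \<eta>) z)"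
      by (simp add: DF[OF \<eta> \<eta>])
    then show ?thesis
      by (simp add: vert Dn \<omega> \<eta> D2_form DV G2.cometric_simps np power2_eq_square)
  qed
  have second: "cometric W ?z (D (vform \<eta>) (D (vform \<omega>) (vform \<eta>)) ?z) (vform \<omega> ?z) =
      (\<nu> p)\<^sup>2 / (f p)\<^sup>2 * cometric g\<^sub>2 q (D\<^sub>2 \<eta> (D\<^sub>2 \<omega> \<eta>) q) (\<omega> q) + 1/4 * (\<pi> ?z)\<^sup>2 * cometric g\<^sub>1 p (?A p) (?A p)"
  proof -
    have form: "D (vform \<omega>) (vform \<eta>) = (\<lambda>z. n z *\<^sub>R vform (D\<^sub>2 \<omega> \<eta>) z + (1/2 * \<pi> z) *\<^sub>R hform ?A z)"
      by (simp add: DF[OF \<omega> \<eta>] \<pi>_def)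
    have "D (vform \<eta>) (D (vform \<omega>) (vform \<eta>)) ?z =
        n ?z *\<^sub>R D (vform \<eta>) (vform (D\<^sub>2 \<omega> \<eta>)) ?z +
        ((1/2 * \<pi> ?z) *\<^sub>R D (vform \<eta>) (hform ?A) ?z + differential N (\<lambda>z. 1/2 * \<pi> z) ?z (sharp Q (vform \<eta>) ?z) *\<^sub>R hform ?A ?z)"
      unfolding form
      by (subst D_add_right)
         (intro one_form_vform \<eta> N.one_form_scaleR n \<pi>2 D2_form \<omega> one_form_hform A
           | simp only: Dn[OF \<eta> D2_form[OF \<omega> \<eta>]] D_leibniz[OF \<pi>2 one_form_vform[OF \<eta>] one_form_hform[OF A]])+
    then show ?thesis
      using mixed
      by (simp only: W.cometric_simps) (simp add: vert DV \<omega> \<eta> D2_form G2.cometric_simps np power2_eq_square)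
  qed
  have third: "cometric W ?z (D (form_bracket N Q (vform \<omega>) (vform \<eta>)) (vform \<eta>) ?z) (vform \<omega> ?z) =
      (\<nu> p)\<^sup>2 / (f p)\<^sup>2 * cometric g\<^sub>2 q (D\<^sub>2 (form_bracket M\<^sub>2 P\<^sub>2 \<omega> \<eta>) \<eta> q) (\<omega> q) + 1/2 * (\<pi> ?z)\<^sup>2 * cometric g\<^sub>1 p (?A p) (?A p)"
  proof -
    have form: "form_bracket N Q (vform \<omega>) (vform \<eta>) = (\<lambda>z. n z *\<^sub>R vform (form_bracket M\<^sub>2 P\<^sub>2 \<omega> \<eta>) z + \<pi> z *\<^sub>R hform ?A z)"
      by (rule ext) (simp add: bracket_vv \<omega> \<eta> n_def \<pi>_def)
    have "form_bracket M\<^sub>2 P\<^sub>2 \<omega> \<eta> = (\<lambda>q. D\<^sub>2 \<omega> \<eta> q - D\<^sub>2 \<eta> \<omega> q)"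
      by (rule ext) (simp add: D2_torsion \<omega> \<eta>)
    then have br: "one_form M\<^sub>2 (form_bracket M\<^sub>2 P\<^sub>2 \<omega> \<eta>)"
      by (simp add: M2.one_form_diff D2_form \<omega> \<eta>)
    have "D (form_bracket N Q (vform \<omega>) (vform \<eta>)) (vform \<eta>) ?z =
        n ?z *\<^sub>R D (vform (form_bracket M\<^sub>2 P\<^sub>2 \<omega> \<eta>)) (vform \<eta>) ?z + \<pi> ?z *\<^sub>R D (hform ?A) (vform \<eta>) ?z"
      unfolding form
      by (subst D_add_left)
         (intro one_form_vform \<eta> N.one_form_scaleR n \<pi> br one_form_hform A
           | simp only: D_scale_left[OF n one_form_vform[OF br] one_form_vform[OF \<eta>]] D_scale_left[OF \<pi> one_form_hform[OF A] one_form_vform[OF \<eta>]])+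
    then show ?thesis
      using mixed'
      by (simp only: W.cometric_simps) (simp add: vert DV br \<eta> G2.cometric_simps np power2_eq_square)
  qed
  show ?thesis
    unfolding curvature_def W.cometric_diff_left G2.cometric_diff_left first second third
    by (simp add: \<pi>_def algebra_simps)
qed

lemma curvature_vform_vanishing:
  assumes "\<And>p. \<nu> p = 0" "one_form M\<^sub>2 \<omega>" "one_form M\<^sub>2 \<eta>"
  shows "curvature N Q D (vform \<omega>) (vform \<eta>) (vform \<eta>) z = 0"
proof -
  have "differential M\<^sub>1 \<nu> p = 0" for p
  proof -
    have "\<nu> = (\<lambda>_. 0)" using assms(1) by (rule ext)
    then show ?thesis
      using M1.differentialI[of "\<lambda>_. 0" p "\<lambda>_. 0"] by (intro blinfun_eqI) (simp add: o_def)
  qed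
  moreover have "vpart (D (vform a) (vform b) z) = 0" if "one_form M\<^sub>2 a" "one_form M\<^sub>2 b" for z a b
  proof -
    have "D\<^sub>v (fst z) a b (snd z) = \<nu> (fst z) *\<^sub>R D\<^sub>v (fst z) a b (snd z)"
      by (rule D\<^sub>v_eq_scaleR) (simp_all add: assms(1) M2.one_form_zero that)
    then show ?thesis by (simp add: assms(1) D\<^sub>v_def)
  qed
  ultimately have zero: "D (vform a) (vform b) = (\<lambda>_. 0)" if "one_form M\<^sub>2 a" "one_form M\<^sub>2 b" for a b
    by (intro ext covec_prod_eqI) (use that in \<open>simp_all add: hpart_D_vform\<close>)
  have "form_bracket N Q (vform \<omega>) (vform \<eta>) = (\<lambda>z. D (vform \<omega>) (vform \<eta>) z - D (vform \<eta>) (vform \<omega>) z)"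
    by (rule ext) (simp add: D_torsion one_form_vform assms)
  then have bracket: "form_bracket N Q (vform \<omega>) (vform \<eta>) = (\<lambda>_. 0)"
    by (simp add: zero assms)
  have "D (vform a) (\<lambda>_. 0) z = 0" if "one_form M\<^sub>2 a" for a
    using D_linear_right[of "vform a" "\<lambda>_. 0" "\<lambda>_. 0" 0 0 z] that by (simp add: one_form_vform N.one_form_zero)
  moreover have "D (\<lambda>_. 0) (vform \<eta>) z = 0"
    using D_linear_left[of "\<lambda>_. 0" "\<lambda>_. 0" "vform \<eta>" 0 0 z] assms by (simp add: one_form_vform N.one_form_zero)
  ultimately show ?thesis
    by (simp add: curvature_def zero bracket assms)
qed

end

section \<open>Positive sectional curvature\<close>

lemma independent_pair_image:
  assumes "linear L" "inj L" "\<alpha> \<noteq> \<beta>" "independent {\<alpha>, \<beta>}"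
  shows "L \<alpha> \<noteq> L \<beta>" "independent {L \<alpha>, L \<beta>}"
proof -
  show "L \<alpha> \<noteq> L \<beta>"
    using assms(2,3) by (auto dest: injD)
  have "independent (L ` {\<alpha>, \<beta>})"
    by (rule linear_independent_injective_image[OF assms(1,4) inj_on_subset[OF assms(2) subset_UNIV]])
  then show "independent {L \<alpha>, L \<beta>}" by simp
qed

lemma inj_lift: "inj hlift" "inj vlift"
  by (rule inj_on_inverseI[of _ hpart], simp, rule inj_on_inverseI[of _ vpart], simp)

text \<open>
  If \<open>\<nu> = 0\<close>, positive curvature of the product leaves no independent pair of covectors on \<open>M\<^sub>2\<close>. The following two
  lemmas supply a connection on \<open>M\<^sub>2\<close> in this case.
\<close>

lemma bivector_zero_of_dependent:
  fixes b :: "'v::real_normed_vector \<Rightarrow>\<^sub>L 'v \<Rightarrow>\<^sub>L real"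
  assumes "\<And>\<alpha>. b \<alpha> \<alpha> = 0" "\<And>\<alpha> \<beta> :: 'v. \<alpha> \<noteq> \<beta> \<Longrightarrow> \<not> independent {\<alpha>, \<beta>}"
  shows "b = 0"
proof -
  have "b \<alpha> \<beta> = 0" for \<alpha> \<beta>
  proof (cases "\<alpha> = \<beta> \<or> \<beta> = 0")
    case True
    then show ?thesis using assms(1) by (auto simp: blinfun.zero_right)
  next
    case False
    have "\<alpha> \<in> span {\<beta>}"
    proof (rule ccontr)
      assume "\<alpha> \<notin> span {\<beta>}"
      then have "independent {\<alpha>, \<beta>}"
        using False by (intro independent_insertI) (simp_all add: independent_empty)
      moreover have "\<not> independent {\<alpha>, \<beta>}"
        using False by (intro assms(2)) simp
      ultimately show False by (rule notE[rotated])
    qed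
    then obtain k where "\<alpha> = k *\<^sub>R \<beta>"
      by (auto simp: span_singleton)
    then show ?thesis using assms(1) by (simp add: blinfun.scaleR_left blinfun.scaleR_right)
  qed
  then show ?thesis
    by (intro blinfun_eqI) simp
qed

lemma (in framed_manifold) levi_civita_zero_bivector:
  assumes g: "inner_metric g" and P: "bivector_field M P" and zero: "\<And>q. P q = 0"
  shows "contravariant_levi_civita M P g (\<lambda>_ _ _. 0)"
proof -
  have sharp: "sharp P \<omega> p = 0" for \<omega> p
    by (rule vector_eqI) (simp add: apply_sharp zero blinfun.zero_right)
  have rep: "bivector_rep M c P = (\<lambda>_. 0)" for c
    by (intro ext blinfun_eqI) (simp add: bivector_rep_apply zero)
  have "form_bracket M P \<omega> \<eta> p = 0" if "one_form M \<omega>" "one_form M \<eta>" for \<omega> \<eta> p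
    by (rule blinfun_eqI)
       (simp add: form_bracket_apply[OF P that] sharp rep
         linear_0[OF has_derivative_linear[OF one_form_has_derivative[OF that(1)]]]
         linear_0[OF has_derivative_linear[OF one_form_has_derivative[OF that(2)]]])
  then show ?thesis
    unfolding contravariant_levi_civita_def contravariant_connection_def
    by (simp add: sharp one_form_zero inner_metric.cometric_zero_left[OF g] inner_metric.cometric_zero_right[OF g])
qed

context warped_levi_civita
begin

lemma sectional_curvature_hform:
  assumes "one_form M\<^sub>1 \<omega>" "one_form M\<^sub>1 \<eta>"
  shows "sectional_curvature N Q W D (hform \<omega>) (hform \<eta>) (p, q) = sectional_curvature M\<^sub>1 P\<^sub>1 g\<^sub>1 (D\<^sub>h q) \<omega> \<eta> p"
  by (simp add: sectional_curvature_def curvature_hform[where q = q] assms cometric_warped G2.cometric_simps)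

text \<open>
  A positive quotient has a nonzero denominator, as division by zero gives zero. Together with the Cauchy--Schwarz
  inequality this makes the denominator positive, and the sign of the numerator is that of the sectional curvature.
\<close>

lemma sectional_curvature_vform:
  assumes D\<^sub>2: "contravariant_levi_civita M\<^sub>2 P\<^sub>2 g\<^sub>2 D\<^sub>2"
    and forms: "one_form M\<^sub>2 \<omega>" "one_form M\<^sub>2 \<eta>"
    and pos: "sectional_curvature N Q W D (vform \<omega>) (vform \<eta>) (p, q) > 0"
  shows "sectional_curvature M\<^sub>2 P\<^sub>2 g\<^sub>2 D\<^sub>2 \<omega> \<eta> q > 0"
proof -
  let ?n = "cometric g\<^sub>2 q (curvature M\<^sub>2 P\<^sub>2 D\<^sub>2 \<omega> \<eta> \<eta> q) (\<omega> q)"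
  let ?d = "cometric g\<^sub>2 q (\<omega> q) (\<omega> q) * cometric g\<^sub>2 q (\<eta> q) (\<eta> q) - (cometric g\<^sub>2 q (\<omega> q) (\<eta> q))\<^sup>2"
  let ?A = "differential M\<^sub>1 \<nu> p"
  have "sectional_curvature N Q W D (vform \<omega>) (vform \<eta>) (p, q) =
      ((\<nu> p)\<^sup>2 / (f p)\<^sup>2 * ?n - 3/4 * (P\<^sub>2 q (\<omega> q) (\<eta> q))\<^sup>2 * cometric g\<^sub>1 p ?A ?A) / ((1 / (f p)\<^sup>2)\<^sup>2 * ?d)"
    unfolding sectional_curvature_def curvature_vform[OF D\<^sub>2 forms]
    by (simp add: cometric_warped G1.cometric_simps power2_eq_square algebra_simps diff_divide_distrib)
  then have pos': "((\<nu> p)\<^sup>2 / (f p)\<^sup>2 * ?n - 3/4 * (P\<^sub>2 q (\<omega> q) (\<eta> q))\<^sup>2 * cometric g\<^sub>1 p ?A ?A) / ((1 / (f p)\<^sup>2)\<^sup>2 * ?d) > 0"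
    using pos by simp
  have "?d \<ge> 0"
    using G2.cometric_Cauchy_Schwarz[of q "\<omega> q" "\<eta> q"] by simp
  moreover have "?d \<noteq> 0"
    using pos' by auto
  ultimately have d: "?d > 0" by simp
  then have "(1 / (f p)\<^sup>2)\<^sup>2 * ?d > 0"
    using f_pos[of p] by (intro mult_pos_pos) simp_all
  with pos' have "(\<nu> p)\<^sup>2 / (f p)\<^sup>2 * ?n - 3/4 * (P\<^sub>2 q (\<omega> q) (\<eta> q))\<^sup>2 * cometric g\<^sub>1 p ?A ?A > 0"
    unfolding zero_less_divide_iff by linarith
  moreover have "3/4 * (P\<^sub>2 q (\<omega> q) (\<eta> q))\<^sup>2 * cometric g\<^sub>1 p ?A ?A \<ge> 0"
    by (intro mult_nonneg_nonneg G1.cometric_nonneg) auto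
  ultimately have prod: "(\<nu> p)\<^sup>2 / (f p)\<^sup>2 * ?n > 0"
    by linarith
  have "?n > 0"
  proof (rule ccontr)
    assume "\<not> ?n > 0"
    then have "(\<nu> p)\<^sup>2 / (f p)\<^sup>2 * ?n \<le> 0"
      by (intro mult_nonneg_nonpos) auto
    with prod show False by linarith
  qed
  with d show ?thesis
    by (simp add: sectional_curvature_def)
qed

end

theorem theorem3p2:
  fixes M\<^sub>1 :: "('a::{t2_space,second_countable_topology}, 'e::real_normed_vector) manifold"
    and M\<^sub>2 :: "('b::{t2_space,second_countable_topology}, 'f::real_normed_vector) manifold"
    and P\<^sub>1 :: "'a \<Rightarrow> 'e covec \<Rightarrow>\<^sub>L 'e covec \<Rightarrow>\<^sub>L real"
    and P\<^sub>2 :: "'b \<Rightarrow> 'f covec \<Rightarrow>\<^sub>L 'f covec \<Rightarrow>\<^sub>L real"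
    and g\<^sub>1 :: "'a \<Rightarrow> 'e \<Rightarrow>\<^sub>L 'e \<Rightarrow>\<^sub>L real"
    and g\<^sub>2 :: "'b \<Rightarrow> 'f \<Rightarrow>\<^sub>L 'f \<Rightarrow>\<^sub>L real"
    and f\<^sub>1 \<nu>\<^sub>1 :: "'a \<Rightarrow> real"
  assumes "smooth_manifold M\<^sub>1" and "smooth_manifold M\<^sub>2"
    and "poisson_tensor M\<^sub>1 P\<^sub>1" and "poisson_tensor M\<^sub>2 P\<^sub>2"
    and "riemannian_metric M\<^sub>1 g\<^sub>1" and "riemannian_metric M\<^sub>2 g\<^sub>2"
    and "smooth_function M\<^sub>1 f\<^sub>1" and "\<forall>p. f\<^sub>1 p > 0"
    and "smooth_function M\<^sub>1 \<nu>\<^sub>1"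
    and "poisson_tensor (prod_manifold M\<^sub>1 M\<^sub>2) (warped_bivector P\<^sub>1 \<nu>\<^sub>1 P\<^sub>2)"
    and "casimir M\<^sub>1 P\<^sub>1 f\<^sub>1"
    and "positive_sectional_curvature (prod_manifold M\<^sub>1 M\<^sub>2)
           (warped_bivector P\<^sub>1 \<nu>\<^sub>1 P\<^sub>2) (warped_metric g\<^sub>1 f\<^sub>1 g\<^sub>2)"
  shows "poisson_tensor M\<^sub>1 P\<^sub>1 \<and> positive_sectional_curvature M\<^sub>1 P\<^sub>1 g\<^sub>1 \<and>
         poisson_tensor M\<^sub>2 P\<^sub>2 \<and> positive_sectional_curvature M\<^sub>2 P\<^sub>2 g\<^sub>2"
proof (intro conjI)
  show "poisson_tensor M\<^sub>1 P\<^sub>1" "poisson_tensor M\<^sub>2 P\<^sub>2"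
    by fact+
  let ?N = "prod_manifold M\<^sub>1 M\<^sub>2" and ?Q = "warped_bivector P\<^sub>1 \<nu>\<^sub>1 P\<^sub>2" and ?W = "warped_metric g\<^sub>1 f\<^sub>1 g\<^sub>2"
  have inner: "inner_form (g\<^sub>1 p)" "inner_form (g\<^sub>2 q)" for p q
    using assms(5,6) by (auto simp: riemannian_metric_def inner_form_def)
  have fin: "\<exists>A::'e set. finite A \<and> span A = UNIV" "\<exists>A::'f set. finite A \<and> span A = UNIV"
    using assms(1,2) by (auto simp: smooth_manifold_def)
  \<comment> \<open>The frames depend on the model spaces only; the metrics at arbitrary points provide them.\<close>
  obtain B\<^sub>1 where B\<^sub>1: "frame B\<^sub>1 (blinfun_apply (g\<^sub>1 undefined))"
    by (rule orthonormal_frame_exists[OF inner(1) fin(1)])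
  obtain B\<^sub>2 where B\<^sub>2: "frame B\<^sub>2 (blinfun_apply (g\<^sub>2 undefined))"
    by (rule orthonormal_frame_exists[OF inner(2) fin(2)])
  interpret M1: framed_manifold M\<^sub>1 B\<^sub>1 "blinfun_apply (g\<^sub>1 undefined)"
    using assms(1) B\<^sub>1 by unfold_locales
  interpret M2: framed_manifold M\<^sub>2 B\<^sub>2 "blinfun_apply (g\<^sub>2 undefined)"
    using assms(2) B\<^sub>2 by unfold_locales
  obtain B :: "('e \<times> 'f) set" and cd where "frame B cd"
    by (rule frame_Times[OF B\<^sub>1 B\<^sub>2])
  then interpret product_manifold M\<^sub>1 B\<^sub>1 "blinfun_apply (g\<^sub>1 undefined)" M\<^sub>2 B\<^sub>2 "blinfun_apply (g\<^sub>2 undefined)" B cd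
    by unfold_locales
  have metric\<^sub>1: "inner_metric g\<^sub>1" and metric\<^sub>2: "inner_metric g\<^sub>2"
    by (intro M1.riemannian_inner_metric M2.riemannian_inner_metric assms)+
  have bivectors: "bivector_field M\<^sub>1 P\<^sub>1" "bivector_field M\<^sub>2 P\<^sub>2" "bivector_field ?N ?Q"
    using assms(3,4,10) by (simp_all add: poisson_tensor_def)
  obtain D where D: "contravariant_levi_civita ?N ?Q ?W D"
    and pos: "\<And>z \<alpha> \<beta> \<omega> \<eta>. \<alpha> \<noteq> \<beta> \<Longrightarrow> independent {\<alpha>, \<beta>} \<Longrightarrow> one_form ?N \<omega> \<Longrightarrow> one_form ?N \<eta> \<Longrightarrow>
      \<omega> z = \<alpha> \<Longrightarrow> \<eta> z = \<beta> \<Longrightarrow> sectional_curvature ?N ?Q ?W D \<omega> \<eta> z > 0"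
    using assms(12) unfolding positive_sectional_curvature_def by blast
  interpret warped_levi_civita M\<^sub>1 B\<^sub>1 "blinfun_apply (g\<^sub>1 undefined)" M\<^sub>2 B\<^sub>2 "blinfun_apply (g\<^sub>2 undefined)" B cd
    P\<^sub>1 P\<^sub>2 g\<^sub>1 g\<^sub>2 f\<^sub>1 \<nu>\<^sub>1 D
    using bivectors assms(5-9) D M1.casimir_anchor[OF metric\<^sub>1 assms(11)] by unfold_locales auto
  have pos_h: "sectional_curvature ?N ?Q ?W D (hform \<omega>) (hform \<eta>) (p, q) > 0"
    if "\<omega> p \<noteq> \<eta> p" "independent {\<omega> p, \<eta> p}" "one_form M\<^sub>1 \<omega>" "one_form M\<^sub>1 \<eta>" for \<omega> \<eta> p q
    by (rule pos[OF independent_pair_image[OF bounded_linear.linear[OF bounded_linear_hlift] inj_lift(1) that(1,2)]]) (simp_all add: that one_form_hform hform_def)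
  have pos_v: "sectional_curvature ?N ?Q ?W D (vform \<omega>) (vform \<eta>) (p, q) > 0"
    if "\<omega> q \<noteq> \<eta> q" "independent {\<omega> q, \<eta> q}" "one_form M\<^sub>2 \<omega>" "one_form M\<^sub>2 \<eta>" for \<omega> \<eta> p q
    by (rule pos[OF independent_pair_image[OF bounded_linear.linear[OF bounded_linear_vlift] inj_lift(2) that(1,2)]]) (simp_all add: that one_form_vform vform_def)
  show "positive_sectional_curvature M\<^sub>1 P\<^sub>1 g\<^sub>1"
    unfolding positive_sectional_curvature_def
  proof (intro exI conjI allI impI)
    \<comment> \<open>All slices yield the same connection, so the choice of the slice is immaterial.\<close>
    show "contravariant_levi_civita M\<^sub>1 P\<^sub>1 g\<^sub>1 (D\<^sub>h undefined)"
      by (rule levi_civita_fst)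
    fix p \<alpha> \<beta> \<omega> \<eta>
    assume "\<alpha> \<noteq> \<beta> \<and> independent {\<alpha>, \<beta>}" "one_form M\<^sub>1 \<omega> \<and> one_form M\<^sub>1 \<eta> \<and> \<omega> p = \<alpha> \<and> \<eta> p = \<beta>"
    then show "sectional_curvature M\<^sub>1 P\<^sub>1 g\<^sub>1 (D\<^sub>h undefined) \<omega> \<eta> p > 0"
      using pos_h[of \<omega> p \<eta> undefined] by (simp add: sectional_curvature_hform)
  qed
  show "positive_sectional_curvature M\<^sub>2 P\<^sub>2 g\<^sub>2"
  proof (cases "\<exists>p. \<nu>\<^sub>1 p \<noteq> 0")
    case True
    then obtain p where "\<nu>\<^sub>1 p \<noteq> 0" by blast
    note lc = levi_civita_snd[OF this]
    show ?thesis
      unfolding positive_sectional_curvature_def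
    proof (intro exI conjI allI impI)
      show "contravariant_levi_civita M\<^sub>2 P\<^sub>2 g\<^sub>2 (\<lambda>\<omega> \<eta> q. (1 / \<nu>\<^sub>1 p) *\<^sub>R D\<^sub>v p \<omega> \<eta> q)"
        by (rule lc)
      fix q \<alpha> \<beta> \<omega> \<eta>
      assume "\<alpha> \<noteq> \<beta> \<and> independent {\<alpha>, \<beta>}" "one_form M\<^sub>2 \<omega> \<and> one_form M\<^sub>2 \<eta> \<and> \<omega> q = \<alpha> \<and> \<eta> q = \<beta>"
      then show "sectional_curvature M\<^sub>2 P\<^sub>2 g\<^sub>2 (\<lambda>\<omega> \<eta> q. (1 / \<nu>\<^sub>1 p) *\<^sub>R D\<^sub>v p \<omega> \<eta> q) \<omega> \<eta> q > 0"
        by (intro sectional_curvature_vform[OF lc _ _ pos_v]) auto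
    qed
  next
    case False
    \<comment> \<open>All cotangent spaces are the dual of the same model space, so a pair may be placed at any point.\<close>
    have dependent: "\<not> independent {\<alpha>, \<beta>}" if "\<alpha> \<noteq> \<beta>" for \<alpha> \<beta> :: "'f covec"
    proof
      assume ind: "independent {\<alpha>, \<beta>}"
      obtain \<omega> where \<omega>: "one_form M\<^sub>2 \<omega>" "\<omega> undefined = \<alpha>"
        by (rule M2.one_form_extension_exists[OF metric\<^sub>2])
      obtain \<eta> where \<eta>: "one_form M\<^sub>2 \<eta>" "\<eta> undefined = \<beta>"
        by (rule M2.one_form_extension_exists[OF metric\<^sub>2])
      have "sectional_curvature ?N ?Q ?W D (vform \<omega>) (vform \<eta>) (undefined, undefined) > 0"
        using pos_v[of \<omega> undefined \<eta> undefined] ind that \<omega> \<eta> by simp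
      moreover have "curvature ?N ?Q D (vform \<omega>) (vform \<eta>) (vform \<eta>) (undefined, undefined) = 0"
        using False by (intro curvature_vform_vanishing \<omega> \<eta>) auto
      ultimately show False
        by (simp add: sectional_curvature_def W.cometric_simps)
    qed
    have "P\<^sub>2 q = 0" for q
      by (rule bivector_zero_of_dependent) (use bivectors(2) dependent in \<open>auto simp: bivector_field_def\<close>)
    from M2.levi_civita_zero_bivector[OF metric\<^sub>2 bivectors(2) this] show ?thesis
      unfolding positive_sectional_curvature_def using dependent by blast
  qed
qed

end
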